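(* Let $P$ be a non-constant homogeneous polynomial in $\mathbb{C}^3$, let $Q_1,Q_2,Q_3$ be homogeneous polynomials in $\mathbb{C}^3$ of the same degree, and let $R$ be a homogeneous polynomial in $\mathbb{C}^3$ (none of these is necessarily irreducible) such that $\deg(R)=\deg(P)+\deg(Q_1)$ and $$P(1,1,1)\,Q_j(1,1,1)=R(1,1,1)\neq 0,\qquad j=1,2,3.$$ Assume that $PQ_1-R,\ PQ_2-R,\ PQ_3-R$ have no nontrivial common factor and that the meromorphic self-map of $\mathbb{P}^2$ $$f([z:w:t]):=[PQ_1-R:PQ_2-R:PQ_3-R]$$ is dominant. Suppose that: (a) for all $(a,b,c)\in\mathbb{C}^3\setminus\{0\}$ with $a+b+c=0$, every irreducible component of the hypersurface $\{aQ_1+bQ_2+cQ_3=0\}$ is sent by $f$ onto a hypersurface; (b) every irreducible component of the hypersurface $\{P=0\}$ is sent by $f^2$ onto a hypersurface; (c) if $\mathcal{G}$ is an irreducible hypersurface such that $f(\mathcal{G})=[1:1:1]$, then $\mathcal{G}\subset\{P=0\}$. Then $f$ satisfies the following properties: (i) $f$ has exactly one primitive degree lowering hypersurface, $\mathcal{H}_0$; (ii) denoting by $n_0$ the height of $\mathcal{H}_0$, for every irreducible component $\mathcal{H}$ of $\mathcal{H}_0$ and every $m=1,\ldots,n_0$, $f^m(\mathcal{H})\not\subset\mathcal{H}_0$; (iii) for every irreducible component $\mathcal{H}$ of $\mathcal{H}_0$, one of the following two conditions holds: either $f^m(\mathcal{H})\not\subset\mathcal{I}(f)$ for all $m\ge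 n_0+1$; or there is an $m_0\ge n_0$ such that $f^{m_0+1}(\mathcal{H})$ is a hypersurface and $f^m(\mathcal{H})\not\subset\mathcal{I}(f)$ for all $m$ with $n_0+1\le m\le m_0$. In particular, $f$ is quasi-algebraically stable.
   Context: A meromorphic self-map $f$ of $\mathbb{P}^k$ is written $f=[G_0:\ldots:G_k]$ with homogeneous polynomials of the same degree having no nontrivial common factor; $(G_0,\ldots,G_k)$ is called a lifting of $f$. It is dominant if its Jacobian determinant does not vanish identically in any local chart. $f^n$ denotes the $n$-th iterate as a meromorphic map. The indeterminacy locus $\mathcal{I}(f)$ is the common zero set in $\mathbb{P}^k$ of $G_0,\ldots,G_k$. For a hypersurface $\mathcal{H}$, $f^m(\mathcal{H})$ denotes the image of $\mathcal{H}$ under the meromorphic map $f^m$, i.e. the closure of $f^m(\mathcal{H}\setminus\mathcal{I}(f^m))$. A hypersurface $\mathcal{H}\subset\mathbb{P}^k$ is a degree lowering hypersurface of $f$ if, for some (smallest) $n\ge 1$, $f^n(\mathcal{H})\subset\mathcal{I}(f)$; this $n$ is called the height of $\mathcal{H}$. Primitive degree lowering hypersurfaces (known structure result): for a meromorphic self-map $f$ of $\mathbb{P}^k$ there are exactly an integer $M\ge 0$ and $M$ degree lowering (not necessarily irreducible) hypersurfaces $\mathcal{H}_j$ with heights $n_j$, $j=1,\ldots,M$, such that: all the $n_j$ are distinct; $\mathrm{codim}\, f^m(\mathcal{H}_j)>1$ for $m=1,\ldots,n_j$ and $j=1,\ldots,M$; and for any irreducible degree lowering hypersurface $\mathcal{H}$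 of $f$ there are integers $n\ge 0$ and $1\le j\le M$ such that $f^n(\mathcal{H})$ is a hypersurface and $f^n(\mathcal{H})\subset\mathcal{H}_j$. The $\mathcal{H}_j$ are called the primitive degree lowering hypersurfaces of $f$. $f$ is quasi-algebraically stable if there are an integer $n_0\ge1$ and a homogeneous polynomial $H$ of $k+1$ variables such that, with $F_0:=\mathrm{Id}$ and $F_1$ a fixed lifting of $f$, the following recursion defines a sequence of liftings $F_n$ of $f^n$ ($n\ge1$): $F_n=F_1\circ F_{n-1}$ for $n=1,\ldots,n_0$, and $F_n=\frac{F_1\circ F_{n-1}}{H\circ F_{n-n_0-1}}$ for $n>n_0$. It is a known theorem that any meromorphic self-map of $\mathbb{P}^k$ satisfying properties (i)–(iii) of the claim is quasi-algebraically stable. *)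

theory Defs
  imports "HOL-Analysis.Analysis"
begin

section \<open>Polynomials in several complex variables\<close>

text \<open>
  Polynomials are represented by the functions they induce on \<open>\<complex>\<^sup>n\<close>; since \<open>\<complex>\<close> is infinite, this
  loses nothing, and divisibility below is divisibility in the polynomial ring.
  The zero polynomial counts as homogeneous of every degree.
\<close>

definition monomial_fun :: "('n \<Rightarrow> nat) \<Rightarrow> complex ^ 'n::finite \<Rightarrow> complex" where
  "monomial_fun \<alpha> x = (\<Prod>i\<in>UNIV. (x $ i) ^ \<alpha> i)"

definition polynomial_fun :: "(complex ^ 'n::finite \<Rightarrow> complex) \<Rightarrow> bool" where
  "polynomial_fun p \<longleftrightarrow>
     (\<exists>A c. finite A \<and> (\<forall>x. p x = (\<Sum>\<alpha>\<in>A. c \<alpha> * monomial_fun \<alpha> x)))"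

definition homogeneous :: "nat \<Rightarrow> (complex ^ 'n::finite \<Rightarrow> complex) \<Rightarrow> bool" where
  "homogeneous d p \<longleftrightarrow>
     (\<exists>A c. finite A \<and> (\<forall>\<alpha>\<in>A. (\<Sum>i\<in>UNIV. \<alpha> i) = d) \<and>
            (\<forall>x. p x = (\<Sum>\<alpha>\<in>A. c \<alpha> * monomial_fun \<alpha> x)))"

definition poly_divides ::
  "(complex ^ 'n::finite \<Rightarrow> complex) \<Rightarrow> (complex ^ 'n \<Rightarrow> complex) \<Rightarrow> bool" where
  "poly_divides p q \<longleftrightarrow> (\<exists>r. polynomial_fun r \<and> (\<forall>x. q x = p x * r x))"

definition no_common_factor :: "(complex ^ 'n::finite \<Rightarrow> complex ^ 'm::finite) \<Rightarrow> bool" where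
  "no_common_factor F \<longleftrightarrow>
     (\<forall>h. polynomial_fun h \<and> (\<forall>i. poly_divides h (\<lambda>x. F x $ i)) \<longrightarrow> (\<exists>c. \<forall>x. h x = c))"


section \<open>Projective space and its algebraic subsets\<close>

text \<open>
  The type \<open>'n proj\<close> is \<open>\<bbbP>\<^sup>k\<close> with \<open>k + 1 = CARD('n)\<close>; so \<open>3 proj\<close> is the projective plane.
\<close>

definition proj_rel :: "complex ^ 'n::finite \<Rightarrow> complex ^ 'n \<Rightarrow> bool" where
  "proj_rel x y \<longleftrightarrow> x \<noteq> 0 \<and> y \<noteq> 0 \<and> (\<exists>c. y = c *s x)"

lemma part_equivp_proj_rel: "part_equivp (proj_rel :: complex ^ 'n::finite \<Rightarrow> _)"
proof (rule part_equivpI)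
  show "\<exists>x::complex ^ 'n. proj_rel x x"
    by (intro exI[of _ 1]) (auto simp: proj_rel_def intro: exI[of _ 1])
  show "symp (proj_rel :: complex ^ 'n \<Rightarrow> _)"
  proof (rule sympI)
    fix x y :: "complex ^ 'n"
    assume "proj_rel x y"
    then obtain c where c: "x \<noteq> 0" "y \<noteq> 0" "y = c *s x" by (auto simp: proj_rel_def)
    then have "c \<noteq> 0" by auto
    then have "x = inverse c *s y" using c by (simp add: vec_eq_iff)
    then show "proj_rel y x" using c(1,2) unfolding proj_rel_def by blast
  qed
  show "transp (proj_rel :: complex ^ 'n \<Rightarrow> _)"
    by (rule transpI) (auto simp: proj_rel_def vector_smult_assoc)
qed

quotient_type (overloaded) 'n proj = "complex ^ ('n::finite)" / partial: proj_rel
  by (rule part_equivp_proj_rel)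

text \<open>\<open>pt x\<close> is the point with homogeneous coordinates \<open>x\<close>; it is only meaningful for \<open>x \<noteq> 0\<close>.\<close>

definition pt :: "complex ^ 'n::finite \<Rightarrow> 'n proj" where
  "pt = abs_proj"

lemma pt_eq_iff: "x \<noteq> 0 \<Longrightarrow> y \<noteq> 0 \<Longrightarrow> pt x = pt y \<longleftrightarrow> (\<exists>c. y = c *s x)"
proof -
  assume xy: "x \<noteq> 0" "y \<noteq> 0"
  then have "proj_rel x x" "proj_rel y y"
    by (auto simp: proj_rel_def intro: exI[of _ 1])
  then have "abs_proj x = abs_proj y \<longleftrightarrow> proj_rel x y"
    using Quotient3_rel[OF Quotient3_proj, of x y] by blast
  then show ?thesis using xy by (simp add: pt_def proj_rel_def)
qed

definition zero_locus :: "(complex ^ 'n::finite \<Rightarrow> complex) set \<Rightarrow> 'n proj set" where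
  "zero_locus S = {pt x |x. x \<noteq> 0 \<and> (\<forall>p\<in>S. p x = 0)}"

definition algebraic_set :: "'n::finite proj set \<Rightarrow> bool" where
  "algebraic_set Z \<longleftrightarrow> (\<exists>S. (\<forall>p\<in>S. \<exists>d. homogeneous d p) \<and> Z = zero_locus S)"

definition zariski_closure :: "'n::finite proj set \<Rightarrow> 'n proj set" where
  "zariski_closure X = \<Inter>{Z. algebraic_set Z \<and> X \<subseteq> Z}"

definition hypersurface :: "'n::finite proj set \<Rightarrow> bool" where
  "hypersurface H \<longleftrightarrow>
     (\<exists>d p. d \<ge> 1 \<and> homogeneous d p \<and> (\<exists>x. p x \<noteq> 0) \<and> H = zero_locus {p})"

definition irreducible_algebraic :: "'n::finite proj set \<Rightarrow> bool" where
  "irreducible_algebraic Z \<longleftrightarrow> algebraic_set Z \<and> Z \<noteq> {} \<and>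
     (\<forall>A B. algebraic_set A \<and> algebraic_set B \<and> Z = A \<union> B \<longrightarrow> Z = A \<or> Z = B)"

definition irreducible_component :: "'n::finite proj set \<Rightarrow> 'n proj set \<Rightarrow> bool" where
  "irreducible_component C X \<longleftrightarrow> irreducible_algebraic C \<and> C \<subseteq> X \<and>
     (\<forall>D. irreducible_algebraic D \<and> C \<subseteq> D \<and> D \<subseteq> X \<longrightarrow> D = C)"

text \<open>
  Krull dimension: the supremum of the lengths of strictly increasing chains of irreducible
  algebraic subsets. The empty set gets dimension \<open>-\<infinity>\<close> and codimension \<open>\<infinity>\<close>.
\<close>

definition proj_dim :: "'n::finite proj set \<Rightarrow> ereal" where
  "proj_dim X =
     (SUP d \<in> {d::nat. \<exists>Z. (\<forall>i\<le>d. irreducible_algebraic (Z i) \<and> Z i \<subseteq> X) \<and>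
                            (\<forall>i<d. Z i \<subset> Z (Suc i))}. ereal (real d))"

definition proj_codim :: "'n::finite proj set \<Rightarrow> ereal" where
  "proj_codim X = ereal (real CARD('n) - 1) - proj_dim X"


section \<open>Meromorphic self-maps of projective space\<close>

text \<open>
  A meromorphic self-map \<open>[G\<^sub>0 : \<dots> : G\<^sub>k]\<close> is given by a lifting \<open>G\<close>, which it determines up to a
  nonzero constant. None of the notions below depends on that constant.
\<close>

definition lifting :: "(complex ^ 'n::finite \<Rightarrow> complex ^ 'n) \<Rightarrow> bool" where
  "lifting F \<longleftrightarrow> (\<exists>d. \<forall>i. homogeneous d (\<lambda>x. F x $ i)) \<and> no_common_factor F"

text \<open>
  Lifting of the \<open>n\<close>-th iterate as a meromorphic map: the common factor of the components of the
  \<open>n\<close>-fold composition has been cancelled.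
\<close>

definition lifting_of_iterate ::
  "(complex ^ 'n::finite \<Rightarrow> complex ^ 'n) \<Rightarrow> nat \<Rightarrow> (complex ^ 'n \<Rightarrow> complex ^ 'n) \<Rightarrow> bool" where
  "lifting_of_iterate f n F \<longleftrightarrow> lifting F \<and>
     (\<exists>h. polynomial_fun h \<and> (\<exists>x. h x \<noteq> 0) \<and> (\<forall>x. (f ^^ n) x = h x *s F x))"

text \<open>For dominant \<open>f\<close> such a lifting exists and is unique up to a nonzero constant.\<close>

definition iterate ::
  "(complex ^ 'n::finite \<Rightarrow> complex ^ 'n) \<Rightarrow> nat \<Rightarrow> complex ^ 'n \<Rightarrow> complex ^ 'n" where
  "iterate f n = (SOME F. lifting_of_iterate f n F)"

definition indeterminacy :: "(complex ^ 'n::finite \<Rightarrow> complex ^ 'n) \<Rightarrow> 'n proj set" where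
  "indeterminacy F = {pt x |x. x \<noteq> 0 \<and> F x = 0}"

text \<open>
  Image of a set under a meromorphic map. The image of an algebraic set minus the indeterminacy
  locus is constructible, so its Zariski closure coincides with its closure in the usual topology.
\<close>

definition mero_image ::
  "(complex ^ 'n::finite \<Rightarrow> complex ^ 'n) \<Rightarrow> 'n proj set \<Rightarrow> 'n proj set" where
  "mero_image F X =
     zariski_closure {pt (F x) |x. x \<noteq> 0 \<and> pt x \<in> X - indeterminacy F}"

abbreviation iter_image ::
  "(complex ^ 'n::finite \<Rightarrow> complex ^ 'n) \<Rightarrow> nat \<Rightarrow> 'n proj set \<Rightarrow> 'n proj set" where
  "iter_image f n X \<equiv> mero_image (iterate f n) X"

text \<open>
  \<open>chart_jacobian F i j x\<close> is, up to sign, the Jacobian determinant at \<open>x\<close> of the map induced by \<open>F\<close>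
  from the chart \<open>x\<^sub>i = 1\<close> to the chart \<open>y\<^sub>j = 1\<close>, i.e. of the components \<open>F\<^sub>l / F\<^sub>j\<close> (\<open>l \<noteq> j\<close>) with
  respect to the variables \<open>x\<^sub>m\<close> (\<open>m \<noteq> i\<close>). This \<open>k \<times> k\<close> determinant is written as a determinant of
  size \<open>k + 1\<close> whose row \<open>j\<close> and column \<open>i\<close> vanish except for the entry 1 where they meet.
\<close>

definition chart_jacobian ::
  "(complex ^ 'n::finite \<Rightarrow> complex ^ 'n) \<Rightarrow> 'n \<Rightarrow> 'n \<Rightarrow> complex ^ 'n \<Rightarrow> complex" where
  "chart_jacobian F i j x =
     det (\<chi> l m. if l = j \<or> m = i then (if l = j \<and> m = i then 1 else 0)
                 else deriv (\<lambda>s. F (x + s *s axis m 1) $ l / F (x + s *s axis m 1) $ j) 0)"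

definition dominant :: "(complex ^ 'n::finite \<Rightarrow> complex ^ 'n) \<Rightarrow> bool" where
  "dominant F \<longleftrightarrow>
     (\<forall>i j. \<exists>x. x $ i = 1 \<and> F x $ j \<noteq> 0 \<and> chart_jacobian F i j x \<noteq> 0)"


section \<open>Degree lowering hypersurfaces and quasi-algebraic stability\<close>

definition degree_lowering ::
  "(complex ^ 'n::finite \<Rightarrow> complex ^ 'n) \<Rightarrow> 'n proj set \<Rightarrow> bool" where
  "degree_lowering f H \<longleftrightarrow>
     hypersurface H \<and> (\<exists>n\<ge>1. iter_image f n H \<subseteq> indeterminacy f)"

definition height :: "(complex ^ 'n::finite \<Rightarrow> complex ^ 'n) \<Rightarrow> 'n proj set \<Rightarrow> nat" where
  "height f H = (LEAST n. n \<ge> 1 \<and> iter_image f n H \<subseteq> indeterminacy f)"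

text \<open>
  \<open>primitive_system f S\<close>: the elements of \<open>S\<close> satisfy the properties that characterise the primitive
  degree lowering hypersurfaces of \<open>f\<close>. These properties determine the hypersurfaces only up to
  discarding a component whose forward orbit runs through another component, so statements about
  ``the'' primitive hypersurfaces should be made for every such \<open>S\<close>.
\<close>

definition primitive_system ::
  "(complex ^ 'n::finite \<Rightarrow> complex ^ 'n) \<Rightarrow> 'n proj set set \<Rightarrow> bool" where
  "primitive_system f S \<longleftrightarrow>
     finite S \<and> (\<forall>H\<in>S. degree_lowering f H) \<and>
     inj_on (height f) S \<and>
     (\<forall>H\<in>S. \<forall>m\<in>{1..height f H}. proj_codim (iter_image f m H) > 1) \<and>
     (\<forall>H. irreducible_algebraic H \<and> degree_lowering f H \<longrightarrow>
        (\<exists>n. \<exists>K\<in>S. hypersurface (iter_image f n H) \<and> iter_image f n H \<subseteq> K))"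

text \<open>
  The quotients in the recursion are expressed by clearing the (not identically vanishing)
  denominators.
\<close>

definition quasi_algebraically_stable :: "(complex ^ 'n::finite \<Rightarrow> complex ^ 'n) \<Rightarrow> bool" where
  "quasi_algebraically_stable f \<longleftrightarrow>
     (\<exists>n\<^sub>0 d h F. n\<^sub>0 \<ge> (1::nat) \<and> homogeneous d h \<and> F 0 = id \<and> F 1 = f \<and>
        (\<forall>n\<in>{1..n\<^sub>0}. F n = F 1 \<circ> F (n - 1)) \<and>
        (\<forall>n>n\<^sub>0. (\<exists>x. h (F (n - n\<^sub>0 - 1) x) \<noteq> 0) \<and>
                 (\<forall>x. h (F (n - n\<^sub>0 - 1) x) *s F n x = F 1 (F (n - 1) x))) \<and>
        (\<forall>n\<ge>1. lifting_of_iterate f n (F n)))"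

end

theory Submission
  imports Defs
    "HOL-Computational_Algebra.Polynomial_Factorial"
    "HOL-Computational_Algebra.Field_as_Ring"
    "HOL-Computational_Algebra.Fundamental_Theorem_Algebra"
begin

text \<open>
  An irreducible curve \<open>G\<close> in the plane is sent by a meromorphic map either onto a curve or to a point.
  If \<open>f\<close> sends \<open>G\<close> to a point \<open>v\<close>, choose a linear form vanishing at \<open>v\<close> and at \<open>[1:1:1]\<close>. Its
  composition with \<open>f\<close> is \<open>P (a Q\<^sub>1 + b Q\<^sub>2 + c Q\<^sub>3)\<close>, so (a) and (c) force \<open>v = [1:1:1]\<close> and
  \<open>G \<subseteq> {P = 0}\<close>; conversely \<open>f = -R (1,1,1)\<close> on \<open>{P = 0}\<close>, and \<open>[1:1:1]\<close> is indeterminate. By (b) the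
  orbit of a curve thus consists of curves and isolated visits to \<open>[1:1:1]\<close>, each one preceded by a
  component of \<open>{P = 0}\<close> and followed by a curve. Hence \<open>{P = 0}\<close> is the primitive degree lowering
  hypersurface, of height 1. If \<open>f \<circ> f = h F\<^sub>2\<close> with \<open>F\<^sub>2\<close> a lifting of \<open>f\<^sup>2\<close>, then \<open>h\<close> vanishes only on
  \<open>{P = 0}\<close>, in particular not at \<open>[1:1:1]\<close>, and the common factor of \<open>f \<circ> F\<^sub>n\<^sub>-\<^sub>1\<close> is \<open>h \<circ> F\<^sub>n\<^sub>-\<^sub>2\<close>.
\<close>

section \<open>Polynomial functions and homogeneity\<close>

text \<open>A curve is handled through its prime form \<open>g\<close>, and a lifting
  \<open>F\<close> acts on it through the forms \<open>s\<close> such that \<open>g\<close> divides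
  \<open>s \<circ> F\<close>; inclusion of images, indeterminacy and composition of iterates all
  become divisibility. Two facts carry this translation: a form vanishing on \<open>g = 0\<close> is
  divisible by \<open>g\<close>, and an image ideal containing two coprime forms is the ideal of a
  point. Both come from eliminating one variable; together with a count of coefficients they replace
  dimension theory for images. The obstacle at [1:1:1] is that an orbit cannot be continued from an
  indeterminate point. It is continued from the curve before it, by \<open>f^2\<close>, and this is
  where (b) enters. Height 1 reduces (ii) to \<open>P 1 \<noteq> 0\<close> and gives
  \<open>m\<^sub>0 = 1\<close> in (iii). A primitive system may consist of a proper part of
  \<open>{P = 0}\<close>, so (ii) and (iii) are shown for any hypersurface inside it. Stability is
  proved directly: \<open>h\<close> is never compared with a power of \<open>P\<close>, since
  besides being a nonzero form it only has to be nonzero at [1:1:1].\<close>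

lemma monomial_sum_regroup:
  assumes "finite I"
  shows "\<exists>c'. \<forall>x. (\<Sum>i\<in>I. c i * monomial_fun (a i) x) = (\<Sum>\<alpha>\<in>a ` I. c' \<alpha> * monomial_fun \<alpha> x)"
proof (intro exI allI)
  fix x :: "complex ^ 'b"
  have "(\<Sum>i\<in>I. c i * monomial_fun (a i) x)
      = (\<Sum>\<alpha>\<in>a ` I. \<Sum>i | i \<in> I \<and> a i = \<alpha>. c i * monomial_fun (a i) x)"
    by (rule sum.image_gen[OF assms])
  also have "\<dots> = (\<Sum>\<alpha>\<in>a ` I. (\<Sum>i | i \<in> I \<and> a i = \<alpha>. c i) * monomial_fun \<alpha> x)"
    by (intro sum.cong refl) (simp add: sum_distrib_right)
  finally show "(\<Sum>i\<in>I. c i * monomial_fun (a i) x)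
      = (\<Sum>\<alpha>\<in>a ` I. (\<lambda>\<alpha>. \<Sum>i | i \<in> I \<and> a i = \<alpha>. c i) \<alpha> * monomial_fun \<alpha> x)" by simp
qed

text \<open>Products and sums of expansions are naturally indexed by pairs or by disjoint unions,
  where exponents may repeat; collecting equal exponents restores the shape required by the
  definition.\<close>

lemma polynomial_fun_monomial_sum:
  assumes "finite I" and "\<And>x. p x = (\<Sum>i\<in>I. c i * monomial_fun (a i) x)"
  shows "polynomial_fun p"
proof -
  obtain c' where "\<forall>x. (\<Sum>i\<in>I. c i * monomial_fun (a i) x) = (\<Sum>\<alpha>\<in>a ` I. c' \<alpha> * monomial_fun \<alpha> x)"
    using monomial_sum_regroup[OF assms(1), of c a] by blast
  then show ?thesis unfolding polynomial_fun_def assms(2) using assms(1)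
    by (intro exI[of _ "a ` I"] exI[of _ c']) auto
qed

lemma homogeneous_monomial_sum:
  assumes "finite I" and "\<And>x. p x = (\<Sum>i\<in>I. c i * monomial_fun (a i) x)"
    and "\<And>i. i \<in> I \<Longrightarrow> (\<Sum>j\<in>UNIV. a i j) = d"
  shows "homogeneous d p"
proof -
  obtain c' where "\<forall>x. (\<Sum>i\<in>I. c i * monomial_fun (a i) x) = (\<Sum>\<alpha>\<in>a ` I. c' \<alpha> * monomial_fun \<alpha> x)"
    using monomial_sum_regroup[OF assms(1), of c a] by blast
  then show ?thesis unfolding homogeneous_def assms(2) using assms(1,3)
    by (intro exI[of _ "a ` I"] exI[of _ c']) auto
qed

lemma monomial_fun_mult:
  "monomial_fun \<alpha> x * monomial_fun \<beta> x = monomial_fun (\<lambda>i. \<alpha> i + \<beta> i) x"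
  by (simp add: monomial_fun_def power_add prod.distrib)

lemma monomial_fun_scale:
  "monomial_fun \<alpha> (t *s x) = t ^ (\<Sum>i\<in>UNIV. \<alpha> i) * monomial_fun \<alpha> x"
  by (simp add: monomial_fun_def power_mult_distrib prod.distrib power_sum)

lemma homogeneous_imp_polynomial_fun: "homogeneous d p \<Longrightarrow> polynomial_fun p"
  unfolding homogeneous_def polynomial_fun_def by blast

lemma homogeneous_scale: "homogeneous d p \<Longrightarrow> p (t *s x) = t ^ d * p x"
  unfolding homogeneous_def by (auto simp: monomial_fun_scale sum_distrib_left mult_ac intro!: sum.cong)

lemma homogeneous_const: "homogeneous 0 (\<lambda>x. c)"
  by (rule homogeneous_monomial_sum[of "{()}" _ "\<lambda>_. c" "\<lambda>_ _. 0"]) (auto simp: monomial_fun_def)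

lemma homogeneous_zero: "homogeneous d (\<lambda>x. 0)"
  by (rule homogeneous_monomial_sum[of "{}" _ "\<lambda>_. 0" "\<lambda>_ _. 0"]) auto

lemma homogeneous_coord: "homogeneous 1 (\<lambda>x. x $ i)"
proof (rule homogeneous_monomial_sum[of "{()}" _ "\<lambda>_. 1" "\<lambda>_ j. if j = i then 1 else 0"])
  fix x :: "complex ^ 'a"
  have "monomial_fun (\<lambda>j. if j = i then 1 else 0) x = (\<Prod>j\<in>UNIV. if j = i then x $ j else 1)"
    unfolding monomial_fun_def by (intro prod.cong) auto
  then show "x $ i = (\<Sum>k\<in>{()}. 1 * monomial_fun (\<lambda>j. if j = i then 1 else 0) x)"
    by simp
qed auto

lemma homogeneous_mult:
  assumes "homogeneous d p" "homogeneous e q"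
  shows "homogeneous (d + e) (\<lambda>x. p x * q x)"
proof -
  obtain A a where A: "finite A" "\<forall>\<alpha>\<in>A. (\<Sum>i\<in>UNIV. \<alpha> i) = d" "\<forall>x. p x = (\<Sum>\<alpha>\<in>A. a \<alpha> * monomial_fun \<alpha> x)"
    using assms(1) unfolding homogeneous_def by blast
  obtain B b where B: "finite B" "\<forall>\<alpha>\<in>B. (\<Sum>i\<in>UNIV. \<alpha> i) = e" "\<forall>x. q x = (\<Sum>\<alpha>\<in>B. b \<alpha> * monomial_fun \<alpha> x)"
    using assms(2) unfolding homogeneous_def by blast
  show ?thesis
    using A B
    by (intro homogeneous_monomial_sum[of "A \<times> B" _ "\<lambda>(\<alpha>, \<beta>). a \<alpha> * b \<beta>" "\<lambda>(\<alpha>, \<beta>) i. \<alpha> i + \<beta> i"])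
       (auto simp: sum_product sum.cartesian_product sum.distrib monomial_fun_mult[symmetric] mult_ac
          intro!: sum.cong)
qed

lemma homogeneous_add:
  assumes "homogeneous d p" "homogeneous d q"
  shows "homogeneous d (\<lambda>x. p x + q x)"
proof -
  obtain A a where A: "finite A" "\<forall>\<alpha>\<in>A. (\<Sum>i\<in>UNIV. \<alpha> i) = d" "\<forall>x. p x = (\<Sum>\<alpha>\<in>A. a \<alpha> * monomial_fun \<alpha> x)"
    using assms(1) unfolding homogeneous_def by blast
  obtain B b where B: "finite B" "\<forall>\<alpha>\<in>B. (\<Sum>i\<in>UNIV. \<alpha> i) = d" "\<forall>x. q x = (\<Sum>\<alpha>\<in>B. b \<alpha> * monomial_fun \<alpha> x)"
    using assms(2) unfolding homogeneous_def by blast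
  show ?thesis
    using A B
    by (intro homogeneous_monomial_sum[of "A <+> B" _ "case_sum a b" "case_sum id id"])
       (auto simp: sum.Plus)
qed

lemma homogeneous_cmult: "homogeneous d p \<Longrightarrow> homogeneous d (\<lambda>x. c * p x)"
  using homogeneous_mult[OF homogeneous_const, of d p c] by simp

lemma homogeneous_diff: "homogeneous d p \<Longrightarrow> homogeneous d q \<Longrightarrow> homogeneous d (\<lambda>x. p x - q x)"
  using homogeneous_add[OF _ homogeneous_cmult, of d p q "-1"] by simp

lemma homogeneous_sum:
  "(\<And>i. i \<in> I \<Longrightarrow> homogeneous d (p i)) \<Longrightarrow> homogeneous d (\<lambda>x. \<Sum>i\<in>I. p i x)"
  by (induction I rule: infinite_finite_induct) (auto intro: homogeneous_zero homogeneous_add)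

lemma homogeneous_power: "homogeneous d p \<Longrightarrow> homogeneous (d * n) (\<lambda>x. p x ^ n)"
  by (induction n) (auto intro: homogeneous_const homogeneous_mult)

lemma homogeneous_prod:
  "finite I \<Longrightarrow> (\<And>i. i \<in> I \<Longrightarrow> homogeneous (d i) (p i)) \<Longrightarrow> homogeneous (\<Sum>i\<in>I. d i) (\<lambda>x. \<Prod>i\<in>I. p i x)"
  by (induction I rule: finite_induct) (auto intro: homogeneous_const homogeneous_mult)

lemma homogeneous_compose:
  assumes "homogeneous e s" "\<And>i. homogeneous d (\<lambda>x. F x $ i)"
  shows "homogeneous (d * e) (\<lambda>x. s (F x))"
proof -
  obtain A a where A: "finite A" "\<forall>\<alpha>\<in>A. (\<Sum>i\<in>UNIV. \<alpha> i) = e" "\<forall>x. s x = (\<Sum>\<alpha>\<in>A. a \<alpha> * monomial_fun \<alpha> x)"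
    using assms(1) unfolding homogeneous_def by blast
  have "homogeneous (d * e) (\<lambda>x. monomial_fun \<alpha> (F x))" if "\<alpha> \<in> A" for \<alpha>
    unfolding monomial_fun_def
    using homogeneous_prod[of UNIV "\<lambda>i. d * \<alpha> i" "\<lambda>i x. (F x $ i) ^ \<alpha> i"] A(2) that
    by (simp add: homogeneous_power assms(2) sum_distrib_left[symmetric])
  then show ?thesis using A(3) by (auto intro!: homogeneous_sum homogeneous_cmult)
qed

lemma polynomial_fun_const: "polynomial_fun (\<lambda>x. c)"
  by (rule homogeneous_imp_polynomial_fun[OF homogeneous_const])

lemma polynomial_fun_coord: "polynomial_fun (\<lambda>x. x $ i)"
  by (rule homogeneous_imp_polynomial_fun[OF homogeneous_coord])

lemma polynomial_fun_mult:
  assumes "polynomial_fun p" "polynomial_fun q"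
  shows "polynomial_fun (\<lambda>x. p x * q x)"
proof -
  obtain A a where A: "finite A" "\<forall>x. p x = (\<Sum>\<alpha>\<in>A. a \<alpha> * monomial_fun \<alpha> x)"
    using assms(1) unfolding polynomial_fun_def by blast
  obtain B b where B: "finite B" "\<forall>x. q x = (\<Sum>\<alpha>\<in>B. b \<alpha> * monomial_fun \<alpha> x)"
    using assms(2) unfolding polynomial_fun_def by blast
  show ?thesis
    using A B
    by (intro polynomial_fun_monomial_sum[of "A \<times> B" _ "\<lambda>(\<alpha>, \<beta>). a \<alpha> * b \<beta>" "\<lambda>(\<alpha>, \<beta>) i. \<alpha> i + \<beta> i"])
       (auto simp: sum_product sum.cartesian_product monomial_fun_mult[symmetric] mult_ac intro!: sum.cong)
qed

lemma polynomial_fun_add: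
  assumes "polynomial_fun p" "polynomial_fun q"
  shows "polynomial_fun (\<lambda>x. p x + q x)"
proof -
  obtain A a where A: "finite A" "\<forall>x. p x = (\<Sum>\<alpha>\<in>A. a \<alpha> * monomial_fun \<alpha> x)"
    using assms(1) unfolding polynomial_fun_def by blast
  obtain B b where B: "finite B" "\<forall>x. q x = (\<Sum>\<alpha>\<in>B. b \<alpha> * monomial_fun \<alpha> x)"
    using assms(2) unfolding polynomial_fun_def by blast
  show ?thesis
    using A B
    by (intro polynomial_fun_monomial_sum[of "A <+> B" _ "case_sum a b" "case_sum id id"])
       (auto simp: sum.Plus)
qed

lemma polynomial_fun_minus: "polynomial_fun p \<Longrightarrow> polynomial_fun (\<lambda>x. - p x)"
  using polynomial_fun_mult[OF polynomial_fun_const[of "-1"], of p] by simp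

lemma polynomial_fun_diff:
  "polynomial_fun p \<Longrightarrow> polynomial_fun q \<Longrightarrow> polynomial_fun (\<lambda>x. p x - q x)"
  using polynomial_fun_add[OF _ polynomial_fun_minus, of p q] by simp

lemma polynomial_fun_sum:
  "(\<And>i. i \<in> I \<Longrightarrow> polynomial_fun (p i)) \<Longrightarrow> polynomial_fun (\<lambda>x. \<Sum>i\<in>I. p i x)"
  by (induction I rule: infinite_finite_induct) (auto intro: polynomial_fun_const polynomial_fun_add)

lemma polynomial_fun_power: "polynomial_fun p \<Longrightarrow> polynomial_fun (\<lambda>x. p x ^ n)"
  by (induction n) (auto intro: polynomial_fun_const polynomial_fun_mult)

lemma polynomial_fun_prod:
  "(\<And>i. i \<in> I \<Longrightarrow> polynomial_fun (p i)) \<Longrightarrow> polynomial_fun (\<lambda>x. \<Prod>i\<in>I. p i x)"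
  by (induction I rule: infinite_finite_induct) (auto intro: polynomial_fun_const polynomial_fun_mult)

lemma polynomial_fun_compose:
  assumes "polynomial_fun s" "\<And>i. polynomial_fun (\<lambda>x. F x $ i)"
  shows "polynomial_fun (\<lambda>x. s (F x))"
proof -
  obtain A a where A: "finite A" "\<forall>x. s x = (\<Sum>\<alpha>\<in>A. a \<alpha> * monomial_fun \<alpha> x)"
    using assms(1) unfolding polynomial_fun_def by blast
  then show ?thesis using assms(2)
    by (auto simp: monomial_fun_def
        intro!: polynomial_fun_sum polynomial_fun_mult polynomial_fun_const polynomial_fun_prod polynomial_fun_power)
qed

text \<open>Restriction to lines is the bridge to univariate polynomials: the domain property, the
  identity theorem and the fundamental theorem of algebra are all used through it.\<close>

lemma polynomial_fun_line:
  assumes "polynomial_fun p"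
  shows "\<exists>q. \<forall>t. p (x + t *s v) = poly q t"
proof -
  obtain A a where A: "finite A" "\<forall>x. p x = (\<Sum>\<alpha>\<in>A. a \<alpha> * monomial_fun \<alpha> x)"
    using assms unfolding polynomial_fun_def by blast
  then show ?thesis
    by (intro exI[of _ "\<Sum>\<alpha>\<in>A. Polynomial.smult (a \<alpha>) (\<Prod>i\<in>UNIV. [:x $ i, v $ i:] ^ \<alpha> i)"])
       (auto simp: poly_sum poly_prod poly_power monomial_fun_def)
qed

text \<open>On the line joining a point where \<open>a\<close> is nonzero to one where
  \<open>b\<close> is nonzero, both restrictions are nonzero univariate polynomials.\<close>

lemma polynomial_fun_eq_0_of_mult:
  assumes "polynomial_fun a" "polynomial_fun b" "\<And>x. a x * b x = 0"
  shows "(\<forall>x. a x = 0) \<or> (\<forall>x. b x = 0)"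
proof (rule ccontr)
  assume "\<not> ?thesis"
  then obtain x y where xy: "a x \<noteq> 0" "b y \<noteq> 0" by blast
  obtain q where q: "\<And>t. a (x + t *s (y - x)) = poly q t" using polynomial_fun_line[OF assms(1)] by blast
  obtain r where r: "\<And>t. b (x + t *s (y - x)) = poly r t" using polynomial_fun_line[OF assms(2)] by blast
  have "poly (q * r) t = 0" for t using assms(3) q r by (metis poly_mult)
  then have "q * r = 0" using poly_all_0_iff_0 by blast
  moreover have "q \<noteq> 0" using q[of 0] xy by auto
  moreover have "r \<noteq> 0" using r[of 1] xy by auto
  ultimately show False by simp
qed

lemma polynomial_fun_mult_nonzero:
  assumes "polynomial_fun a" "polynomial_fun b" "\<exists>x. a x \<noteq> 0" "\<exists>x. b x \<noteq> 0"
  shows "\<exists>x. a x \<noteq> 0 \<and> b x \<noteq> 0"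
  using polynomial_fun_eq_0_of_mult[OF assms(1,2)] assms(3,4) by force

lemma polynomial_fun_cancel:
  assumes "polynomial_fun a" "polynomial_fun b" "polynomial_fun c" "\<exists>x. a x \<noteq> 0" "\<And>x. a x * b x = a x * c x"
  shows "b x = c x"
  using polynomial_fun_eq_0_of_mult[OF assms(1) polynomial_fun_diff[OF assms(2,3)]] assms(4,5)
  by (auto simp: algebra_simps)

section \<open>Homogeneous parts of a polynomial\<close>

lemma homogeneous_decomposition:
  assumes "polynomial_fun u"
  shows "\<exists>n U. (\<forall>e. homogeneous e (U e)) \<and> (\<forall>e>n. \<forall>x. U e x = 0) \<and>
    (\<forall>x t. u (t *s x) = (\<Sum>e\<le>n. U e x * t ^ e))"
proof -
  obtain A a where A: "finite A" "\<forall>x. u x = (\<Sum>\<alpha>\<in>A. a \<alpha> * monomial_fun \<alpha> x)"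
    using assms unfolding polynomial_fun_def by blast
  define dg where "dg = (\<lambda>\<alpha>::'a \<Rightarrow> nat. \<Sum>i\<in>UNIV. \<alpha> i)"
  \<comment> \<open>Any upper bound for the degrees will do; the sum also makes sense when
    \<open>A\<close> is empty.\<close>
  define n where "n = (\<Sum>\<alpha>\<in>A. dg \<alpha>)"
  have n: "dg \<alpha> \<le> n" if "\<alpha> \<in> A" for \<alpha>
    unfolding n_def using A(1) that by (intro member_le_sum) auto
  \<comment> \<open>The parts are indexed by all degrees and vanish above \<open>n\<close>, so that
    decompositions with different bounds can be compared coefficient by coefficient in
    \<open>t\<close>.\<close>
  define U where "U = (\<lambda>e x. \<Sum>\<alpha> | \<alpha> \<in> A \<and> dg \<alpha> = e. a \<alpha> * monomial_fun \<alpha> x)"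
  have "homogeneous e (U e)" for e
    by (rule homogeneous_monomial_sum[of "{\<alpha>\<in>A. dg \<alpha> = e}" _ a "\<lambda>\<alpha>. \<alpha>"]) (auto simp: A(1) U_def dg_def)
  moreover have "U e x = 0" if "e > n" for e x
    unfolding U_def using n that by (intro sum.neutral) fastforce
  moreover have "u (t *s x) = (\<Sum>e\<le>n. U e x * t ^ e)" for x t
  proof -
    have "u (t *s x) = (\<Sum>\<alpha>\<in>A. a \<alpha> * monomial_fun \<alpha> x * t ^ dg \<alpha>)"
      using A(2) by (simp add: monomial_fun_scale dg_def mult_ac)
    also have "\<dots> = (\<Sum>e\<le>n. \<Sum>\<alpha> | \<alpha> \<in> A \<and> dg \<alpha> = e. a \<alpha> * monomial_fun \<alpha> x * t ^ dg \<alpha>)"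
      using n A(1) by (intro sum.group[symmetric]) auto
    also have "\<dots> = (\<Sum>e\<le>n. U e x * t ^ e)"
      unfolding U_def by (intro sum.cong refl) (simp add: sum_distrib_right)
    finally show ?thesis .
  qed
  ultimately show ?thesis by blast
qed

lemma polyfun_coeffs_unique:
  fixes a b :: "nat \<Rightarrow> complex"
  assumes "\<And>t. (\<Sum>e\<le>n. a e * t ^ e) = (\<Sum>e\<le>m. b e * t ^ e)"
    and "\<And>e. e > n \<Longrightarrow> a e = 0" and "\<And>e. e > m \<Longrightarrow> b e = 0"
  shows "a e = b e"
proof -
  define N where "N = n + m + e"
  have "(\<Sum>e\<le>N. a e * t ^ e) = (\<Sum>e\<le>N. b e * t ^ e)" for t
  proof -
    have "(\<Sum>e\<le>N. a e * t ^ e) = (\<Sum>e\<le>n. a e * t ^ e)"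
      unfolding N_def using assms(2) by (intro sum.mono_neutral_right) auto
    also have "\<dots> = (\<Sum>e\<le>m. b e * t ^ e)" by (rule assms(1))
    also have "\<dots> = (\<Sum>e\<le>N. b e * t ^ e)"
      unfolding N_def using assms(3) by (intro sum.mono_neutral_left) auto
    finally show ?thesis .
  qed
  then have "\<forall>e\<le>N. a e = b e" using polyfun_eq_coeffs[of a N b] by simp
  then show ?thesis by (simp add: N_def)
qed

lemma homogeneous_part_monomial:
  fixes U :: "nat \<Rightarrow> 'a \<Rightarrow> complex"
  assumes "\<And>t. t ^ d * c = (\<Sum>e\<le>n. U e x * t ^ e)" and "\<And>e. e > n \<Longrightarrow> U e x = 0"
  shows "U e x = (if e = d then c else 0)"
proof (rule polyfun_coeffs_unique[where n = n and m = d and a = "\<lambda>e. U e x"])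
  fix t
  have "(\<Sum>e\<le>d. (if e = d then c else 0) * t ^ e) = (\<Sum>e\<le>d. if e = d then c * t ^ e else 0)"
    by (intro sum.cong) auto
  then show "(\<Sum>e\<le>n. U e x * t ^ e) = (\<Sum>e\<le>d. (if e = d then c else 0) * t ^ e)"
    using assms(1) by (simp add: mult.commute)
qed (use assms(2) in auto)

lemma homogeneous_degree_unique:
  assumes "homogeneous d p" "homogeneous e p" "\<exists>x. p x \<noteq> 0"
  shows "d = e"
proof -
  obtain x where "p x \<noteq> 0" using assms by blast
  then have "(2::complex) ^ d = 2 ^ e"
    using homogeneous_scale[OF assms(1), of 2 x] homogeneous_scale[OF assms(2), of 2 x] by simp
  then have "(2::real) ^ d = 2 ^ e" by (metis norm_numeral norm_power)
  then show ?thesis by simp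
qed

text \<open>Multiplication by a form of degree \<open>k\<close> shifts degrees by \<open>k\<close>:
  the part of degree \<open>e\<close> of \<open>g w\<close> is \<open>g\<close> times the part of
  degree \<open>e - k\<close> of \<open>w\<close>, and zero for \<open>e < k\<close>, which is what
  \<open>W'\<close> records.\<close>

lemma homogeneous_part_dvd:
  assumes g: "homogeneous k g" and d: "poly_divides g u"
    and u: "\<And>x t. u (t *s x) = (\<Sum>e\<le>n. U e x * t ^ e)" and U0: "\<And>e x. e > n \<Longrightarrow> U e x = 0"
  shows "poly_divides g (U e)"
proof -
  obtain w where w: "polynomial_fun w" "\<And>x. u x = g x * w x" using d unfolding poly_divides_def by blast
  obtain m W where W: "\<And>e. homogeneous e (W e)" "\<And>e x. e > m \<Longrightarrow> W e x = 0"
      "\<And>x t. w (t *s x) = (\<Sum>e\<le>m. W e x * t ^ e)"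
    using homogeneous_decomposition[OF w(1)] by metis
  define W' where "W' = (\<lambda>e x. if k \<le> e then W (e - k) x else 0)"
  have "U e x = g x * W' e x" for x
  proof (rule polyfun_coeffs_unique[where n = n and m = "m + k" and a = "\<lambda>e. U e x"])
    fix t
    have "(\<Sum>e\<le>n. U e x * t ^ e) = g (t *s x) * w (t *s x)" using u w(2) by metis
    also have "\<dots> = (\<Sum>e\<le>m. g x * W e x * t ^ (e + k))"
      by (simp add: homogeneous_scale[OF g] W(3) sum_distrib_left power_add mult_ac)
    also have "\<dots> = (\<Sum>e\<in>{k..k+m}. g x * W' e x * t ^ e)"
      by (rule sum.reindex_bij_witness[of _ "\<lambda>e. e - k" "\<lambda>e. e + k"]) (auto simp: W'_def)
    also have "\<dots> = (\<Sum>e\<le>m + k. (g x * W' e x) * t ^ e)"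
      unfolding W'_def by (rule sum.mono_neutral_left) auto
    finally show "(\<Sum>e\<le>n. U e x * t ^ e) = (\<Sum>e\<le>m + k. (g x * W' e x) * t ^ e)" .
  qed (use U0 W(2) in \<open>auto simp: W'_def\<close>)
  moreover have "polynomial_fun (W' e)"
    unfolding W'_def using W(1)[THEN homogeneous_imp_polynomial_fun] polynomial_fun_const
    by (cases "k \<le> e") auto
  ultimately show ?thesis unfolding poly_divides_def by auto
qed

text \<open>If the exponent is positive, the constant coefficients of the factors have product zero,
  so one of them contains the variable; removing it lowers the exponent.\<close>

lemma dvd_monom_imp_monom:
  fixes A B :: "'a::idom poly"
  assumes "A * B = Polynomial.monom c d" "c \<noteq> 0"
  shows "\<exists>a i. A = Polynomial.monom a i"
  using assms
proof (induction d arbitrary: A B)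
  case 0
  then have "A dvd [:c:]" by (metis dvd_triv_left monom_0)
  then have "degree A = 0" using "0.prems" by (metis degree_pCons_0 dvd_imp_degree_le le_zero_eq pCons_eq_0_iff)
  then show ?case by (metis degree_eq_zeroE monom_0)
next
  case (Suc d)
  have "coeff A 0 * coeff B 0 = 0" using Suc.prems by (metis coeff_monom coeff_mult_0 nat.distinct(1))
  then consider "coeff A 0 = 0" | "coeff B 0 = 0" by auto
  then show ?case
  proof cases
    case 1
    then obtain A' where A': "A = pCons 0 A'" by (cases A) auto
    then have "A' * B = Polynomial.monom c d" using Suc.prems by (simp add: monom_Suc)
    then obtain a i where "A' = Polynomial.monom a i" using Suc.IH Suc.prems by blast
    then show ?thesis using A' by (metis monom_Suc)
  next
    case 2
    then obtain B' where B': "B = pCons 0 B'" by (cases B) auto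
    then have "A * B' = Polynomial.monom c d" using Suc.prems by (simp add: monom_Suc)
    then show ?thesis using Suc.IH Suc.prems by blast
  qed
qed

text \<open>On a line through the origin where \<open>p\<close> does not vanish, \<open>a\<close> restricts to a divisor of a
  monomial, hence to a monomial.\<close>

lemma homogeneous_left_factor:
  assumes p: "homogeneous d p" "\<exists>x. p x \<noteq> 0" and a: "polynomial_fun a" and b: "polynomial_fun b"
    and eq: "\<And>x. p x = a x * b x"
  shows "\<exists>e. homogeneous e a"
proof -
  obtain n U where U: "\<And>e. homogeneous e (U e)" "\<And>e x. e > n \<Longrightarrow> U e x = 0"
      "\<And>x t. a (t *s x) = (\<Sum>e\<le>n. U e x * t ^ e)"
    using homogeneous_decomposition[OF a] by metis
  have pf: "polynomial_fun p" using p(1) homogeneous_imp_polynomial_fun by blast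
  have Upf: "polynomial_fun (U e)" for e using U(1) homogeneous_imp_polynomial_fun by blast
  have mono: "\<exists>i. \<forall>t. t ^ i * a x = a (t *s x)" if px: "p x \<noteq> 0" for x
  proof -
    obtain A where A: "\<And>t. a (t *s x) = poly A t" using polynomial_fun_line[OF a, of 0 x] by auto
    obtain B where B: "\<And>t. b (t *s x) = poly B t" using polynomial_fun_line[OF b, of 0 x] by auto
    have "poly (A * B) t = poly (Polynomial.monom (p x) d) t" for t
      using A B eq homogeneous_scale[OF p(1)] by (metis mult.commute poly_monom poly_mult)
    then have AB: "A * B = Polynomial.monom (p x) d" using poly_eq_poly_eq_iff by blast
    then obtain c i where c: "A = Polynomial.monom c i" using dvd_monom_imp_monom px by blast
    have "a x = c" using A[of 1] c by (simp add: poly_monom)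
    then show ?thesis using A c by (auto simp: poly_monom mult.commute)
  qed
  have parts: "\<exists>i. \<forall>e. U e x = (if e = i then a x else 0)" if px: "p x \<noteq> 0" for x
  proof -
    obtain i where "\<And>t. t ^ i * a x = a (t *s x)" using mono[OF px] by blast
    then have "\<And>e. U e x = (if e = i then a x else 0)"
      using U(2,3) by (intro homogeneous_part_monomial[where n = n]) auto
    then show ?thesis by blast
  qed
  obtain x0 where x0: "p x0 \<noteq> 0" using p(2) by blast
  then obtain i where i: "\<And>e. U e x0 = (if e = i then a x0 else 0)" using parts by blast
  then have Ui: "\<exists>x. U i x \<noteq> 0" using x0 eq by (metis mult_zero_left)
  then obtain y where y: "p y \<noteq> 0" "U i y \<noteq> 0" using polynomial_fun_mult_nonzero[OF pf Upf p(2)] by blast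
  \<comment> \<open>A priori the degree of the monomial depends on the line. Two parts that are both
    not identically zero would be nonzero at a common point where also \<open>p\<close> is nonzero,
    and there only one part survives.\<close>
  have zero: "U e x = 0" if "e \<noteq> i" for e x
  proof (rule ccontr)
    assume "U e x \<noteq> 0"
    moreover have "\<exists>x. p x * U i x \<noteq> 0" using y by (intro exI[of _ y]) simp
    ultimately obtain z where "p z \<noteq> 0" "U i z \<noteq> 0" "U e z \<noteq> 0"
      using polynomial_fun_mult_nonzero[OF polynomial_fun_mult[OF pf Upf] Upf, of i e] by auto
    then show False using parts that by metis
  qed
  have "a x = U i x" for x
  proof -
    have "i \<le> n" using y U(2) by (meson not_le)
    have "a x = (\<Sum>e\<le>n. U e x)" using U(3)[of 1 x] by simp
    also have "\<dots> = (\<Sum>e\<le>n. if e = i then U i x else 0)" by (intro sum.cong refl) (auto simp: zero)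
    also have "\<dots> = U i x" using \<open>i \<le> n\<close> by simp
    finally show ?thesis .
  qed
  then have "a = U i" by auto
  then show ?thesis using U(1) by blast
qed

lemma homogeneous_factor:
  assumes p: "homogeneous d p" "\<exists>x. p x \<noteq> 0" and a: "polynomial_fun a" and b: "polynomial_fun b"
    and eq: "\<And>x. p x = a x * b x"
  shows "\<exists>i j. i + j = d \<and> homogeneous i a \<and> homogeneous j b"
proof -
  obtain i where i: "homogeneous i a" using homogeneous_left_factor[OF assms] by blast
  obtain j where j: "homogeneous j b"
    using homogeneous_left_factor[OF p b a] eq by (auto simp: mult.commute)
  have "homogeneous (i + j) p" using homogeneous_mult[OF i j] eq[symmetric] by simp
  then show ?thesis using i j homogeneous_degree_unique[OF p(1) _ p(2)] by blast
qed

section \<open>Divisibility and prime polynomials in three variables\<close>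

lemma poly_dividesI: "polynomial_fun r \<Longrightarrow> (\<And>x. b x = a x * r x) \<Longrightarrow> poly_divides a b"
  unfolding poly_divides_def by blast

lemma poly_dividesE:
  assumes "poly_divides a b"
  obtains r where "polynomial_fun r" "\<And>x. b x = a x * r x"
  using assms unfolding poly_divides_def by blast

lemma poly_dvd_refl: "poly_divides g g"
  by (rule poly_dividesI[OF polynomial_fun_const[of 1]]) simp

lemma poly_dvd_mult_right:
  assumes "poly_divides g a" "polynomial_fun b" shows "poly_divides g (\<lambda>x. a x * b x)"
proof -
  obtain r where "polynomial_fun r" "\<And>x. a x = g x * r x" using poly_dividesE[OF assms(1)] by blast
  then show ?thesis by (intro poly_dividesI[OF polynomial_fun_mult[of r b]]) (auto simp: assms)
qed

lemma poly_dvd_mult_left: "poly_divides g a \<Longrightarrow> polynomial_fun b \<Longrightarrow> poly_divides g (\<lambda>x. b x * a x)"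
  using poly_dvd_mult_right[of g a b] by (simp add: mult.commute)

lemma poly_dvd_zero: "poly_divides g (\<lambda>x. 0)"
  by (rule poly_dividesI[OF polynomial_fun_const[of 0]]) simp

lemma poly_dvd_add:
  assumes "poly_divides g a" "poly_divides g b" shows "poly_divides g (\<lambda>x. a x + b x)"
proof -
  obtain r s where "polynomial_fun r" "\<And>x. a x = g x * r x" "polynomial_fun s" "\<And>x. b x = g x * s x"
    using poly_dividesE[OF assms(1)] poly_dividesE[OF assms(2)] by metis
  then show ?thesis by (intro poly_dividesI[OF polynomial_fun_add[of r s]]) (auto simp: distrib_left)
qed

lemma poly_dvd_diff:
  assumes "poly_divides g a" "poly_divides g b" shows "poly_divides g (\<lambda>x. a x - b x)"
  using poly_dvd_add[OF assms(1) poly_dvd_mult_left[OF assms(2) polynomial_fun_const[of "-1"]]] by simp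

lemma poly_dvd_trans:
  assumes "poly_divides a b" "poly_divides b c" shows "poly_divides a c"
proof -
  obtain r s where "polynomial_fun r" "\<And>x. b x = a x * r x" "polynomial_fun s" "\<And>x. c x = b x * s x"
    using poly_dividesE[OF assms(1)] poly_dividesE[OF assms(2)] by metis
  then show ?thesis by (intro poly_dividesI[OF polynomial_fun_mult[of r s]]) (auto simp: mult.assoc)
qed

lemma poly_dvd_sum: "(\<And>i. i \<in> I \<Longrightarrow> poly_divides g (a i)) \<Longrightarrow> poly_divides g (\<lambda>x. \<Sum>i\<in>I. a i x)"
  by (induction I rule: infinite_finite_induct) (auto intro: poly_dvd_zero poly_dvd_add)

lemma poly_dvd_imp_zero: "poly_divides g s \<Longrightarrow> g x = 0 \<Longrightarrow> s x = 0"
  unfolding poly_divides_def by auto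

text \<open>Excluding the constants removes zero and the units at once.\<close>

definition prime_fun :: "(complex ^ 'n::finite \<Rightarrow> complex) \<Rightarrow> bool" where
  "prime_fun g \<longleftrightarrow> polynomial_fun g \<and> \<not> (\<exists>c. \<forall>x. g x = c) \<and>
     (\<forall>a b. polynomial_fun a \<longrightarrow> polynomial_fun b \<longrightarrow> poly_divides g (\<lambda>x. a x * b x) \<longrightarrow>
        poly_divides g a \<or> poly_divides g b)"

lemma prime_fun_nonzero: "prime_fun g \<Longrightarrow> \<exists>x. g x \<noteq> 0"
  unfolding prime_fun_def by metis

lemma prime_fun_polynomial_fun: "prime_fun g \<Longrightarrow> polynomial_fun g"
  unfolding prime_fun_def by blast

lemma prime_fun_dvd_mult:
  "prime_fun g \<Longrightarrow> polynomial_fun a \<Longrightarrow> polynomial_fun b \<Longrightarrow> poly_divides g (\<lambda>x. a x * b x) \<Longrightarrow>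
     poly_divides g a \<or> poly_divides g b"
  unfolding prime_fun_def by blast

text \<open>Identifies polynomial functions with a factorial ring, from which prime factorization is
  taken. The outermost variable is the third coordinate, so that a constant outer polynomial does
  not depend on it; this is the coordinate that elimination removes directly.\<close>

definition eval3 :: "complex poly poly poly \<Rightarrow> complex ^ 3 \<Rightarrow> complex" where
  "eval3 p x = poly (poly (poly p [:[:x $ 3:]:]) [:x $ 2:]) (x $ 1)"

lemma eval3_simps [simp]:
  "eval3 0 x = 0" "eval3 1 x = 1" "eval3 (p + q) x = eval3 p x + eval3 q x"
  "eval3 (p * q) x = eval3 p x * eval3 q x" "eval3 (p ^ n) x = eval3 p x ^ n"
  "eval3 [:[:[:c:]:]:] x = c" "eval3 (p - q) x = eval3 p x - eval3 q x"
  by (auto simp: eval3_def poly_power)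

lemma eval3_sum: "eval3 (sum f A) x = (\<Sum>a\<in>A. eval3 (f a) x)"
  by (simp add: eval3_def poly_sum)

text \<open>A nonzero polynomial over a domain has finitely many roots. The complex constants
  already supply infinitely many arguments, also when the coefficients are themselves
  polynomials.\<close>

lemma poly_eq_0_of_inj:
  fixes P :: "'a::idom poly" and h :: "complex \<Rightarrow> 'a"
  assumes "inj h" "\<And>y. poly P (h y) = 0"
  shows "P = 0"
proof (rule ccontr)
  assume "P \<noteq> 0"
  then have "finite {x. poly P x = 0}" by (rule poly_roots_finite)
  moreover have "range h \<subseteq> {x. poly P x = 0}" using assms(2) by auto
  ultimately have "finite (range h)" by (rule finite_subset[rotated])
  then show False using assms(1) finite_imageD infinite_UNIV_char_0 by blast
qed

lemma eval3_eq_0: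
  assumes "\<And>x. eval3 p x = 0"
  shows "p = 0"
proof -
  have "poly (poly (poly p [:[:z:]:]) [:y:]) x = 0" for x y z
    using assms[of "vector [x, y, z]"] by (simp add: eval3_def)
  then have "poly (poly p [:[:z:]:]) [:y:] = 0" for y z
    using poly_all_0_iff_0 by blast
  then have "poly p [:[:z:]:] = 0" for z
    by (intro poly_eq_0_of_inj[of "\<lambda>y. [:y:]"]) (auto intro: injI)
  then show ?thesis
    by (intro poly_eq_0_of_inj[of "\<lambda>y. [:[:y:]:]"]) (auto intro: injI)
qed

lemma eval3_inject: "(\<And>x. eval3 p x = eval3 q x) \<Longrightarrow> p = q"
  using eval3_eq_0[of "p - q"] by simp

lemma polynomial_fun_eval3: "polynomial_fun (eval3 p)"
proof -
  have 1: "polynomial_fun (\<lambda>x. poly a (x $ 1))" for a :: "complex poly"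
    by (auto simp: poly_altdef intro!: polynomial_fun_sum polynomial_fun_mult polynomial_fun_const
        polynomial_fun_power polynomial_fun_coord)
  have 2: "polynomial_fun (\<lambda>x::complex^3. poly (poly a [:x $ 2:]) (x $ 1))" for a :: "complex poly poly"
    by (induction a) (auto intro!: polynomial_fun_add polynomial_fun_mult polynomial_fun_const
        polynomial_fun_coord 1)
  show ?thesis
    unfolding eval3_def
    by (induction p) (auto intro!: polynomial_fun_add polynomial_fun_mult polynomial_fun_const
        polynomial_fun_coord 2)
qed

lemma polynomial_fun_imp_eval3:
  assumes "polynomial_fun u"
  obtains p where "u = eval3 p"
proof -
  obtain A a where A: "finite A" "\<forall>x. u x = (\<Sum>\<alpha>\<in>A. a \<alpha> * monomial_fun \<alpha> x)"
    using assms unfolding polynomial_fun_def by blast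
  define m where "m = (\<lambda>\<alpha>::3\<Rightarrow>nat. [:[:[:0::complex, 1:]:]:] ^ \<alpha> 1 * [:[:0, 1:]:] ^ \<alpha> 2 * [:0, 1:] ^ \<alpha> 3)"
  have X: "eval3 [:[:[:0, 1:]:]:] x = x $ 1" "eval3 [:[:0, 1:]:] x = x $ 2" "eval3 [:0, 1:] x = x $ 3" for x
    by (simp_all add: eval3_def)
  have "(\<Prod>i\<in>UNIV. h i) = h 1 * h 2 * h 3" for h :: "3 \<Rightarrow> complex"
    unfolding UNIV_3 by (simp add: mult.assoc)
  then have m: "eval3 (m \<alpha>) x = monomial_fun \<alpha> x" for \<alpha> x
    unfolding m_def monomial_fun_def by (simp only: eval3_simps X)
  have "u = eval3 (\<Sum>\<alpha>\<in>A. [:[:[:a \<alpha>:]:]:] * m \<alpha>)"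
    using A(2) by (auto simp only: eval3_sum eval3_simps m intro!: ext)
  then show ?thesis using that by blast
qed

lemma poly_divides_eval3: "poly_divides (eval3 a) (eval3 b) \<longleftrightarrow> a dvd b"
proof
  assume "poly_divides (eval3 a) (eval3 b)"
  then obtain r where r: "polynomial_fun r" "\<And>x. eval3 b x = eval3 a x * r x"
    unfolding poly_divides_def by blast
  then obtain R where "r = eval3 R" using polynomial_fun_imp_eval3 by blast
  then have "b = a * R" using r(2) by (intro eval3_inject) simp
  then show "a dvd b" by simp
next
  assume "a dvd b"
  then obtain k where "b = a * k" by blast
  then show "poly_divides (eval3 a) (eval3 b)"
    by (intro poly_dividesI[OF polynomial_fun_eval3[of k]]) simp
qed

lemma eval3_const: "(\<forall>x. eval3 p x = c) \<longleftrightarrow> p = [:[:[:c:]:]:]"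
  using eval3_inject[of p "[:[:[:c:]:]:]"] by auto

lemma is_unit_poly3_iff:
  "is_unit (p :: complex poly poly poly) \<longleftrightarrow> (\<exists>c. c \<noteq> 0 \<and> p = [:[:[:c:]:]:])"
  by (auto simp: is_unit_poly_iff dvd_field_iff)

lemma prime_fun_eval3: "prime_fun (eval3 p) \<longleftrightarrow> prime_elem p"
proof
  assume p: "prime_fun (eval3 p)"
  show "prime_elem p"
  proof (rule prime_elemI)
    show "p \<noteq> 0" "\<not> is_unit p"
      using p unfolding prime_fun_def is_unit_poly3_iff by auto
    fix a b assume "p dvd a * b"
    then have "poly_divides (eval3 p) (eval3 (a * b))" by (simp only: poly_divides_eval3)
    then have "poly_divides (eval3 p) (\<lambda>x. eval3 a x * eval3 b x)" by (simp add: poly_divides_def)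
    then show "p dvd a \<or> p dvd b"
      using prime_fun_dvd_mult[OF p polynomial_fun_eval3 polynomial_fun_eval3] poly_divides_eval3 by blast
  qed
next
  assume p: "prime_elem p"
  have "\<not> (\<exists>c. \<forall>x. eval3 p x = c)"
  proof
    assume "\<exists>c. \<forall>x. eval3 p x = c"
    then obtain c where "p = [:[:[:c:]:]:]" by (auto simp: eval3_const)
    then show False using p is_unit_poly3_iff[of p] by (cases "c = 0") (auto simp: prime_elem_def)
  qed
  moreover have "poly_divides (eval3 p) a \<or> poly_divides (eval3 p) b"
    if ab: "polynomial_fun a" "polynomial_fun b" "poly_divides (eval3 p) (\<lambda>x. a x * b x)" for a b
  proof -
    obtain A where "a = eval3 A" using polynomial_fun_imp_eval3[OF ab(1)] by blast
    moreover obtain B where "b = eval3 B" using polynomial_fun_imp_eval3[OF ab(2)] by blast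
    ultimately have AB: "a = eval3 A" "b = eval3 B" by auto
    have "poly_divides (eval3 p) (eval3 (A * B))" using ab(3) AB by (simp add: poly_divides_def)
    then show ?thesis using AB poly_divides_eval3 prime_elem_dvd_multD[OF p] by blast
  qed
  ultimately show "prime_fun (eval3 p)" unfolding prime_fun_def using polynomial_fun_eval3 by blast
qed

text \<open>Unique factorization in the shape of an induction rule: arguments below split off one
  prime factor at a time and never handle a full factorization.\<close>

lemma polynomial_fun_prime_induct [consumes 2, case_names const factor]:
  fixes u :: "complex ^ 3 \<Rightarrow> complex"
  assumes "polynomial_fun u" "\<exists>x. u x \<noteq> 0"
    and const: "\<And>c. c \<noteq> 0 \<Longrightarrow> Q (\<lambda>x. c)"
    and factor: "\<And>g u. prime_fun g \<Longrightarrow> polynomial_fun u \<Longrightarrow> \<exists>x. u x \<noteq> 0 \<Longrightarrow> Q u \<Longrightarrow> Q (\<lambda>x. g x * u x)"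
  shows "Q u"
proof -
  have "p \<noteq> 0 \<longrightarrow> Q (eval3 p)" for p
  proof (induction p rule: prime_divisors_induct)
    case (unit p)
    then obtain c where "c \<noteq> 0" "p = [:[:[:c:]:]:]" using is_unit_poly3_iff by blast
    then have "eval3 p = (\<lambda>x. c)" by (auto simp: eval3_simps(6))
    then show ?case using const[OF \<open>c \<noteq> 0\<close>] by simp
  next
    case (factor p q)
    show ?case
    proof
      assume "p * q \<noteq> 0"
      then have "q \<noteq> 0" by auto
      then have "\<exists>x. eval3 q x \<noteq> 0" "Q (eval3 q)" using eval3_eq_0[of q] factor by auto
      moreover have "prime_fun (eval3 p)" using factor prime_fun_eval3 by blast
      ultimately have "Q (\<lambda>x. eval3 p x * eval3 q x)" using assms(4) polynomial_fun_eval3 by blast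
      moreover have "eval3 (p * q) = (\<lambda>x. eval3 p x * eval3 q x)" by (rule ext) simp
      ultimately show "Q (eval3 (p * q))" by simp
    qed
  qed auto
  moreover obtain p where "u = eval3 p" using polynomial_fun_imp_eval3 assms by metis
  moreover have "p \<noteq> 0" using calculation assms(2) by auto
  ultimately show ?thesis by blast
qed

lemma prime_factor_exists:
  fixes u :: "complex ^ 3 \<Rightarrow> complex"
  assumes "polynomial_fun u" "\<not> (\<exists>c. \<forall>x. u x = c)"
  shows "\<exists>g. prime_fun g \<and> poly_divides g u"
proof -
  have "(\<exists>c. \<forall>x. u x = c) \<or> (\<exists>g. prime_fun g \<and> poly_divides g u)"
  proof (rule polynomial_fun_prime_induct[OF assms(1)])
    show "\<exists>x. u x \<noteq> 0" using assms(2) by metis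
    fix g u :: "complex ^ 3 \<Rightarrow> complex" assume "prime_fun g" "polynomial_fun u"
    then show "(\<exists>c. \<forall>x. g x * u x = c) \<or> (\<exists>h. prime_fun h \<and> poly_divides h (\<lambda>x. g x * u x))"
      using poly_dvd_mult_right[OF poly_dvd_refl, of u g] by blast
  qed auto
  then show ?thesis using assms(2) by blast
qed

text \<open>A nonzero element of least degree in the ideal \<open>(g, s)\<close> divides constant multiples of both
  generators.\<close>

lemma prime_elem_elimination:
  fixes g s :: "'a::idom poly"
  assumes "prime_elem g" "\<not> g dvd s"
  shows "\<exists>A B r. A * g + B * s = [:r:] \<and> r \<noteq> 0"
proof -
  define I where "I = {A * g + B * s |A B. True}"
  have Iadd: "a - c * m \<in> I" if "a \<in> I" "m \<in> I" for a m c
  proof -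
    obtain A B A' B' where "a = A * g + B * s" "m = A' * g + B' * s" using \<open>a \<in> I\<close> \<open>m \<in> I\<close> unfolding I_def by blast
    then have "a - c * m = (A - c * A') * g + (B - c * B') * s" by (simp add: algebra_simps)
    then show ?thesis unfolding I_def by blast
  qed
  have "0 * g + 0 * s \<in> I" "1 * g + 0 * s \<in> I" "0 * g + 1 * s \<in> I" unfolding I_def by blast+
  then have I0: "0 \<in> I" and gI: "g \<in> I" and sI: "s \<in> I" by simp_all
  have Imult: "smult c a \<in> I" if "a \<in> I" for a c using Iadd[OF I0 that, of "[:-c:]"] by simp
  have g0: "g \<noteq> 0" using assms(1) by auto
  define m where "m = arg_min degree (\<lambda>m. m \<in> I \<and> m \<noteq> 0)"
  have m: "m \<in> I" "m \<noteq> 0" and min: "\<And>a. a \<in> I \<Longrightarrow> a \<noteq> 0 \<Longrightarrow> degree m \<le> degree a"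
    using arg_min_nat_lemma[of "\<lambda>m. m \<in> I \<and> m \<noteq> 0" g degree] gI g0 unfolding m_def by auto
  \<comment> \<open>Over a domain only pseudo-division is possible, which is why a multiple of
    \<open>a\<close> appears; the pseudo-remainder stays in the ideal and has smaller degree than
    \<open>m\<close>, so it is zero.\<close>
  have div: "\<exists>c q. c \<noteq> 0 \<and> smult c a = m * q" if "a \<in> I" for a
  proof -
    obtain c q where c: "c \<noteq> 0" "smult c a = m * q + pseudo_mod a m" using pseudo_mod(1)[OF m(2)] by blast
    then have "pseudo_mod a m = smult c a - q * m" by (simp add: mult.commute)
    then have "pseudo_mod a m \<in> I" using Iadd[OF Imult[OF that] m(1)] by simp
    then have "pseudo_mod a m = 0" using min pseudo_mod(2)[OF m(2), of a] by force
    then show ?thesis using c by auto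
  qed
  have "\<exists>r\<in>I. r \<noteq> 0 \<and> degree r = 0"
  proof -
    obtain a q where a: "a \<noteq> 0" "smult a g = m * q" using div[OF gI] by blast
    obtain b q' where b: "b \<noteq> 0" "smult b s = m * q'" using div[OF sI] by blast
    \<comment> \<open>If \<open>g\<close> divides \<open>m\<close>, it divides a constant multiple
      of \<open>s\<close>, hence a nonzero constant, and \<open>g\<close> itself has degree 0. If
      \<open>g\<close> divides \<open>q\<close>, cancelling \<open>g\<close> shows that
      \<open>m\<close> divides a nonzero constant.\<close>
    have "g dvd m * q" using a(2) by (metis dvd_refl dvd_smult)
    then consider "g dvd m" | "g dvd q" using assms(1) prime_elem_dvd_multD by blast
    then show ?thesis
    proof cases
      case 1
      then have "g dvd [:b:] * s" using b(2) by simp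
      then have "g dvd [:b:]" using assms prime_elem_dvd_multD by blast
      then have "degree g = 0" using b(1) dvd_imp_degree_le[of g "[:b:]"] by simp
      then show ?thesis using gI g0 by blast
    next
      case 2
      then obtain q'' where "q = g * q''" by blast
      then have "g * [:a:] = g * (m * q'')" using a(2) by (simp add: mult_ac)
      then have "[:a:] = m * q''" by (simp only: mult_left_cancel[OF g0])
      then have "m dvd [:a:]" by simp
      then have "degree m = 0" using a(1) dvd_imp_degree_le[of m "[:a:]"] by simp
      then show ?thesis using m by blast
    qed
  qed
  then obtain r where "r \<in> I" "r \<noteq> 0" "degree r = 0" by blast
  moreover obtain c where "r = [:c:]" using \<open>degree r = 0\<close> by (rule degree_eq_zeroE)
  moreover obtain A B where "r = A * g + B * s" using \<open>r \<in> I\<close> unfolding I_def by blast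
  ultimately show ?thesis by (metis pCons_0_0)
qed

lemma elimination_coord3:
  fixes g s :: "complex ^ 3 \<Rightarrow> complex"
  assumes "prime_fun g" "polynomial_fun s" "\<not> poly_divides g s"
  shows "\<exists>A B r. polynomial_fun A \<and> polynomial_fun B \<and> polynomial_fun r \<and> (\<exists>x. r x \<noteq> 0) \<and>
     (\<forall>x. A x * g x + B x * s x = r x) \<and> (\<forall>x y. (\<forall>j. j \<noteq> 3 \<longrightarrow> x $ j = y $ j) \<longrightarrow> r x = r y)"
proof -
  obtain G S where GS: "g = eval3 G" "s = eval3 S"
    using assms prime_fun_polynomial_fun polynomial_fun_imp_eval3 by metis
  then have "prime_elem G" "\<not> G dvd S" using assms by (auto simp: prime_fun_eval3 poly_divides_eval3)
  then obtain A B r where r: "A * G + B * S = [:r:]" "r \<noteq> 0" using prime_elem_elimination by blast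
  have "eval3 A x * g x + eval3 B x * s x = eval3 [:r:] x" for x
    using arg_cong[OF r(1), of "\<lambda>p. eval3 p x"] GS by simp
  moreover have "\<exists>x. eval3 [:r:] x \<noteq> 0" using eval3_eq_0[of "[:r:]"] r(2) by auto
  moreover have "eval3 [:r:] x = eval3 [:r:] y" if "\<forall>j. j \<noteq> 3 \<longrightarrow> x $ j = y $ j" for x y
    using that[rule_format, of 1] that[rule_format, of 2] by (simp add: eval3_def)
  ultimately show ?thesis using polynomial_fun_eval3 by blast
qed

text \<open>Moves an arbitrary coordinate to the third place, the only one for which elimination is
  done by hand.\<close>

definition swap_coord :: "'n \<Rightarrow> 'n \<Rightarrow> 'a ^ 'n \<Rightarrow> 'a ^ 'n::finite" where
  "swap_coord i k x = (\<chi> j. x $ Transposition.transpose i k j)"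

lemma swap_coord_invol [simp]: "swap_coord i k (swap_coord i k x) = x"
  by (simp add: swap_coord_def vec_eq_iff)

lemma polynomial_fun_swap: "polynomial_fun u \<Longrightarrow> polynomial_fun (\<lambda>x. u (swap_coord i k x))"
  by (rule polynomial_fun_compose) (auto simp: swap_coord_def polynomial_fun_coord)

lemma poly_divides_swap:
  "poly_divides (\<lambda>x. g (swap_coord i k x)) s \<longleftrightarrow> poly_divides g (\<lambda>x. s (swap_coord i k x))"
proof
  assume "poly_divides (\<lambda>x. g (swap_coord i k x)) s"
  then obtain r where "polynomial_fun r" "\<And>x. s x = g (swap_coord i k x) * r x"
    unfolding poly_divides_def by blast
  then show "poly_divides g (\<lambda>x. s (swap_coord i k x))"
    unfolding poly_divides_def by (intro exI[of _ "\<lambda>x. r (swap_coord i k x)"]) (auto intro: polynomial_fun_swap)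
next
  assume "poly_divides g (\<lambda>x. s (swap_coord i k x))"
  then obtain r where r: "polynomial_fun r" "\<And>x. s (swap_coord i k x) = g x * r x"
    unfolding poly_divides_def by blast
  have "s x = g (swap_coord i k x) * r (swap_coord i k x)" for x using r(2)[of "swap_coord i k x"] by simp
  then show "poly_divides (\<lambda>x. g (swap_coord i k x)) s"
    unfolding poly_divides_def using polynomial_fun_swap[OF r(1)] by blast
qed

lemma prime_fun_swap:
  assumes "prime_fun g" shows "prime_fun (\<lambda>x. g (swap_coord i k x))"
  unfolding prime_fun_def
proof (intro conjI allI impI)
  show "polynomial_fun (\<lambda>x. g (swap_coord i k x))"
    using assms polynomial_fun_swap prime_fun_polynomial_fun by blast
  show "\<not> (\<exists>c. \<forall>x. g (swap_coord i k x) = c)"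
    using assms unfolding prime_fun_def by (metis swap_coord_invol)
  show "poly_divides (\<lambda>x. g (swap_coord i k x)) a \<or> poly_divides (\<lambda>x. g (swap_coord i k x)) b"
    if "polynomial_fun a" "polynomial_fun b" "poly_divides (\<lambda>x. g (swap_coord i k x)) (\<lambda>x. a x * b x)" for a b
    using that(3) prime_fun_dvd_mult[OF assms polynomial_fun_swap[OF that(1)] polynomial_fun_swap[OF that(2)]]
    unfolding poly_divides_swap by blast
qed

lemma elimination:
  fixes g s :: "complex ^ 3 \<Rightarrow> complex"
  assumes "prime_fun g" "polynomial_fun s" "\<not> poly_divides g s"
  shows "\<exists>A B r. polynomial_fun A \<and> polynomial_fun B \<and> polynomial_fun r \<and> (\<exists>x. r x \<noteq> 0) \<and>
     (\<forall>x. A x * g x + B x * s x = r x) \<and> (\<forall>x y. (\<forall>j. j \<noteq> i \<longrightarrow> x $ j = y $ j) \<longrightarrow> r x = r y)"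
proof -
  define \<sigma> where "\<sigma> = (swap_coord i 3 :: complex ^ 3 \<Rightarrow> _)"
  have "\<not> poly_divides (\<lambda>x. g (\<sigma> x)) (\<lambda>x. s (\<sigma> x))"
    using assms(3) unfolding \<sigma>_def poly_divides_swap by simp
  then obtain A B r where r: "polynomial_fun A" "polynomial_fun B" "polynomial_fun r" "\<exists>x. r x \<noteq> 0"
      "\<And>x. A x * g (\<sigma> x) + B x * s (\<sigma> x) = r x" "\<And>x y. (\<forall>j. j \<noteq> 3 \<longrightarrow> x $ j = y $ j) \<Longrightarrow> r x = r y"
    using elimination_coord3[OF prime_fun_swap[OF assms(1)] polynomial_fun_swap[OF assms(2)], of i 3 i 3]
    unfolding \<sigma>_def by blast
  have ss: "\<sigma> (\<sigma> x) = x" for x unfolding \<sigma>_def by simp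
  have "r (\<sigma> x) = r (\<sigma> y)" if "\<forall>j. j \<noteq> i \<longrightarrow> x $ j = y $ j" for x y
    using that by (intro r(6)) (auto simp: \<sigma>_def swap_coord_def Transposition.transpose_def)
  moreover have "A (\<sigma> x) * g x + B (\<sigma> x) * s x = r (\<sigma> x)" for x using r(5)[of "\<sigma> x"] ss by simp
  moreover have "\<exists>x. r (\<sigma> x) \<noteq> 0" using r(4) ss by metis
  ultimately show ?thesis using r(1-3) polynomial_fun_swap unfolding \<sigma>_def
    by (intro exI[of _ "\<lambda>x. A (swap_coord i 3 x)"] exI[of _ "\<lambda>x. B (swap_coord i 3 x)"]
      exI[of _ "\<lambda>x. r (swap_coord i 3 x)"]) auto
qed

text \<open>One takes a nonzero homogeneous part of the relation \<open>A g + B s = r\<close>. Its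
  two summands are still multiples of \<open>g\<close> and of \<open>s\<close>, because these are
  forms, and independence of the eliminated coordinate passes to the parts, which are coefficients
  in \<open>t\<close>.\<close>

lemma homogeneous_elimination:
  fixes g s :: "complex ^ 3 \<Rightarrow> complex"
  assumes g: "prime_fun g" "homogeneous k g" and s: "homogeneous l s" "\<not> poly_divides g s"
  shows "\<exists>A B r e. polynomial_fun A \<and> polynomial_fun B \<and> homogeneous e r \<and> (\<exists>x. r x \<noteq> 0) \<and>
     (\<forall>x. A x * g x + B x * s x = r x) \<and> (\<forall>x y. (\<forall>j. j \<noteq> i \<longrightarrow> x $ j = y $ j) \<longrightarrow> r x = r y)"
proof -
  obtain A B r where r: "polynomial_fun A" "polynomial_fun B" "polynomial_fun r" "\<exists>x. r x \<noteq> 0"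
      "\<And>x. A x * g x + B x * s x = r x" "\<And>x y. (\<forall>j. j \<noteq> i \<longrightarrow> x $ j = y $ j) \<Longrightarrow> r x = r y"
    using elimination[OF g(1) homogeneous_imp_polynomial_fun[OF s(1)] s(2), of i] by blast
  have pf: "polynomial_fun (\<lambda>x. A x * g x)" "polynomial_fun (\<lambda>x. B x * s x)"
    using r(1,2) g s by (auto intro: polynomial_fun_mult homogeneous_imp_polynomial_fun)
  obtain n U where U: "\<And>e. homogeneous e (U e)" "\<And>e x. e > n \<Longrightarrow> U e x = 0"
      "\<And>x t. A (t *s x) * g (t *s x) = (\<Sum>e\<le>n. U e x * t ^ e)"
    using homogeneous_decomposition[OF pf(1)] by metis
  obtain m V where V: "\<And>e. homogeneous e (V e)" "\<And>e x. e > m \<Longrightarrow> V e x = 0"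
      "\<And>x t. B (t *s x) * s (t *s x) = (\<Sum>e\<le>m. V e x * t ^ e)"
    using homogeneous_decomposition[OF pf(2)] by metis
  define N where "N = n + m"
  define W where "W = (\<lambda>e x. U e x + V e x)"
  have W: "r (t *s x) = (\<Sum>e\<le>N. W e x * t ^ e)" for t x
  proof -
    have "(\<Sum>e\<le>n. U e x * t ^ e) = (\<Sum>e\<le>N. U e x * t ^ e)"
      unfolding N_def using U(2) by (intro sum.mono_neutral_left) auto
    moreover have "(\<Sum>e\<le>m. V e x * t ^ e) = (\<Sum>e\<le>N. V e x * t ^ e)"
      unfolding N_def using V(2) by (intro sum.mono_neutral_left) auto
    ultimately show ?thesis
      using r(5)[of "t *s x"] U(3)[of t x] V(3)[of t x] by (simp add: W_def sum.distrib algebra_simps)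
  qed
  obtain x0 where "r x0 \<noteq> 0" using r(4) by blast
  then have "(\<Sum>e\<le>N. W e x0) \<noteq> 0" using W[of 1 x0] by simp
  then obtain e where e: "W e x0 \<noteq> 0" by (meson sum.neutral)
  have indep: "W e x = W e y" if "\<forall>j. j \<noteq> i \<longrightarrow> x $ j = y $ j" for x y
  proof (rule polyfun_coeffs_unique[where n = N and m = N and a = "\<lambda>e. W e x"])
    fix t
    have "r (t *s x) = r (t *s y)" using that by (intro r(6)) simp
    then show "(\<Sum>e\<le>N. W e x * t ^ e) = (\<Sum>e\<le>N. W e y * t ^ e)" by (simp add: W)
  qed (use U(2) V(2) in \<open>auto simp: W_def N_def\<close>)
  have "poly_divides g (U e)"
    by (rule homogeneous_part_dvd[OF g(2) _ U(3,2)]) (use r(1) in \<open>auto intro: poly_dvd_mult_left poly_dvd_refl\<close>)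
  then obtain A' where A': "polynomial_fun A'" "\<And>x. U e x = g x * A' x" unfolding poly_divides_def by blast
  have "poly_divides s (V e)"
    by (rule homogeneous_part_dvd[OF s(1) _ V(3,2)]) (use r(2) in \<open>auto intro: poly_dvd_mult_left poly_dvd_refl\<close>)
  then obtain B' where B': "polynomial_fun B'" "\<And>x. V e x = s x * B' x" unfolding poly_divides_def by blast
  have "homogeneous e (W e)" unfolding W_def by (intro homogeneous_add U V)
  moreover have "\<forall>x. A' x * g x + B' x * s x = W e x" using A' B' by (simp add: W_def mult.commute)
  ultimately show ?thesis using A' B' e indep by blast
qed

section \<open>Hypersurfaces of the projective plane\<close>

text \<open>If \<open>g\<close> does not divide \<open>s\<close>, eliminate \<open>x\<^sub>i\<close>: on a line parallel to the \<open>i\<close>-th axis where the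
  eliminant does not vanish, \<open>g\<close> has no zero and is therefore constant.\<close>

lemma prime_dvd_of_vanishing:
  fixes g s :: "complex ^ 3 \<Rightarrow> complex"
  assumes g: "prime_fun g" and s: "polynomial_fun s" and van: "\<And>x. x \<noteq> 0 \<Longrightarrow> g x = 0 \<Longrightarrow> s x = 0"
  shows "poly_divides g s"
proof (rule ccontr)
  assume nd: "\<not> poly_divides g s"
  have gpf: "polynomial_fun g" using g prime_fun_polynomial_fun by blast
  have shift: "g (x + t *s axis i 1) = g x" for i t x
  proof -
    obtain A B r where r: "polynomial_fun r" "\<exists>x. r x \<noteq> 0" "\<And>x. A x * g x + B x * s x = r x"
        "\<And>x y. (\<forall>j. j \<noteq> i \<longrightarrow> x $ j = y $ j) \<Longrightarrow> r x = r y"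
      using elimination[OF g s nd, of i] by metis
    \<comment> \<open>A line parallel to the \<open>i\<close>-th axis along which the coordinate
      \<open>l\<close> is a nonzero constant avoids the origin, where nothing is assumed about the
      zeros of \<open>g\<close>.\<close>
    obtain l :: 3 where l: "l \<noteq> i" by (metis (full_types) num1_eq1 zero_neq_one)
    have line: "g (x + t *s axis i 1) = g x" if "r x \<noteq> 0" "x $ l \<noteq> 0" for x
    proof -
      obtain q where q: "\<And>t. g (x + t *s axis i 1) = poly q t" using polynomial_fun_line[OF gpf] by blast
      have "poly q t \<noteq> 0" for t
      proof
        let ?y = "x + t *s axis i 1"
        assume "poly q t = 0"
        then have "g ?y = 0" using q by simp
        moreover have "?y $ l \<noteq> 0" using that l by (simp add: axis_def)
        then have "?y \<noteq> 0" by (metis zero_index)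
        ultimately have "r ?y = 0" using van[of ?y] r(3)[of ?y] by simp
        moreover have "r ?y = r x" by (rule r(4)) (simp add: axis_def)
        ultimately show False using that by simp
      qed
      then have "constant (poly q)" using fundamental_theorem_of_algebra by blast
      then have "poly q t = poly q 0" unfolding constant_def by blast
      then show ?thesis using q[of t] q[of 0] by simp
    qed
    have "polynomial_fun (\<lambda>x. g (x + t *s axis i 1))"
      by (rule polynomial_fun_compose[OF gpf])
         (simp add: polynomial_fun_add polynomial_fun_coord polynomial_fun_const)
    then show ?thesis
    \<comment> \<open>Invariance under the shift is known only off the zeros of \<open>r\<close> and
      of the coordinate \<open>l\<close>; their product is a nonzero polynomial and cancels.\<close>
    proof (intro polynomial_fun_cancel[OF polynomial_fun_mult[OF r(1) polynomial_fun_coord[of l]] _ gpf])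
      show "\<exists>x. r x * x $ l \<noteq> 0"
        using polynomial_fun_mult_nonzero[OF r(1) polynomial_fun_coord[of l] r(2)]
        by (metis mult_eq_0_iff one_index zero_neq_one)
      show "r x * x $ l * g (x + t *s axis i 1) = r x * x $ l * g x" for x
        using line[of x] by auto
    qed
  qed
  have "g x = g 0" for x
  proof -
    have "x = 0 + x $ 1 *s axis 1 1 + x $ 2 *s axis 2 1 + x $ 3 *s axis 3 1"
      by (simp add: vec_eq_iff axis_def forall_3)
    then show ?thesis by (metis shift)
  qed
  then show False using g unfolding prime_fun_def by blast
qed

lemma prime_fun_degree_pos:
  assumes "prime_fun g" "homogeneous k g" shows "k \<ge> 1"
proof (rule ccontr)
  assume "\<not> k \<ge> 1"
  then have "k = 0" by simp
  then have "g x = g 0" for x using homogeneous_scale[of k g 0 x] assms(2) by simp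
  then show False using assms(1) unfolding prime_fun_def by blast
qed

lemma prime_not_dvd_const:
  assumes "prime_fun g" "c \<noteq> 0" shows "\<not> poly_divides g (\<lambda>x. c)"
proof
  assume "poly_divides g (\<lambda>x. c)"
  then obtain r where r: "polynomial_fun r" "\<And>x. c = g x * r x" using poly_dividesE by blast
  then have "homogeneous 0 g"
    using homogeneous_factor[OF homogeneous_const[of c] _ prime_fun_polynomial_fun[OF assms(1)] r(1)] assms(2)
    by auto
  then show False using prime_fun_degree_pos assms(1) by fastforce
qed

section \<open>Zero loci of forms, irreducible curves and components\<close>

lemma pt_in_zero_locus:
  assumes "\<And>p. p \<in> S \<Longrightarrow> \<exists>d. homogeneous d p" "x \<noteq> 0"
  shows "pt x \<in> zero_locus S \<longleftrightarrow> (\<forall>p\<in>S. p x = 0)"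
proof
  assume "pt x \<in> zero_locus S"
  then obtain y where y: "pt x = pt y" "y \<noteq> 0" "\<forall>p\<in>S. p y = 0" unfolding zero_locus_def by auto
  then obtain c where c: "x = c *s y" using pt_eq_iff[of y x] assms by auto
  show "\<forall>p\<in>S. p x = 0"
  proof
    fix p assume "p \<in> S"
    then obtain d where "homogeneous d p" using assms by blast
    then show "p x = 0" using c y \<open>p \<in> S\<close> by (simp add: homogeneous_scale)
  qed
qed (use assms in \<open>auto simp: zero_locus_def\<close>)

lemma pt_in_zero_locus_single:
  "homogeneous d p \<Longrightarrow> x \<noteq> 0 \<Longrightarrow> pt x \<in> zero_locus {p} \<longleftrightarrow> p x = 0"
  using pt_in_zero_locus[of "{p}" x] by auto

lemma in_zero_locusE:
  assumes "z \<in> zero_locus S" obtains x where "z = pt x" "x \<noteq> 0"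
  using assms unfolding zero_locus_def by auto

lemma zero_locus_subset_iff:
  assumes "\<And>p. p \<in> S \<Longrightarrow> \<exists>d. homogeneous d p" "\<And>p. p \<in> T \<Longrightarrow> \<exists>d. homogeneous d p"
  shows "zero_locus S \<subseteq> zero_locus T \<longleftrightarrow> (\<forall>x. x \<noteq> 0 \<longrightarrow> (\<forall>p\<in>S. p x = 0) \<longrightarrow> (\<forall>p\<in>T. p x = 0))"
proof
  assume L: "zero_locus S \<subseteq> zero_locus T"
  show "\<forall>x. x \<noteq> 0 \<longrightarrow> (\<forall>p\<in>S. p x = 0) \<longrightarrow> (\<forall>p\<in>T. p x = 0)"
    using L pt_in_zero_locus[OF assms(1)] pt_in_zero_locus[OF assms(2)] by blast
next
  assume "\<forall>x. x \<noteq> 0 \<longrightarrow> (\<forall>p\<in>S. p x = 0) \<longrightarrow> (\<forall>p\<in>T. p x = 0)"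
  then show "zero_locus S \<subseteq> zero_locus T" unfolding zero_locus_def by blast
qed

lemma zero_locus_subset_single_iff:
  assumes "homogeneous d p" "homogeneous e q"
  shows "zero_locus {p} \<subseteq> zero_locus {q} \<longleftrightarrow> (\<forall>x. x \<noteq> 0 \<longrightarrow> p x = 0 \<longrightarrow> q x = 0)"
  using zero_locus_subset_iff[of "{p}" "{q}"] assms by auto

lemma zero_locus_mono_dvd:
  assumes "homogeneous d p" "homogeneous e q" "poly_divides p q"
  shows "zero_locus {p} \<subseteq> zero_locus {q}"
  using poly_dvd_imp_zero[OF assms(3)] zero_locus_subset_single_iff[OF assms(1,2)] by blast

lemma zero_locus_subset_iff_dvd:
  fixes g s :: "complex ^ 3 \<Rightarrow> complex"
  assumes "prime_fun g" "homogeneous k g" "homogeneous d s"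
  shows "zero_locus {g} \<subseteq> zero_locus {s} \<longleftrightarrow> poly_divides g s"
  using zero_locus_mono_dvd[OF assms(2,3)] zero_locus_subset_single_iff[OF assms(2,3)]
    prime_dvd_of_vanishing[OF assms(1) homogeneous_imp_polynomial_fun[OF assms(3)]] by blast

lemma algebraic_zero_locus:
  "(\<And>p. p \<in> S \<Longrightarrow> \<exists>d. homogeneous d p) \<Longrightarrow> algebraic_set (zero_locus S)"
  unfolding algebraic_set_def by blast

lemma algebraic_zero_locus_single: "homogeneous d p \<Longrightarrow> algebraic_set (zero_locus {p})"
  by (rule algebraic_zero_locus) auto

lemma algebraic_Int:
  assumes "algebraic_set A" "algebraic_set B" shows "algebraic_set (A \<inter> B)"
proof -
  obtain S T where S: "\<forall>p\<in>S. \<exists>d. homogeneous d p" "A = zero_locus S"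
    and T: "\<forall>p\<in>T. \<exists>d. homogeneous d p" "B = zero_locus T"
    using assms unfolding algebraic_set_def by blast
  have "A \<inter> B = zero_locus (S \<union> T)"
  proof (intro set_eqI iffI)
    fix z assume "z \<in> A \<inter> B"
    then obtain x where x: "z = pt x" "x \<noteq> 0" using S(2) in_zero_locusE by blast
    then show "z \<in> zero_locus (S \<union> T)"
      using \<open>z \<in> A \<inter> B\<close> S T pt_in_zero_locus[of S x] pt_in_zero_locus[of T x] pt_in_zero_locus[of "S \<union> T" x]
      by blast
  qed (auto simp: S T zero_locus_def)
  then show ?thesis using S T by (auto intro!: algebraic_zero_locus)
qed

lemma algebraic_setE:
  assumes "algebraic_set A"
  obtains S where "\<And>p. p \<in> S \<Longrightarrow> \<exists>d. homogeneous d p" "A = zero_locus S"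
  using assms unfolding algebraic_set_def by blast

text \<open>If both closed sets were proper, one equation from each, neither vanishing on the whole
  curve, would have a product that vanishes there; primality of \<open>g\<close> forbids
  this.\<close>

lemma irreducible_zero_locus:
  fixes g :: "complex ^ 3 \<Rightarrow> complex"
  assumes g: "prime_fun g" "homogeneous k g"
  shows "irreducible_algebraic (zero_locus {g})"
  unfolding irreducible_algebraic_def
proof (intro conjI allI impI)
  show "algebraic_set (zero_locus {g})" by (rule algebraic_zero_locus_single[OF g(2)])
  show "zero_locus {g} \<noteq> {}"
  proof
    assume "zero_locus {g} = {}"
    then have "poly_divides g (\<lambda>x. 1)"
      by (intro prime_dvd_of_vanishing[OF g(1) polynomial_fun_const]) (auto simp: zero_locus_def)
    then show False using prime_not_dvd_const[OF g(1), of 1] by simp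
  qed
  fix A B :: "3 proj set" assume AB: "algebraic_set A \<and> algebraic_set B \<and> zero_locus {g} = A \<union> B"
  obtain S where S: "\<And>p. p \<in> S \<Longrightarrow> \<exists>d. homogeneous d p" "A = zero_locus S" using AB algebraic_setE by blast
  obtain T where T: "\<And>p. p \<in> T \<Longrightarrow> \<exists>d. homogeneous d p" "B = zero_locus T" using AB algebraic_setE by blast
  have h: "\<exists>d. homogeneous d p" if "p \<in> {g}" for p using that g by auto
  show "zero_locus {g} = A \<or> zero_locus {g} = B"
  proof (rule ccontr)
    assume "\<not> ?thesis"
    then have "\<not> zero_locus {g} \<subseteq> zero_locus S" "\<not> zero_locus {g} \<subseteq> zero_locus T" using AB S T by auto
    moreover have "zero_locus {g} \<subseteq> zero_locus S \<longleftrightarrow> (\<forall>x. x \<noteq> 0 \<longrightarrow> g x = 0 \<longrightarrow> (\<forall>p\<in>S. p x = 0))"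
      using zero_locus_subset_iff[of "{g}" S] h S(1) by simp
    moreover have "zero_locus {g} \<subseteq> zero_locus T \<longleftrightarrow> (\<forall>x. x \<noteq> 0 \<longrightarrow> g x = 0 \<longrightarrow> (\<forall>p\<in>T. p x = 0))"
      using zero_locus_subset_iff[of "{g}" T] h T(1) by simp
    ultimately obtain a b x y where ab: "a \<in> S" "b \<in> T"
      and xy: "g x = 0" "a x \<noteq> 0" "g y = 0" "b y \<noteq> 0" by blast
    have pf: "polynomial_fun a" "polynomial_fun b" using ab S(1) T(1) homogeneous_imp_polynomial_fun by blast+
    have "a z * b z = 0" if "z \<noteq> 0" "g z = 0" for z
    proof -
      have "pt z \<in> A \<union> B" using that AB by (auto simp: zero_locus_def)
      then show ?thesis using that ab S T pt_in_zero_locus[of S z] pt_in_zero_locus[of T z] by auto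
    qed
    then have "poly_divides g (\<lambda>x. a x * b x)"
      by (intro prime_dvd_of_vanishing[OF g(1) polynomial_fun_mult[OF pf]]) auto
    then have "poly_divides g a \<or> poly_divides g b" using prime_fun_dvd_mult[OF g(1) pf] by blast
    then show False using xy poly_dvd_imp_zero by blast
  qed
qed

lemma hypersurface_prime: "prime_fun g \<Longrightarrow> homogeneous k g \<Longrightarrow> hypersurface (zero_locus {g})"
  unfolding hypersurface_def using prime_fun_degree_pos prime_fun_nonzero by blast

lemma prime_factor_homogeneous:
  assumes "homogeneous d p" "\<exists>x. p x \<noteq> 0" "prime_fun g" "poly_divides g p"
  shows "\<exists>k. homogeneous k g"
proof -
  obtain r where "polynomial_fun r" "\<And>x. p x = g x * r x" using assms poly_dividesE by blast
  then show ?thesis using homogeneous_factor[OF assms(1,2) prime_fun_polynomial_fun[OF assms(3)]] by blast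
qed

text \<open>An irreducible set inside the zeros of a product lies in the zeros of one factor. Prime
  factors are removed until one contains \<open>C\<close>; a nonzero constant cannot remain, since
  its zero locus is empty.\<close>

lemma irreducible_in_prime_zero_locus:
  fixes p :: "complex ^ 3 \<Rightarrow> complex"
  assumes C: "irreducible_algebraic C" and p: "homogeneous d p" "\<exists>x. p x \<noteq> 0" "C \<subseteq> zero_locus {p}"
  shows "\<exists>g k. prime_fun g \<and> homogeneous k g \<and> poly_divides g p \<and> C \<subseteq> zero_locus {g}"
proof -
  have "\<forall>d. homogeneous d p \<longrightarrow> C \<subseteq> zero_locus {p} \<longrightarrow>
      (\<exists>g k. prime_fun g \<and> homogeneous k g \<and> poly_divides g p \<and> C \<subseteq> zero_locus {g})"
    using homogeneous_imp_polynomial_fun[OF p(1)] p(2)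
  proof (induction p rule: polynomial_fun_prime_induct)
    case (const c)
    then show ?case using C by (auto simp: zero_locus_def irreducible_algebraic_def)
  next
    case (factor g u)
    show ?case
    proof (intro allI impI)
      fix d assume d: "homogeneous d (\<lambda>x. g x * u x)" and sub: "C \<subseteq> zero_locus {\<lambda>x. g x * u x}"
      have gpf: "polynomial_fun g" and g0: "\<exists>x. g x \<noteq> 0"
        using factor prime_fun_polynomial_fun prime_fun_nonzero by blast+
      have "\<exists>x. g x * u x \<noteq> 0"
        using polynomial_fun_mult_nonzero[OF gpf factor(2) g0 factor(3)] by auto
      then obtain i j where ij: "homogeneous i g" "homogeneous j u"
        using homogeneous_factor[OF d _ gpf factor(2)] by blast
      have "C = (C \<inter> zero_locus {g}) \<union> (C \<inter> zero_locus {u})"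
      proof -
        have "z \<in> zero_locus {g} \<or> z \<in> zero_locus {u}" if "z \<in> C" for z
          using that sub unfolding zero_locus_def by fastforce
        then show ?thesis by blast
      qed
      moreover have "algebraic_set (C \<inter> zero_locus {g})" "algebraic_set (C \<inter> zero_locus {u})"
        using C algebraic_Int algebraic_zero_locus_single ij unfolding irreducible_algebraic_def by blast+
      ultimately have "C = C \<inter> zero_locus {g} \<or> C = C \<inter> zero_locus {u}"
        using C unfolding irreducible_algebraic_def by blast
      then consider "C \<subseteq> zero_locus {g}" | "C \<subseteq> zero_locus {u}" by blast
      then show "\<exists>g' k. prime_fun g' \<and> homogeneous k g' \<and> poly_divides g' (\<lambda>x. g x * u x) \<and> C \<subseteq> zero_locus {g'}"
      proof cases
        case 1
        then show ?thesis using factor(1) ij(1) poly_dvd_mult_right[OF poly_dvd_refl factor(2)] by blast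
      next
        case 2
        then show ?thesis using factor(4) ij(2) poly_dvd_mult_left[OF _ gpf] by blast
      qed
    qed
  qed
  then show ?thesis using p by blast
qed

lemma irreducible_hypersurfaceE:
  fixes Z :: "3 proj set"
  assumes "irreducible_algebraic Z" "hypersurface Z"
  obtains g k where "prime_fun g" "homogeneous k g" "Z = zero_locus {g}"
proof -
  obtain d p where p: "homogeneous d p" "\<exists>x. p x \<noteq> 0" "Z = zero_locus {p}"
    using assms(2) unfolding hypersurface_def by blast
  then obtain g k where g: "prime_fun g" "homogeneous k g" "poly_divides g p" "Z \<subseteq> zero_locus {g}"
    using irreducible_in_prime_zero_locus[OF assms(1)] by blast
  then have "zero_locus {g} \<subseteq> Z" using zero_locus_mono_dvd p by blast
  then show ?thesis using that g by blast
qed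

text \<open>Writing \<open>h = g r\<close>, the prime \<open>h\<close> divides \<open>g\<close> or
  \<open>r\<close>; in the latter case \<open>g\<close> would be a unit. Hence the primes are
  associated.\<close>

lemma prime_dvd_prime:
  fixes g h :: "complex ^ 3 \<Rightarrow> complex"
  assumes "prime_fun g" "homogeneous k g" "prime_fun h" "homogeneous l h" "poly_divides g h"
  shows "zero_locus {g} = zero_locus {h}"
proof -
  obtain r where r: "polynomial_fun r" "\<And>x. h x = g x * r x" using assms(5) poly_dividesE by blast
  have pf: "polynomial_fun g" "polynomial_fun h" using assms prime_fun_polynomial_fun by blast+
  have "poly_divides h (\<lambda>x. g x * r x)"
    by (rule poly_dividesI[OF polynomial_fun_const[of 1]]) (simp add: r)
  then have "poly_divides h g \<or> poly_divides h r" using prime_fun_dvd_mult[OF assms(3) pf(1) r(1)] by blast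
  moreover have "\<not> poly_divides h r"
  proof
    assume "poly_divides h r"
    then obtain s where s: "polynomial_fun s" "\<And>x. r x = h x * s x" using poly_dividesE by blast
    have "h x * (g x * s x) = h x * 1" for x using r(2)[of x] s(2)[of x] by (simp add: mult_ac)
    then have gs: "g x * s x = 1" for x
      by (rule polynomial_fun_cancel[OF pf(2) polynomial_fun_mult[OF pf(1) s(1)] polynomial_fun_const
            prime_fun_nonzero[OF assms(3)]])
    have "poly_divides g (\<lambda>x. 1)" by (rule poly_dividesI[OF s(1)]) (simp add: gs)
    then show False using prime_not_dvd_const[OF assms(1), of 1] by simp
  qed
  ultimately have "poly_divides h g" by blast
  then show ?thesis
    using zero_locus_mono_dvd[OF assms(2,4,5)] zero_locus_mono_dvd[OF assms(4,2)] by blast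
qed

text \<open>Components are exactly the curves of prime divisors. Maximality holds because one
  irreducible curve cannot lie properly inside another.\<close>

lemma irreducible_component_zero_locus:
  fixes p :: "complex ^ 3 \<Rightarrow> complex"
  assumes p: "homogeneous d p" "\<exists>x. p x \<noteq> 0"
  shows "irreducible_component C (zero_locus {p}) \<longleftrightarrow>
    (\<exists>g k. prime_fun g \<and> homogeneous k g \<and> poly_divides g p \<and> C = zero_locus {g})"
proof
  assume C: "irreducible_component C (zero_locus {p})"
  then have "irreducible_algebraic C" "C \<subseteq> zero_locus {p}" unfolding irreducible_component_def by simp_all
  then obtain g k where g: "prime_fun g" "homogeneous k g" "poly_divides g p" "C \<subseteq> zero_locus {g}"
    using irreducible_in_prime_zero_locus[OF _ p] by blast
  have "\<And>D. irreducible_algebraic D \<Longrightarrow> C \<subseteq> D \<Longrightarrow> D \<subseteq> zero_locus {p} \<Longrightarrow> D = C"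
    using C unfolding irreducible_component_def by blast
  from this[OF irreducible_zero_locus[OF g(1,2)] g(4) zero_locus_mono_dvd[OF g(2) p(1) g(3)]]
  have "zero_locus {g} = C" .
  then show "\<exists>g k. prime_fun g \<and> homogeneous k g \<and> poly_divides g p \<and> C = zero_locus {g}" using g by blast
next
  assume "\<exists>g k. prime_fun g \<and> homogeneous k g \<and> poly_divides g p \<and> C = zero_locus {g}"
  then obtain g k where g: "prime_fun g" "homogeneous k g" "poly_divides g p" "C = zero_locus {g}" by blast
  have "D = C" if D: "irreducible_algebraic D" "C \<subseteq> D" "D \<subseteq> zero_locus {p}" for D
  proof -
    obtain h l where h: "prime_fun h" "homogeneous l h" "D \<subseteq> zero_locus {h}"
      using irreducible_in_prime_zero_locus[OF D(1) p D(3)] by blast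
    then have "zero_locus {g} \<subseteq> zero_locus {h}" using D g by blast
    then have "zero_locus {g} = zero_locus {h}"
      using prime_dvd_prime[OF g(1,2) h(1,2)] zero_locus_subset_iff_dvd[OF g(1,2) h(2)] by blast
    then show ?thesis using D h g by blast
  qed
  then show "irreducible_component C (zero_locus {p})"
    unfolding irreducible_component_def using irreducible_zero_locus[OF g(1,2)] g(4)
      zero_locus_mono_dvd[OF g(2) p(1) g(3)] by (intro conjI allI impI) auto
qed

section \<open>Forms vanishing on the image of a curve\<close>

text \<open>Gaussian elimination, one equation and one unknown at a time: the pivot \<open>k\<close>
  is removed from the other equations, and \<open>d k\<close> is then chosen so as to satisfy
  equation \<open>j\<close>.\<close>

lemma linear_system_nontrivial:
  fixes M :: "'i \<Rightarrow> 'j \<Rightarrow> 'a::field"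
  assumes "finite J" "finite I" "card J < card I"
  shows "\<exists>c. (\<exists>i\<in>I. c i \<noteq> 0) \<and> (\<forall>j\<in>J. (\<Sum>i\<in>I. c i * M i j) = 0)"
  using assms
proof (induction J arbitrary: I M rule: finite_induct)
  case empty
  then have "I \<noteq> {}" by auto
  then show ?case by (intro exI[of _ "\<lambda>_. 1"]) auto
next
  case (insert j J)
  show ?case
  proof (cases "\<forall>i\<in>I. M i j = 0")
    case True
    obtain c where "\<exists>i\<in>I. c i \<noteq> 0" "\<forall>j\<in>J. (\<Sum>i\<in>I. c i * M i j) = 0"
      using insert.IH[of I M] insert.hyps insert.prems by (auto dest: Suc_lessD)
    then show ?thesis using True by (intro exI[of _ c]) simp
  next
    case False
    then obtain k where k: "k \<in> I" "M k j \<noteq> 0" by blast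
    define M' where "M' = (\<lambda>i j'. M i j' - M i j / M k j * M k j')"
    have "card J < card (I - {k})" using insert k by simp
    then obtain c where c: "\<exists>i\<in>I - {k}. c i \<noteq> 0" "\<forall>j\<in>J. (\<Sum>i\<in>I - {k}. c i * M' i j) = 0"
      using insert.IH[of "I - {k}" M'] insert.prems by auto
    define d where "d = (\<lambda>i. if i = k then - (\<Sum>i\<in>I - {k}. c i * (M i j / M k j)) else c i)"
    have split: "(\<Sum>i\<in>I. d i * M i j') = d k * M k j' + (\<Sum>i\<in>I - {k}. c i * M i j')" for j'
    proof -
      have "(\<Sum>i\<in>I. d i * M i j') = d k * M k j' + (\<Sum>i\<in>I - {k}. d i * M i j')"
        using insert k by (simp add: sum.remove)
      also have "(\<Sum>i\<in>I - {k}. d i * M i j') = (\<Sum>i\<in>I - {k}. c i * M i j')"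
        by (intro sum.cong) (auto simp: d_def)
      finally show ?thesis .
    qed
    have "(\<Sum>i\<in>I. d i * M i j') = (\<Sum>i\<in>I - {k}. c i * M' i j')" for j'
      unfolding split unfolding M'_def d_def by (simp add: algebra_simps sum_subtractf sum_distrib_left sum_distrib_right)
    moreover have "(\<Sum>i\<in>I - {k}. c i * M' i j) = 0"
      using k by (intro sum.neutral) (simp add: M'_def)
    moreover have "\<exists>i\<in>I. d i \<noteq> 0" using c(1) by (auto simp: d_def)
    ultimately show ?thesis using c(2) by (intro exI[of _ d]) simp
  qed
qed

text \<open>The pairs are the exponents of the first two variables in a monomial of degree
  \<open>N\<close>; the third exponent is determined by them.\<close>

definition tri :: "nat \<Rightarrow> (nat \<times> nat) set" where
  "tri N = (SIGMA i:{..N}. {..N - i})"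

definition monom3 :: "nat \<Rightarrow> nat \<times> nat \<Rightarrow> complex ^ 3 \<Rightarrow> complex" where
  "monom3 N a x = x $ 1 ^ fst a * x $ 2 ^ snd a * x $ 3 ^ (N - fst a - snd a)"

lemma finite_tri: "finite (tri N)" by (simp add: tri_def)

lemma card_tri: "2 * card (tri N) = (N + 1) * (N + 2)"
proof -
  have "card (tri N) = (\<Sum>i\<le>N. N - i + 1)" by (simp add: tri_def)
  also have "\<dots> = (\<Sum>i\<le>N. i + 1)"
    by (rule sum.reindex_bij_witness[of _ "\<lambda>i. N - i" "\<lambda>i. N - i"]) auto
  also have "2 * \<dots> = (N + 1) * (N + 2)" by (induction N) auto
  finally show ?thesis .
qed

lemma homogeneous_monom3: "a \<in> tri N \<Longrightarrow> homogeneous N (monom3 N a)"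
proof -
  assume a: "a \<in> tri N"
  have "homogeneous (1 * fst a + 1 * snd a + 1 * (N - fst a - snd a))
      (\<lambda>x. x $ 1 ^ fst a * x $ 2 ^ snd a * x $ 3 ^ (N - fst a - snd a) :: complex)"
    by (intro homogeneous_mult homogeneous_power homogeneous_coord)
  moreover have "1 * fst a + 1 * snd a + 1 * (N - fst a - snd a) = N" using a by (auto simp: tri_def)
  ultimately show ?thesis by (simp add: monom3_def[abs_def])
qed

lemma homogeneous_expand3:
  assumes "homogeneous N p"
  shows "\<exists>c. \<forall>x. p x = (\<Sum>a\<in>tri N. c a * monom3 N a x)"
proof -
  obtain A c where A: "finite A" "\<forall>\<alpha>\<in>A. (\<Sum>i\<in>UNIV. \<alpha> i) = N" "\<forall>x. p x = (\<Sum>\<alpha>\<in>A. c \<alpha> * monomial_fun \<alpha> x)"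
    using assms unfolding homogeneous_def by blast
  have tri: "(\<alpha> 1, \<alpha> 2) \<in> tri N" and \<alpha>3: "\<alpha> 3 = N - \<alpha> 1 - \<alpha> 2" if "\<alpha> \<in> A" for \<alpha>
    using A(2) that unfolding tri_def by (auto simp: sum_3)
  have prod3: "(\<Prod>i\<in>UNIV. h i) = h 1 * h 2 * h 3" for h :: "3 \<Rightarrow> complex"
    unfolding UNIV_3 by (simp add: mult.assoc)
  have m: "monomial_fun \<alpha> x = monom3 N (\<alpha> 1, \<alpha> 2) x" if "\<alpha> \<in> A" for \<alpha> x
    using \<alpha>3[OF that] by (simp add: monomial_fun_def monom3_def prod3)
  have "p x = (\<Sum>a\<in>tri N. (\<Sum>\<alpha> | \<alpha> \<in> A \<and> (\<alpha> 1, \<alpha> 2) = a. c \<alpha>) * monom3 N a x)" for x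
  proof -
    have "p x = (\<Sum>\<alpha>\<in>A. c \<alpha> * monom3 N (\<alpha> 1, \<alpha> 2) x)" using A(3) m by simp
    also have "\<dots> = (\<Sum>a\<in>tri N. \<Sum>\<alpha> | \<alpha> \<in> A \<and> (\<alpha> 1, \<alpha> 2) = a. c \<alpha> * monom3 N (\<alpha> 1, \<alpha> 2) x)"
      using A(1) finite_tri tri by (intro sum.group[symmetric]) auto
    also have "\<dots> = (\<Sum>a\<in>tri N. (\<Sum>\<alpha> | \<alpha> \<in> A \<and> (\<alpha> 1, \<alpha> 2) = a. c \<alpha>) * monom3 N a x)"
      unfolding sum_distrib_right by (intro sum.cong refl) auto
    finally show ?thesis .
  qed
  then show ?thesis by (intro exI[of _ "\<lambda>a. \<Sum>\<alpha> | \<alpha> \<in> A \<and> (\<alpha> 1, \<alpha> 2) = a. c \<alpha>"]) simp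
qed

text \<open>Kronecker substitution \<open>(t, t\<^sup>M, 1)\<close> with \<open>M > N\<close> separates the monomials of degree \<open>N\<close>.\<close>

lemma monom3_independent:
  assumes "\<And>x. (\<Sum>a\<in>tri N. c a * monom3 N a x) = 0" "b \<in> tri N"
  shows "c b = 0"
proof -
  define M where "M = Suc N"
  define ex where "ex = (\<lambda>a::nat \<times> nat. fst a + M * snd a)"
  define q where "q = (\<Sum>a\<in>tri N. Polynomial.monom (c a) (ex a))"
  have "poly q t = 0" for t
  proof -
    have "poly q t = (\<Sum>a\<in>tri N. c a * monom3 N a (vector [t, t ^ M, 1]))"
      by (simp add: q_def poly_sum poly_monom monom3_def ex_def power_add power_mult mult_ac)
    then show ?thesis using assms(1) by simp
  qed
  then have "q = 0" using poly_all_0_iff_0 by blast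
  have inj: "a = b" if "a \<in> tri N" "ex a = ex b" for a
  proof -
    have "fst a < M" "fst b < M" using that assms(2) by (auto simp: tri_def M_def)
    then have "fst a = ex a mod M" "fst b = ex b mod M" "snd a = ex a div M" "snd b = ex b div M"
      by (auto simp: ex_def)
    then show ?thesis using that by (simp add: prod_eq_iff)
  qed
  have "0 = coeff q (ex b)" using \<open>q = 0\<close> by simp
  also have "\<dots> = (\<Sum>a\<in>tri N. if a = b then c b else 0)"
    unfolding q_def coeff_sum using inj by (intro sum.cong) auto
  also have "\<dots> = c b" using assms(2) finite_tri by simp
  finally show ?thesis by simp
qed

text \<open>The forms of degree \<open>N\<close> in three variables have quadratically many coefficients, the forms of
  degree \<open>d N\<close> modulo \<open>g\<close> only linearly many, so the linear system \<open>s \<circ> F = g r\<close> is underdetermined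
  for large \<open>N\<close>.\<close>

lemma vanishing_form_exists:
  fixes g :: "complex ^ 3 \<Rightarrow> complex" and F :: "complex ^ 3 \<Rightarrow> complex ^ 3"
  assumes g: "homogeneous k g" "\<exists>x. g x \<noteq> 0" and F: "\<And>i. homogeneous d (\<lambda>x. F x $ i)" and "d \<ge> 1"
  shows "\<exists>N s. homogeneous N s \<and> (\<exists>x. s x \<noteq> 0) \<and> poly_divides g (\<lambda>x. s (F x))"
proof -
  \<comment> \<open>Twice the number of monomials of degree \<open>d N = k + m\<close> exceeds twice
    that of degree \<open>m\<close> by \<open>k^2 + 2 k m + 3 k\<close>. This \<open>N\<close> gives
    \<open>N^2 = 2 k d N + 4 k N + N\<close>, which covers the excess because
    \<open>m \<le> d N\<close> and \<open>k \<le> N\<close>.\<close>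
  define N where "N = 2 * d * k + 4 * k + 1"
  have "1 * N \<le> d * N" using \<open>d \<ge> 1\<close> by (rule mult_le_mono1)
  then have "k \<le> d * N" unfolding N_def by simp
  then obtain m where m: "d * N = k + m" using le_Suc_ex by blast
  \<comment> \<open>The unknowns are the coefficients of \<open>s\<close> (left) and of
    \<open>- r\<close> (right); the equations say that every coefficient of
    \<open>s \<circ> F - g r\<close> in degree \<open>d N\<close> is zero.\<close>
  define I where "I = tri N <+> tri m"
  define w where "w = case_sum (\<lambda>a x. monom3 N a (F x)) (\<lambda>b x. g x * monom3 m b x)"
  have "homogeneous (d * N) (w i)" if "i \<in> I" for i
  proof (cases i)
    case (Inl a)
    then show ?thesis using that homogeneous_compose[OF homogeneous_monom3 F] by (auto simp: I_def w_def)
  next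
    case (Inr b)
    then show ?thesis using that homogeneous_mult[OF g(1) homogeneous_monom3, of b m] m
      by (auto simp: I_def w_def)
  qed
  then have "\<forall>i\<in>I. \<exists>M. \<forall>x. w i x = (\<Sum>a\<in>tri (d * N). M a * monom3 (d * N) a x)"
    using homogeneous_expand3 by blast
  then obtain M where M: "\<And>i x. i \<in> I \<Longrightarrow> w i x = (\<Sum>a\<in>tri (d * N). M i a * monom3 (d * N) a x)" by metis
  have "card (tri (d * N)) < card I"
  proof -
    have 1: "k * m \<le> k * (d * N)" using m by simp
    have 2: "k * k \<le> k * N" "k * 1 \<le> k * N" unfolding N_def by (intro mult_le_mono2; simp)+
    have 3: "N * N = 2 * (k * (d * N)) + 4 * (k * N) + N" by (simp add: N_def algebra_simps)
    have "(k + m + 1) * (k + m + 2) = (m + 1) * (m + 2) + (k * k + 2 * (k * m) + 3 * k)"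
      by (simp add: algebra_simps)
    also have "\<dots> < (m + 1) * (m + 2) + (N + 1) * (N + 2)"
    proof -
      have "(N + 1) * (N + 2) = N * N + 3 * N + 2" by simp
      then show ?thesis using 1 2 3 by linarith
    qed
    finally have "2 * card (tri (d * N)) < 2 * card (tri m) + 2 * card (tri N)"
      unfolding card_tri m by simp
    then show ?thesis by (simp add: I_def card_Plus finite_tri)
  qed
  moreover have "finite I" by (simp add: I_def finite_tri)
  ultimately obtain c where c: "\<exists>i\<in>I. c i \<noteq> 0" "\<forall>a\<in>tri (d * N). (\<Sum>i\<in>I. c i * M i a) = 0"
    using linear_system_nontrivial[OF finite_tri, of I "d * N" M] by blast
  define s where "s = (\<lambda>x. \<Sum>a\<in>tri N. c (Inl a) * monom3 N a x)"
  define r where "r = (\<lambda>x. - (\<Sum>b\<in>tri m. c (Inr b) * monom3 m b x))"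
  have s: "homogeneous N s" unfolding s_def by (intro homogeneous_sum homogeneous_cmult homogeneous_monom3)
  have r: "homogeneous m (\<lambda>x. - r x)"
    unfolding r_def by (auto intro!: homogeneous_sum homogeneous_cmult homogeneous_monom3)
  then have rpf: "polynomial_fun r" using polynomial_fun_minus[OF homogeneous_imp_polynomial_fun[OF r]] by simp
  have eq: "s (F x) = g x * r x" for x
  proof -
    have "s (F x) - g x * r x = (\<Sum>i\<in>I. c i * w i x)"
      unfolding I_def by (simp add: sum.Plus finite_tri s_def r_def w_def sum_distrib_left mult_ac)
    also have "\<dots> = (\<Sum>i\<in>I. \<Sum>a\<in>tri (d * N). c i * M i a * monom3 (d * N) a x)"
      by (intro sum.cong refl) (simp add: M sum_distrib_left mult_ac)
    also have "\<dots> = (\<Sum>a\<in>tri (d * N). (\<Sum>i\<in>I. c i * M i a) * monom3 (d * N) a x)"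
      unfolding sum_distrib_right by (rule sum.swap)
    also have "\<dots> = 0" using c(2) by simp
    finally show ?thesis by simp
  qed
  \<comment> \<open>A solution with \<open>s = 0\<close> would give \<open>g r = 0\<close>, hence
    \<open>r = 0\<close>, and then independence of the monomials kills every unknown.\<close>
  have "\<exists>x. s x \<noteq> 0"
  proof (rule ccontr)
    assume "\<not> ?thesis"
    then have s0: "s x = 0" for x by blast
    then have "g x * r x = 0" for x using eq[of x] by simp
    then have r0: "r x = 0" for x
      using polynomial_fun_eq_0_of_mult[OF homogeneous_imp_polynomial_fun[OF g(1)] rpf] g(2) by blast
    have "c (Inl a) = 0" if "a \<in> tri N" for a
      using monom3_independent[where N = N and c = "\<lambda>a. c (Inl a)"] s0 that unfolding s_def by blast
    moreover have "c (Inr b) = 0" if "b \<in> tri m" for b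
      using monom3_independent[where N = m and c = "\<lambda>a. c (Inr a)"] r0 that unfolding r_def by (metis neg_equal_0_iff_equal)
    ultimately show False using c(1) by (auto simp: I_def)
  qed
  then show ?thesis using s poly_dividesI[OF rpf eq] by blast
qed

section \<open>Congruences modulo a polynomial\<close>

lemma poly_divides_mult_cong:
  assumes "poly_divides g (\<lambda>x. a x - b x)" "poly_divides g (\<lambda>x. a' x - b' x)" "polynomial_fun a" "polynomial_fun b'"
  shows "poly_divides g (\<lambda>x. a x * a' x - b x * b' x)"
  using poly_dvd_add[OF poly_dvd_mult_left[OF assms(2,3)] poly_dvd_mult_right[OF assms(1,4)]]
  by (simp add: algebra_simps)

lemma poly_divides_power_cong:
  assumes "poly_divides g (\<lambda>x. a x - b x)" "polynomial_fun a" "polynomial_fun b"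
  shows "poly_divides g (\<lambda>x. a x ^ n - b x ^ n)"
proof (induction n)
  case (Suc n)
  then show ?case using poly_divides_mult_cong[OF assms(1) Suc assms(2) polynomial_fun_power[OF assms(3)]] by simp
qed (simp add: poly_dvd_zero)

lemma poly_divides_prod_cong:
  assumes "\<And>i. i \<in> I \<Longrightarrow> poly_divides g (\<lambda>x. a i x - b i x)"
    "\<And>i. polynomial_fun (a i)" "\<And>i. polynomial_fun (b i)"
  shows "poly_divides g (\<lambda>x. (\<Prod>i\<in>I. a i x) - (\<Prod>i\<in>I. b i x))"
  using assms(1)
proof (induction I rule: infinite_finite_induct)
  case (insert i I)
  then show ?case
    using poly_divides_mult_cong[of g "a i" "b i" "\<lambda>x. \<Prod>i\<in>I. a i x" "\<lambda>x. \<Prod>i\<in>I. b i x"]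
    by (simp add: assms polynomial_fun_prod)
qed (simp_all add: poly_dvd_zero)

text \<open>Lets a map be replaced, modulo \<open>g\<close>, by a scalar function times a constant
  vector; this is how a curve contracted to a point is recognised.\<close>

lemma poly_divides_compose_cong:
  assumes "polynomial_fun s" and FG: "\<And>i. poly_divides g (\<lambda>x. F x $ i - G x $ i)"
    "\<And>i. polynomial_fun (\<lambda>x. F x $ i)" "\<And>i. polynomial_fun (\<lambda>x. G x $ i)"
  shows "poly_divides g (\<lambda>x. s (F x) - s (G x))"
proof -
  obtain A a where A: "finite A" "\<forall>x. s x = (\<Sum>\<alpha>\<in>A. a \<alpha> * monomial_fun \<alpha> x)"
    using assms unfolding polynomial_fun_def by blast
  have "poly_divides g (\<lambda>x. monomial_fun \<alpha> (F x) - monomial_fun \<alpha> (G x))" for \<alpha>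
    unfolding monomial_fun_def
    by (intro poly_divides_prod_cong poly_divides_power_cong polynomial_fun_power FG)
  then have "poly_divides g (\<lambda>x. \<Sum>\<alpha>\<in>A. a \<alpha> * (monomial_fun \<alpha> (F x) - monomial_fun \<alpha> (G x)))"
    by (intro poly_dvd_sum poly_dvd_mult_left polynomial_fun_const)
  then show ?thesis using A(2) by (simp add: right_diff_distrib sum_subtractf)
qed

lemma prime_fun_dvd_cmult:
  assumes "prime_fun g" "polynomial_fun a" "c \<noteq> 0" "poly_divides g (\<lambda>x. c * a x)"
  shows "poly_divides g a"
  using prime_fun_dvd_mult[OF assms(1) polynomial_fun_const assms(2,4)] prime_not_dvd_const[OF assms(1,3)] by blast

lemma prime_fun_dvd_power:
  assumes "prime_fun g" "polynomial_fun a" "poly_divides g (\<lambda>x. a x ^ n)"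
  shows "poly_divides g a"
  using assms(3)
proof (induction n)
  case 0
  then show ?case using prime_not_dvd_const[OF assms(1), of 1] by simp
next
  case (Suc n)
  then show ?case using prime_fun_dvd_mult[OF assms(1,2) polynomial_fun_power[OF assms(2)]] by auto
qed

lemma prime_fun_dvd_prod:
  fixes m :: nat
  assumes "prime_fun g" "\<And>i. polynomial_fun (a i)" "poly_divides g (\<lambda>x. \<Prod>i<m. a i x)"
  shows "\<exists>i. poly_divides g (a i)"
  using assms(3)
proof (induction m)
  case 0
  then show ?case using prime_not_dvd_const[OF assms(1), of 1] by simp
next
  case (Suc m)
  then show ?case using prime_fun_dvd_mult[OF assms(1) polynomial_fun_prod[of "{..<m}" a] assms(2)[of m]] assms(2) by auto
qed

text \<open>The factor \<open>x\<^sub>l\<^sup>m\<close> saves comparing \<open>e\<close> with the degree \<open>m\<close> of the dehomogenisation.\<close>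

lemma binary_form_split:
  fixes r :: "complex ^ 3 \<Rightarrow> complex"
  assumes r: "homogeneous e r" "\<exists>x. r x \<noteq> 0" "\<And>x y. x $ j = y $ j \<Longrightarrow> x $ l = y $ l \<Longrightarrow> r x = r y" and "j \<noteq> l"
  shows "\<exists>c m a. c \<noteq> 0 \<and> (\<forall>x. x $ l ^ m * r x = c * x $ l ^ e * (\<Prod>i<m. x $ j - a i * x $ l))"
proof -
  obtain \<rho> where \<rho>: "\<And>t. r (axis l 1 + t *s axis j 1) = poly \<rho> t"
    using polynomial_fun_line[OF homogeneous_imp_polynomial_fun[OF r(1)]] by blast
  obtain a where a: "smult (lead_coeff \<rho>) (\<Prod>i<degree \<rho>. [:- a i, 1:]) = \<rho>"
    by (rule complex_poly_decompose')
  define m where "m = degree \<rho>"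
  have red: "r x = x $ l ^ e * poly \<rho> (x $ j / x $ l)" if "x $ l \<noteq> 0" for x
  proof -
    have "r x = r (x $ l *s (axis l 1 + (x $ j / x $ l) *s axis j 1))"
      using that \<open>j \<noteq> l\<close> by (intro r(3)) (simp_all add: axis_def)
    also have "\<dots> = x $ l ^ e * poly \<rho> (x $ j / x $ l)"
      unfolding homogeneous_scale[OF r(1)] \<rho> ..
    finally show ?thesis .
  qed
  have lpf: "polynomial_fun (\<lambda>x::complex^3. x $ l)" by (rule polynomial_fun_coord)
  have l0: "\<exists>x::complex^3. x $ l \<noteq> 0" by (metis one_index zero_neq_one)
  have "\<rho> \<noteq> 0"
  proof
    assume "\<rho> = 0"
    then have "x $ l * r x = 0" for x using red[of x] by auto
    then show False
      using polynomial_fun_eq_0_of_mult[OF lpf homogeneous_imp_polynomial_fun[OF r(1)]] l0 r(2) by blast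
  qed
  have pf: "polynomial_fun (\<lambda>x. x $ l ^ m * r x)"
      "polynomial_fun (\<lambda>x. lead_coeff \<rho> * x $ l ^ e * (\<Prod>i<m. x $ j - a i * x $ l))"
    by (intro polynomial_fun_mult polynomial_fun_prod polynomial_fun_power polynomial_fun_coord
        polynomial_fun_const polynomial_fun_diff homogeneous_imp_polynomial_fun[OF r(1)])+
  \<comment> \<open>The factorization of the dehomogenisation says nothing where the coordinate
    \<open>l\<close> is zero. Multiplying both sides by that coordinate makes this case trivial, and
    it cancels afterwards.\<close>
  have "x $ l ^ m * r x = lead_coeff \<rho> * x $ l ^ e * (\<Prod>i<m. x $ j - a i * x $ l)" for x
  proof (rule polynomial_fun_cancel[OF lpf pf l0])
    fix x :: "complex ^ 3"
    show "x $ l * (x $ l ^ m * r x) = x $ l * (lead_coeff \<rho> * x $ l ^ e * (\<Prod>i<m. x $ j - a i * x $ l))"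
    proof (cases "x $ l = 0")
      case False
      have "poly \<rho> (x $ j / x $ l) = lead_coeff \<rho> * (\<Prod>i<m. x $ j / x $ l - a i)"
        unfolding m_def by (subst a[symmetric]) (simp add: poly_prod)
      then have "x $ l ^ m * r x = lead_coeff \<rho> * x $ l ^ e * (x $ l ^ m * (\<Prod>i<m. x $ j / x $ l - a i))"
        using red[OF False] by (simp add: mult_ac)
      also have "x $ l ^ m * (\<Prod>i<m. x $ j / x $ l - a i) = (\<Prod>i<m. x $ l * (x $ j / x $ l - a i))"
        by (simp add: prod.distrib)
      also have "\<dots> = (\<Prod>i<m. x $ j - a i * x $ l)"
        using False by (intro prod.cong refl) (simp add: algebra_simps)
      finally show ?thesis by simp
    qed simp
  qed
  then show ?thesis using \<open>\<rho> \<noteq> 0\<close> by (intro exI[of _ "lead_coeff \<rho>"] exI[of _ m] exI[of _ a]) simp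
qed

section \<open>Images of plane curves\<close>

lemma exists_3: "(\<exists>i::3. P i) \<longleftrightarrow> P 1 \<or> P 2 \<or> P 3"
  using forall_3[of "\<lambda>i. \<not> P i"] by auto

lemma third_index: "(j::3) \<noteq> k \<Longrightarrow> \<exists>i. i \<noteq> j \<and> i \<noteq> k \<and> (\<forall>m. m = i \<or> m = j \<or> m = k)"
  using exhaust_3[of j] exhaust_3[of k] by (elim disjE) (simp_all add: exists_3 forall_3)

text \<open>Both relations describe the prime ideal of the image of \<open>g = 0\<close> under \<open>F\<close>, which is
  \<open>{s. g dvd s \<circ> F}\<close>.\<close>

definition maps_onto_curve ::
  "(complex ^ 3 \<Rightarrow> complex) \<Rightarrow> (complex ^ 3 \<Rightarrow> complex ^ 3) \<Rightarrow> (complex ^ 3 \<Rightarrow> complex) \<Rightarrow> bool" where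
  "maps_onto_curve g F h \<longleftrightarrow> prime_fun h \<and> (\<exists>l. homogeneous l h) \<and>
     (\<forall>e s. homogeneous e s \<longrightarrow> (poly_divides g (\<lambda>x. s (F x)) \<longleftrightarrow> poly_divides h s))"

definition maps_to_point ::
  "(complex ^ 3 \<Rightarrow> complex) \<Rightarrow> (complex ^ 3 \<Rightarrow> complex ^ 3) \<Rightarrow> complex ^ 3 \<Rightarrow> bool" where
  "maps_to_point g F v \<longleftrightarrow> v \<noteq> 0 \<and>
     (\<forall>e s. homogeneous e s \<longrightarrow> (poly_divides g (\<lambda>x. s (F x)) \<longleftrightarrow> s v = 0))"

text \<open>The forms \<open>s\<close> with \<open>g\<close> dividing \<open>s \<circ> F\<close>
  form a prime ideal, so any nonzero member has a prime factor in it.\<close>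

lemma prime_in_image_ideal:
  assumes g: "prime_fun g" and F: "\<And>i. polynomial_fun (\<lambda>x. F x $ i)"
    and s: "homogeneous N s" "\<exists>x. s x \<noteq> 0" "poly_divides g (\<lambda>x. s (F x :: complex ^ 3))"
  shows "\<exists>h l. prime_fun h \<and> homogeneous l h \<and> poly_divides g (\<lambda>x. h (F x))"
proof -
  have "\<forall>N. homogeneous N s \<longrightarrow> poly_divides g (\<lambda>x. s (F x)) \<longrightarrow>
      (\<exists>h l. prime_fun h \<and> homogeneous l h \<and> poly_divides g (\<lambda>x. h (F x)))"
    using homogeneous_imp_polynomial_fun[OF s(1)] s(2)
  proof (induction s rule: polynomial_fun_prime_induct)
    case (const c)
    then show ?case using prime_not_dvd_const[OF g] by blast
  next
    case (factor h u)
    show ?case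
    proof (intro allI impI)
      fix N assume N: "homogeneous N (\<lambda>x. h x * u x)" and d: "poly_divides g (\<lambda>x. h (F x) * u (F x))"
      have hpf: "polynomial_fun h" using factor(1) prime_fun_polynomial_fun by blast
      have "\<exists>x. h x * u x \<noteq> 0"
        using polynomial_fun_mult_nonzero[OF hpf factor(2) prime_fun_nonzero[OF factor(1)] factor(3)] by auto
      then obtain i j where ij: "homogeneous i h" "homogeneous j u"
        using homogeneous_factor[OF N _ hpf factor(2)] by blast
      have "poly_divides g (\<lambda>x. h (F x)) \<or> poly_divides g (\<lambda>x. u (F x))"
        using prime_fun_dvd_mult[OF g polynomial_fun_compose[OF hpf F] polynomial_fun_compose[OF factor(2) F] d] .
      then show "\<exists>h l. prime_fun h \<and> homogeneous l h \<and> poly_divides g (\<lambda>x. h (F x))"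
        using factor(1,4) ij by blast
    qed
  qed
  then show ?thesis using s by blast
qed

text \<open>The image lies in two curves without common component. Eliminating the third coordinate
  yields a binary form in the coordinates \<open>j\<close> and \<open>k\<close> that vanishes on the
  image; it splits into linear factors over the complex numbers, and since \<open>g\<close> is prime
  one factor already vanishes there. The factor \<open>x_k\<close> itself is excluded by the last
  hypothesis.\<close>

lemma linear_relation_of_coprime:
  assumes g: "prime_fun g" and F: "\<And>i. polynomial_fun (\<lambda>x. F x $ i)"
    and h: "prime_fun h" "homogeneous l h" "poly_divides g (\<lambda>x. h (F x :: complex ^ 3))"
    and t: "homogeneous e t" "poly_divides g (\<lambda>x. t (F x))" "\<not> poly_divides h t"
    and jk: "j \<noteq> k" and Fk: "\<not> poly_divides g (\<lambda>x. F x $ k)"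
  shows "\<exists>c. poly_divides g (\<lambda>x. F x $ j - c * F x $ k)"
proof -
  obtain i :: 3 where i: "i \<noteq> j" "i \<noteq> k" and all: "\<And>m. m = i \<or> m = j \<or> m = k"
    using third_index[OF jk] by blast
  obtain A B r n where r: "polynomial_fun A" "polynomial_fun B" "homogeneous n r" "\<exists>x. r x \<noteq> 0"
     "\<And>x. A x * h x + B x * t x = r x" "\<And>x y. (\<forall>m. m \<noteq> i \<longrightarrow> x $ m = y $ m) \<Longrightarrow> r x = r y"
    using homogeneous_elimination[OF h(1,2) t(1,3), of i] by blast
  have "r x = r y" if "x $ j = y $ j" "x $ k = y $ k" for x y
    using that all by (intro r(6)) metis
  then obtain c m a where c: "c \<noteq> 0" "\<And>x. x $ k ^ m * r x = c * x $ k ^ n * (\<Prod>i<m. x $ j - a i * x $ k)"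
    using binary_form_split[OF r(3,4) _ jk] by blast
  have lin: "polynomial_fun (\<lambda>x. F x $ j - a i * F x $ k)" for i
    by (intro polynomial_fun_diff polynomial_fun_mult polynomial_fun_const F)
  have prod: "polynomial_fun (\<lambda>x. \<Prod>i<m. F x $ j - a i * F x $ k)" by (intro polynomial_fun_prod lin)
  have pow: "polynomial_fun (\<lambda>x. F x $ k ^ N)" for N by (intro polynomial_fun_power F)
  have "poly_divides g (\<lambda>x. A (F x) * h (F x) + B (F x) * t (F x))"
    by (rule poly_dvd_add[OF poly_dvd_mult_left[OF h(3) polynomial_fun_compose[OF r(1) F]]
          poly_dvd_mult_left[OF t(2) polynomial_fun_compose[OF r(2) F]]])
  then have "poly_divides g (\<lambda>x. F x $ k ^ m * r (F x))"
    unfolding r(5) by (rule poly_dvd_mult_left[OF _ pow])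
  then have "poly_divides g (\<lambda>x. c * (F x $ k ^ n * (\<Prod>i<m. F x $ j - a i * F x $ k)))"
    unfolding c(2) by (simp add: mult.assoc)
  then have "poly_divides g (\<lambda>x. F x $ k ^ n * (\<Prod>i<m. F x $ j - a i * F x $ k))"
    by (rule prime_fun_dvd_cmult[OF g polynomial_fun_mult[OF pow prod] c(1)])
  then have "poly_divides g (\<lambda>x. F x $ k ^ n) \<or> poly_divides g (\<lambda>x. \<Prod>i<m. F x $ j - a i * F x $ k)"
    by (rule prime_fun_dvd_mult[OF g pow prod])
  then have "poly_divides g (\<lambda>x. \<Prod>i<m. F x $ j - a i * F x $ k)"
    using prime_fun_dvd_power[OF g F] Fk by blast
  then show ?thesis using prime_fun_dvd_prod[where a = "\<lambda>i x. F x $ j - a i * F x $ k", OF g lin] by blast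
qed

text \<open>The count of coefficients gives some prime \<open>h\<close> in the image ideal. Either
  every form in the ideal is a multiple of \<open>h\<close>, or a second form coprime to
  \<open>h\<close> makes all coordinates of \<open>F\<close> proportional modulo \<open>g\<close>.
  The case distinction does the work of a dimension argument.\<close>

lemma image_classification:
  fixes F :: "complex ^ 3 \<Rightarrow> complex ^ 3"
  assumes g: "prime_fun g" "homogeneous k g" and F: "\<And>i. homogeneous d (\<lambda>x. F x $ i)"
    and nd: "\<not> (\<forall>i. poly_divides g (\<lambda>x. F x $ i))"
  shows "(\<exists>h. maps_onto_curve g F h) \<or> (\<exists>v. maps_to_point g F v)"
proof -
  have Fpf: "polynomial_fun (\<lambda>x. F x $ i)" for i using F homogeneous_imp_polynomial_fun by blast
  obtain k where k: "\<not> poly_divides g (\<lambda>x. F x $ k)" using nd by blast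
  \<comment> \<open>Modulo \<open>g\<close> the map is \<open>F_k\<close> times the constant vector
    \<open>v\<close>, so \<open>s \<circ> F\<close> is \<open>s v\<close> times a power of
    \<open>F_k\<close>, which \<open>g\<close> does not divide. The normalisation
    \<open>c k = 1\<close> ensures \<open>v \<noteq> 0\<close>.\<close>
  have pointI: ?thesis if c: "\<And>j. poly_divides g (\<lambda>x. F x $ j - c j * F x $ k)" "c k = 1" for c
  proof -
    define v where "v = (\<chi> j. c j)"
    have "poly_divides g (\<lambda>x. s (F x)) \<longleftrightarrow> s v = 0" if s: "homogeneous e s" for e s
    proof -
      have "poly_divides g (\<lambda>x. s (F x) - s (F x $ k *s v))"
        by (rule poly_divides_compose_cong[OF homogeneous_imp_polynomial_fun[OF s]])
           (use c in \<open>auto simp: v_def mult.commute intro!: Fpf polynomial_fun_mult polynomial_fun_const\<close>)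
      then have *: "poly_divides g (\<lambda>x. s (F x) - s v * F x $ k ^ e)"
        by (simp add: homogeneous_scale[OF s] mult.commute)
      show ?thesis
      proof
        assume "poly_divides g (\<lambda>x. s (F x))"
        then have "poly_divides g (\<lambda>x. s v * F x $ k ^ e)" using poly_dvd_diff[of g "\<lambda>x. s (F x)", OF _ *] by simp
        then show "s v = 0"
          using prime_fun_dvd_cmult[OF g(1) polynomial_fun_power[OF Fpf]] prime_fun_dvd_power[OF g(1) Fpf] k
          by blast
      qed (use * in simp)
    qed
    moreover have "v \<noteq> 0" using c(2) by (metis v_def vec_lambda_beta zero_index zero_neq_one)
    ultimately show ?thesis unfolding maps_to_point_def by blast
  qed
  show ?thesis
  proof (cases "d = 0")
    \<comment> \<open>For \<open>d = 0\<close> the map is constant; this case is separate because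
      the count of coefficients needs \<open>d \<ge> 1\<close>.\<close>
    case True
    then have const: "F x $ i = F 0 $ i" for x i using homogeneous_scale[OF F[of i], of 0 x] by simp
    have Fk: "(\<lambda>x. F x $ k) = (\<lambda>x. F 0 $ k)" by (rule ext) (rule const)
    have k0: "F 0 $ k \<noteq> 0"
    proof
      assume "F 0 $ k = 0"
      then show False using k poly_dvd_zero[of g] unfolding Fk by simp
    qed
    have "(\<lambda>x. F x $ j - (F 0 $ j / F 0 $ k) * F x $ k) = (\<lambda>x. 0)" for j
    proof
      show "F x $ j - (F 0 $ j / F 0 $ k) * F x $ k = 0" for x
        using k0 unfolding const[of x j] const[of x k] by simp
    qed
    then show ?thesis
      using k0 by (intro pointI[of "\<lambda>j. F 0 $ j / F 0 $ k"]) (simp_all add: poly_dvd_zero)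
  next
    case False
    then obtain N s where s: "homogeneous N s" "\<exists>x. s x \<noteq> 0" "poly_divides g (\<lambda>x. s (F x))"
      using vanishing_form_exists[OF g(2) prime_fun_nonzero[OF g(1)] F] by auto
    then obtain h l where h: "prime_fun h" "homogeneous l h" "poly_divides g (\<lambda>x. h (F x))"
      using prime_in_image_ideal[OF g(1) Fpf s] by blast
    show ?thesis
    proof (cases "\<forall>e t. homogeneous e t \<longrightarrow> poly_divides g (\<lambda>x. t (F x)) \<longrightarrow> poly_divides h t")
      case True
      have "poly_divides g (\<lambda>x. t (F x))" if "poly_divides h t" for t
      proof -
        obtain r where r: "polynomial_fun r" "\<And>x. t x = h x * r x" using \<open>poly_divides h t\<close> poly_dividesE by blast
        show ?thesis unfolding r(2) by (rule poly_dvd_mult_right[OF h(3) polynomial_fun_compose[OF r(1) Fpf]])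
      qed
      then have "maps_onto_curve g F h" unfolding maps_onto_curve_def using True h by blast
      then show ?thesis by blast
    next
      case False
      then obtain e t where t: "homogeneous e t" "poly_divides g (\<lambda>x. t (F x))" "\<not> poly_divides h t" by blast
      have "\<exists>c. poly_divides g (\<lambda>x. F x $ j - c * F x $ k) \<and> (j = k \<longrightarrow> c = 1)" for j
      proof (cases "j = k")
        case True
        then show ?thesis by (intro exI[of _ 1]) (simp add: poly_dvd_zero)
      qed (use linear_relation_of_coprime[OF g(1) Fpf h t _ k] in blast)
      then obtain c where "\<And>j. poly_divides g (\<lambda>x. F x $ j - c j * F x $ k)" "c k = 1" by metis
      then show ?thesis by (rule pointI)
    qed
  qed
qed

section \<open>Zariski closures and images of curves under meromorphic maps\<close>

lemma zariski_closure_subset: "algebraic_set Z \<Longrightarrow> X \<subseteq> Z \<Longrightarrow> zariski_closure X \<subseteq> Z"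
  unfolding zariski_closure_def by blast

lemma zariski_closure_extensive: "X \<subseteq> zariski_closure X"
  unfolding zariski_closure_def by blast

lemma zariski_closure_subset_iff: "algebraic_set Z \<Longrightarrow> zariski_closure X \<subseteq> Z \<longleftrightarrow> X \<subseteq> Z"
  using zariski_closure_subset[of Z X] zariski_closure_extensive[of X] by auto

lemma mero_image_mono: "X \<subseteq> Y \<Longrightarrow> mero_image F X \<subseteq> mero_image F Y"
  unfolding mero_image_def zariski_closure_def by blast

lemma pt_in_indeterminacy:
  assumes F: "\<And>i. homogeneous d (\<lambda>x. F x $ i)" and "x \<noteq> 0"
  shows "pt x \<in> indeterminacy F \<longleftrightarrow> F x = 0"
proof
  assume "pt x \<in> indeterminacy F"
  then obtain y where y: "pt x = pt y" "y \<noteq> 0" "F y = 0" unfolding indeterminacy_def by auto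
  then obtain c where "x = c *s y" using pt_eq_iff[of y x] assms by auto
  then have "F x $ i = c ^ d * F y $ i" for i using homogeneous_scale[OF F] by simp
  then show "F x = 0" using y by (simp add: vec_eq_iff)
qed (use assms in \<open>auto simp: indeterminacy_def\<close>)

lemma mero_image_zero_locus:
  assumes p: "homogeneous k p" and F: "\<And>i. homogeneous d (\<lambda>x. F x $ i)"
  shows "mero_image F (zero_locus {p}) = zariski_closure {pt (F x) |x. x \<noteq> 0 \<and> p x = 0 \<and> F x \<noteq> 0}"
proof -
  have "{pt (F x) |x. x \<noteq> 0 \<and> pt x \<in> zero_locus {p} - indeterminacy F}
      = {pt (F x) |x. x \<noteq> 0 \<and> p x = 0 \<and> F x \<noteq> 0}"
    using pt_in_zero_locus_single[OF p] pt_in_indeterminacy[OF F] by blast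
  then show ?thesis unfolding mero_image_def by simp
qed

lemma mero_image_subset_iff:
  fixes F :: "complex ^ 3 \<Rightarrow> complex ^ 3"
  assumes g: "prime_fun g" "homogeneous k g" and F: "\<And>i. homogeneous d (\<lambda>x. F x $ i)"
    and nd: "\<not> (\<forall>i. poly_divides g (\<lambda>x. F x $ i))" and s: "homogeneous e s"
  shows "mero_image F (zero_locus {g}) \<subseteq> zero_locus {s} \<longleftrightarrow> poly_divides g (\<lambda>x. s (F x))"
proof -
  define X where "X = {pt (F x) |x. x \<noteq> 0 \<and> g x = 0 \<and> F x \<noteq> 0}"
  have Fpf: "polynomial_fun (\<lambda>x. F x $ i)" for i using F homogeneous_imp_polynomial_fun by blast
  have "mero_image F (zero_locus {g}) \<subseteq> zero_locus {s} \<longleftrightarrow> X \<subseteq> zero_locus {s}"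
    unfolding mero_image_zero_locus[OF g(2) F] X_def
    by (rule zariski_closure_subset_iff[OF algebraic_zero_locus_single[OF s]])
  also have "\<dots> \<longleftrightarrow> (\<forall>x. x \<noteq> 0 \<longrightarrow> g x = 0 \<longrightarrow> F x \<noteq> 0 \<longrightarrow> s (F x) = 0)"
    unfolding X_def using pt_in_zero_locus_single[OF s] by (auto simp: subset_iff)
  also have "\<dots> \<longleftrightarrow> poly_divides g (\<lambda>x. s (F x))"
  proof
    assume L: "\<forall>x. x \<noteq> 0 \<longrightarrow> g x = 0 \<longrightarrow> F x \<noteq> 0 \<longrightarrow> s (F x) = 0"
    obtain i where "\<not> poly_divides g (\<lambda>x. F x $ i)" using nd by blast
    \<comment> \<open>At an indeterminate point \<open>s (F x)\<close> is \<open>s 0\<close>, which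
      need not vanish in degree 0. The extra factor vanishes there and, not being divisible by
      \<open>g\<close>, is dropped again.\<close>
    have "poly_divides g (\<lambda>x. F x $ i * s (F x))"
    proof (rule prime_dvd_of_vanishing[OF g(1)])
      show "polynomial_fun (\<lambda>x. F x $ i * s (F x))"
        by (rule polynomial_fun_mult[OF Fpf polynomial_fun_compose[OF homogeneous_imp_polynomial_fun[OF s] Fpf]])
      show "F x $ i * s (F x) = 0" if "x \<noteq> 0" "g x = 0" for x using L that by (cases "F x = 0") auto
    qed
    then show "poly_divides g (\<lambda>x. s (F x))"
      using prime_fun_dvd_mult[OF g(1) Fpf polynomial_fun_compose[OF homogeneous_imp_polynomial_fun[OF s] Fpf]]
        \<open>\<not> poly_divides g (\<lambda>x. F x $ i)\<close> by blast
  qed (auto dest: poly_dvd_imp_zero)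
  finally show ?thesis .
qed

text \<open>For the nontrivial inclusion, each equation \<open>s\<close> of a closed set containing
  the image satisfies \<open>g\<close> divides \<open>s \<circ> F\<close>, hence is a multiple of
  \<open>h\<close>. No preimage of a point of \<open>h = 0\<close> has to be found.\<close>

lemma mero_image_curve:
  fixes F :: "complex ^ 3 \<Rightarrow> complex ^ 3"
  assumes g: "prime_fun g" "homogeneous k g" and F: "\<And>i. homogeneous d (\<lambda>x. F x $ i)"
    and nd: "\<not> (\<forall>i. poly_divides g (\<lambda>x. F x $ i))" and h: "maps_onto_curve g F h"
  shows "mero_image F (zero_locus {g}) = zero_locus {h}"
proof
  obtain l where hp: "prime_fun h" "homogeneous l h" using h unfolding maps_onto_curve_def by blast
  have dvd: "poly_divides g (\<lambda>x. s (F x)) \<longleftrightarrow> poly_divides h s" if "homogeneous e s" for e s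
    using h that unfolding maps_onto_curve_def by blast
  show "mero_image F (zero_locus {g}) \<subseteq> zero_locus {h}"
    using mero_image_subset_iff[OF g F nd hp(2)] dvd[OF hp(2)] poly_dvd_refl by blast
  show "zero_locus {h} \<subseteq> mero_image F (zero_locus {g})"
  proof -
    have "zero_locus {h} \<subseteq> Z"
      if Z: "algebraic_set Z" "{pt (F x) |x. x \<noteq> 0 \<and> g x = 0 \<and> F x \<noteq> 0} \<subseteq> Z" for Z
    proof -
      obtain S where S: "\<And>p. p \<in> S \<Longrightarrow> \<exists>d. homogeneous d p" "Z = zero_locus S" using Z(1) algebraic_setE by blast
      have "poly_divides h s" if "s \<in> S" for s
      proof -
        obtain e where e: "homogeneous e s" using S(1) \<open>s \<in> S\<close> by blast
        have "Z \<subseteq> zero_locus {s}" using S that by (auto simp: zero_locus_def)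
        then have "mero_image F (zero_locus {g}) \<subseteq> zero_locus {s}"
          unfolding mero_image_zero_locus[OF g(2) F]
          using zariski_closure_subset[OF Z] by simp
        then show ?thesis using mero_image_subset_iff[OF g F nd e] dvd[OF e] by blast
      qed
      then have "zero_locus {h} \<subseteq> zero_locus S" unfolding zero_locus_def using poly_dvd_imp_zero by blast
      then show ?thesis using S by blast
    qed
    then show ?thesis
      unfolding mero_image_zero_locus[OF g(2) F] zariski_closure_def by blast
  qed
qed

lemma proportional_vec:
  fixes v y :: "complex ^ 'n::finite"
  assumes "v \<noteq> 0" "\<And>i j. v $ i * y $ j = v $ j * y $ i"
  shows "\<exists>c. y = c *s v"
proof -
  obtain i where i: "v $ i \<noteq> 0" using assms(1) by (metis vec_eq_iff zero_index)
  have "y = (y $ i / v $ i) *s v" using assms(2)[of i] i by (simp add: vec_eq_iff field_simps)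
  then show ?thesis by blast
qed

text \<open>These are the 2 by 2 minors of the pair \<open>v\<close>, \<open>x\<close>; together
  they cut out the point with coordinates \<open>v\<close>.\<close>

lemma homogeneous_minor: "homogeneous 1 (\<lambda>x. v $ i * x $ j - v $ j * x $ i)"
  by (intro homogeneous_diff homogeneous_cmult homogeneous_coord)

lemma algebraic_singleton:
  fixes v :: "complex ^ 'n::finite"
  assumes "v \<noteq> 0" shows "algebraic_set {pt v}"
proof -
  define S where "S = range (\<lambda>(i, j) x. v $ i * x $ j - v $ j * x $ i)"
  have "{pt v} = zero_locus S"
  proof (intro equalityI subsetI)
    fix z assume "z \<in> zero_locus S"
    then obtain x where x: "z = pt x" "x \<noteq> 0" "\<forall>p\<in>S. p x = 0"
      unfolding zero_locus_def by blast
    have "v $ i * x $ j - v $ j * x $ i = 0" for i j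
      using x(3)[rule_format, of "\<lambda>x. v $ i * x $ j - v $ j * x $ i"]
      by (auto simp: S_def image_iff split: prod.splits)
    then have "\<exists>c. x = c *s v" using proportional_vec[OF assms, of x] by auto
    then show "z \<in> {pt v}" using pt_eq_iff[OF assms x(2)] x(1) by simp
  qed (use assms in \<open>auto simp: zero_locus_def S_def\<close>)
  moreover have "\<exists>d. homogeneous d p" if "p \<in> S" for p
    using that homogeneous_minor by (auto simp: S_def)
  ultimately show ?thesis using algebraic_zero_locus by metis
qed

lemma irreducible_singleton: "v \<noteq> 0 \<Longrightarrow> irreducible_algebraic {pt v}"
  unfolding irreducible_algebraic_def using algebraic_singleton by (auto simp: singleton_Un_iff)

lemma mero_image_point:
  fixes F :: "complex ^ 3 \<Rightarrow> complex ^ 3"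
  assumes g: "prime_fun g" "homogeneous k g" and F: "\<And>i. homogeneous d (\<lambda>x. F x $ i)"
    and nd: "\<not> (\<forall>i. poly_divides g (\<lambda>x. F x $ i))" and v: "maps_to_point g F v"
  shows "mero_image F (zero_locus {g}) = {pt v}"
proof -
  define X where "X = {pt (F x) |x. x \<noteq> 0 \<and> g x = 0 \<and> F x \<noteq> 0}"
  have v0: "v \<noteq> 0" and dvd: "\<And>e s. homogeneous e s \<Longrightarrow> poly_divides g (\<lambda>x. s (F x)) \<longleftrightarrow> s v = 0"
    using v unfolding maps_to_point_def by auto
  have "pt (F x) = pt v" if x: "g x = 0" "F x \<noteq> 0" for x
  proof -
    have "v $ i * F x $ j - v $ j * F x $ i = 0" for i j
      using poly_dvd_imp_zero[OF iffD2[OF dvd[OF homogeneous_minor]] x(1), of v i j] by simp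
    then have "\<exists>c. F x = c *s v" using proportional_vec[OF v0, of "F x"] by auto
    then show ?thesis using pt_eq_iff[OF v0 x(2)] by simp
  qed
  then have "X \<subseteq> {pt v}" unfolding X_def by auto
  moreover have "X \<noteq> {}"
  proof -
    obtain i where i: "\<not> poly_divides g (\<lambda>x. F x $ i)" using nd by blast
    then obtain x where "x \<noteq> 0" "g x = 0" "F x $ i \<noteq> 0"
      using prime_dvd_of_vanishing[OF g(1) homogeneous_imp_polynomial_fun[OF F[of i]]] by blast
    then have "pt (F x) \<in> X" unfolding X_def by (auto intro!: exI[of _ x])
    then show ?thesis by blast
  qed
  ultimately have "X = {pt v}" by blast
  then show ?thesis
    unfolding mero_image_zero_locus[OF g(2) F] X_def[symmetric]
    using zariski_closure_subset[OF algebraic_singleton[OF v0], of X] zariski_closure_extensive[of X] by blast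
qed

text \<open>A prime \<open>g\<close> vanishing only at the point would divide two of the linear
  minors with constant quotients. These minors would then be proportional, which fails at a
  coordinate vector.\<close>

lemma not_hypersurface_singleton:
  fixes v :: "complex ^ 3"
  assumes v: "v \<noteq> 0" shows "\<not> hypersurface {pt v}"
proof
  assume "hypersurface {pt v}"
  then obtain g k where g: "prime_fun g" "homogeneous k g" "{pt v} = zero_locus {g}"
    using irreducible_hypersurfaceE[OF irreducible_singleton[OF v]] by metis
  obtain i where i: "v $ i \<noteq> 0" using v by (metis vec_eq_iff zero_index)
  have scal: "\<exists>c. c \<noteq> 0 \<and> (\<forall>x. v $ i * x $ j - v $ j * x $ i = g x * c)" if "j \<noteq> i" for j
  proof -
    define L where "L = (\<lambda>x. v $ i * x $ j - v $ j * x $ i)"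
    have L: "homogeneous 1 L" unfolding L_def by (rule homogeneous_minor)
    have L0: "\<exists>x. L x \<noteq> 0" using i that by (intro exI[of _ "axis j 1"]) (simp add: L_def axis_def)
    have "zero_locus {g} \<subseteq> zero_locus {L}" unfolding g(3)[symmetric] using v by (auto simp: zero_locus_def L_def)
    then have "poly_divides g L" using zero_locus_subset_iff_dvd[OF g(1,2) L] by blast
    then obtain r where r: "polynomial_fun r" "\<And>x. L x = g x * r x" using poly_dividesE by blast
    then obtain a b where "a + b = 1" "homogeneous a g" "homogeneous b r"
      using homogeneous_factor[OF L L0 prime_fun_polynomial_fun[OF g(1)]] by blast
    then have "homogeneous 0 r" using prime_fun_degree_pos[OF g(1), of a] by (cases b) auto
    then have "r x = r 0" for x using homogeneous_scale[of 0 r 0 x] by simp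
    then show ?thesis using r(2) L0 unfolding L_def by (metis mult_zero_right)
  qed
  obtain j l :: 3 where jl: "j \<noteq> i" "l \<noteq> i" "j \<noteq> l"
  proof -
    have "\<exists>j l::3. j \<noteq> i \<and> l \<noteq> i \<and> j \<noteq> l"
      using exhaust_3[of i] by (elim disjE) (simp_all add: exists_3)
    then show ?thesis using that by blast
  qed
  obtain c where c: "c \<noteq> 0" "\<And>x. v $ i * x $ j - v $ j * x $ i = g x * c" using scal[OF jl(1)] by blast
  obtain c' where c': "\<And>x. v $ i * x $ l - v $ l * x $ i = g x * c'" using scal[OF jl(2)] by blast
  have "g (axis l 1) = 0" using c(1) c(2)[of "axis l 1"] jl by (simp add: axis_def)
  then show False using c'[of "axis l 1"] jl i by (simp add: axis_def)
qed

section \<open>Liftings and dominance\<close>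

lemma no_common_factor_prime: "no_common_factor F \<Longrightarrow> prime_fun g \<Longrightarrow> \<exists>i. \<not> poly_divides g (\<lambda>x. F x $ i)"
  unfolding no_common_factor_def prime_fun_def by blast

lemma no_common_factorI:
  fixes F :: "complex ^ 3 \<Rightarrow> complex ^ 'm::finite"
  assumes "\<And>g. prime_fun g \<Longrightarrow> \<exists>i. \<not> poly_divides g (\<lambda>x. F x $ i)"
  shows "no_common_factor F"
  unfolding no_common_factor_def
proof (intro allI impI, elim conjE, rule ccontr)
  fix h :: "complex ^ 3 \<Rightarrow> complex"
  assume h: "polynomial_fun h" "\<forall>i. poly_divides h (\<lambda>x. F x $ i)" "\<nexists>c. \<forall>x. h x = c"
  then obtain g where "prime_fun g" "poly_divides g h" using prime_factor_exists by blast
  then show False using assms h(2) poly_dvd_trans by blast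
qed

text \<open>Euclid's lemma for a family: it suffices that no prime factor of \<open>a\<close>
  divides all the \<open>b i\<close>. The family will be the coordinates of a lifting, or a single
  polynomial.\<close>

lemma dvd_of_dvd_mult_coprime:
  fixes a :: "complex ^ 3 \<Rightarrow> complex"
  assumes a: "polynomial_fun a" "\<exists>x. a x \<noteq> 0" and b: "\<And>i. polynomial_fun (b i)"
    and cop: "\<And>g. prime_fun g \<Longrightarrow> poly_divides g a \<Longrightarrow> \<exists>i. \<not> poly_divides g (b i)"
    and c: "polynomial_fun c" "\<And>i. poly_divides a (\<lambda>x. b i x * c x)"
  shows "poly_divides a c"
proof -
  have "\<forall>c. polynomial_fun c \<longrightarrow> (\<forall>g. prime_fun g \<longrightarrow> poly_divides g a \<longrightarrow> (\<exists>i. \<not> poly_divides g (b i))) \<longrightarrow>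
      (\<forall>i. poly_divides a (\<lambda>x. b i x * c x)) \<longrightarrow> poly_divides a c"
    using a
  proof (induction a rule: polynomial_fun_prime_induct)
    case (const k)
    show ?case
    proof (intro allI impI)
      fix c :: "complex ^ 3 \<Rightarrow> complex" assume "polynomial_fun c"
      then show "poly_divides (\<lambda>x. k) c"
        using const by (intro poly_dividesI[of "\<lambda>x. inverse k * c x"]) (auto intro: polynomial_fun_mult polynomial_fun_const)
    qed
  next
    case (factor g u)
    have gpf: "polynomial_fun g" using factor(1) prime_fun_polynomial_fun by blast
    show ?case
    proof (intro allI impI)
      fix c assume c: "polynomial_fun c"
        and cop: "\<forall>h. prime_fun h \<longrightarrow> poly_divides h (\<lambda>x. g x * u x) \<longrightarrow> (\<exists>i. \<not> poly_divides h (b i))"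
        and d: "\<forall>i. poly_divides (\<lambda>x. g x * u x) (\<lambda>x. b i x * c x)"
      have gd: "poly_divides g (\<lambda>x. g x * u x)" by (rule poly_dividesI[OF factor(2)]) simp
      then obtain i where "\<not> poly_divides g (b i)" using cop factor(1) by blast
      then have "poly_divides g c"
        using prime_fun_dvd_mult[OF factor(1) b c poly_dvd_trans[OF gd spec[OF d]]] by blast
      then obtain c' where c': "polynomial_fun c'" "\<And>x. c x = g x * c' x" using poly_dividesE by blast
      have "poly_divides u (\<lambda>x. b i x * c' x)" for i
      proof -
        obtain r where r: "polynomial_fun r" "\<And>x. b i x * c x = g x * u x * r x" using d poly_dividesE by blast
        have "b i x * c' x = u x * r x" for x
        proof (rule polynomial_fun_cancel[OF gpf _ _ prime_fun_nonzero[OF factor(1)]])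
          show "polynomial_fun (\<lambda>x. b i x * c' x)" by (rule polynomial_fun_mult[OF b c'(1)])
          show "polynomial_fun (\<lambda>x. u x * r x)" by (rule polynomial_fun_mult[OF factor(2) r(1)])
          show "g x * (b i x * c' x) = g x * (u x * r x)" for x using r(2)[of x] c'(2)[of x] by (simp add: mult_ac)
        qed
        then show ?thesis by (rule poly_dividesI[OF r(1)])
      qed
      moreover have "\<exists>i. \<not> poly_divides h (b i)" if "prime_fun h" "poly_divides h u" for h
        using cop that poly_dvd_mult_left[OF that(2) gpf] by blast
      ultimately have "poly_divides u c'" using factor(4) c'(1) by blast
      then obtain w where "polynomial_fun w" "\<And>x. c' x = u x * w x" using poly_dividesE by blast
      then show "poly_divides (\<lambda>x. g x * u x) c" by (intro poly_dividesI[of w]) (auto simp: c'(2))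
    qed
  qed
  then show ?thesis using cop c by blast
qed

text \<open>Common prime factors are cancelled one after the other; each has positive degree, so the
  process stops.\<close>

lemma lifting_exists:
  fixes F :: "complex ^ 3 \<Rightarrow> complex ^ 'm::finite"
  assumes "\<And>i. homogeneous d (\<lambda>x. F x $ i)" "\<exists>x. F x \<noteq> 0"
  shows "\<exists>h G. polynomial_fun h \<and> (\<exists>x. h x \<noteq> 0) \<and> (\<exists>e. \<forall>i. homogeneous e (\<lambda>x. G x $ i)) \<and>
    no_common_factor G \<and> (\<forall>x. F x = h x *s G x)"
  using assms
proof (induction d arbitrary: F rule: less_induct)
  case (less d)
  show ?case
  proof (cases "no_common_factor F")
    case True
    then show ?thesis using less.prems
      by (intro exI[of _ "\<lambda>x. 1"] exI[of _ F]) (auto intro: polynomial_fun_const)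
  next
    case False
    then obtain g where g: "prime_fun g" "\<And>i. poly_divides g (\<lambda>x. F x $ i)" using no_common_factorI by blast
    obtain x0 i0 where x0: "F x0 $ i0 \<noteq> 0" using less.prems(2) by (metis vec_eq_iff zero_index)
    obtain k where k: "homogeneous k g"
      using prime_factor_homogeneous[OF less.prems(1) _ g(1) g(2), of i0] x0 by blast
    have gpf: "polynomial_fun g" using g(1) prime_fun_polynomial_fun by blast
    have "\<forall>i. \<exists>r. polynomial_fun r \<and> (\<forall>x. F x $ i = g x * r x)" using g(2) unfolding poly_divides_def by blast
    then obtain r where r: "\<And>i. polynomial_fun (r i)" "\<And>i x. F x $ i = g x * r i x" by metis
    \<comment> \<open>A vanishing coordinate has the zero quotient, which is homogeneous in every
      degree. The coordinate that is nonzero at \<open>x0\<close> yields \<open>k \<le> d\<close>,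
      so the subtraction is not truncated.\<close>
    have hr: "homogeneous (d - k) (r i) \<and> (r i x0 \<noteq> 0 \<longrightarrow> k \<le> d)" for i
    proof (cases "\<exists>x. F x $ i \<noteq> 0")
      case True
      then obtain a b where ab: "a + b = d" "homogeneous a g" "homogeneous b (r i)"
        using homogeneous_factor[OF less.prems(1) _ gpf r(1) r(2)] by blast
      then show ?thesis using homogeneous_degree_unique[OF k ab(2) prime_fun_nonzero[OF g(1)]] by auto
    next
      case False
      then have "r i x = 0" for x
        using polynomial_fun_eq_0_of_mult[OF gpf r(1), of i] r(2)[of _ i] prime_fun_nonzero[OF g(1)] by auto
      then have "r i = (\<lambda>x. 0)" by auto
      then show ?thesis using homogeneous_zero by simp
    qed
    have "r i0 x0 \<noteq> 0" using x0 r(2) by auto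
    then have "d - k < d" using hr prime_fun_degree_pos[OF g(1) k] by fastforce
    moreover have "homogeneous (d - k) (\<lambda>x. (\<chi> i. r i x) $ i)" for i using hr by simp
    moreover have "\<exists>x. (\<chi> i. r i x) \<noteq> 0" using \<open>r i0 x0 \<noteq> 0\<close> by (metis vec_lambda_beta zero_index)
    ultimately obtain h e G where G: "polynomial_fun h" "\<exists>x. h x \<noteq> 0" "\<forall>i. homogeneous e (\<lambda>x. G x $ i)"
        "no_common_factor G" "\<And>x. (\<chi> i. r i x) = h x *s G x"
      using less.IH[of "d - k" "\<lambda>x. \<chi> i. r i x"] by metis
    have "F x = (g x * h x) *s G x" for x
    proof -
      have "F x = g x *s (\<chi> i. r i x)" using r(2) by (simp add: vec_eq_iff)
      then show ?thesis by (simp add: G(5) vector_smult_assoc)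
    qed
    moreover have "\<exists>x. g x * h x \<noteq> 0"
      using polynomial_fun_mult_nonzero[OF gpf G(1) prime_fun_nonzero[OF g(1)] G(2)] by auto
    ultimately show ?thesis using G polynomial_fun_mult[OF gpf G(1)]
      by (intro exI[of _ "\<lambda>x. g x * h x"] exI[of _ G]) blast
  qed
qed

text \<open>\<open>has_derivative\<close> is real differentiability; the condition on
  \<open>L\<close> makes the derivative complex linear, hence determined by the partial derivatives
  along the coordinate axes that occur in \<open>chart_jacobian\<close>.\<close>

definition complex_derivable :: "(complex ^ 'n::finite \<Rightarrow> complex) \<Rightarrow> complex ^ 'n \<Rightarrow> bool" where
  "complex_derivable p x \<longleftrightarrow> (\<exists>L. (p has_derivative L) (at x) \<and> (\<forall>c v. L (c *s v) = c * L v))"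

lemma complex_derivable_const: "complex_derivable (\<lambda>x. c) x"
  unfolding complex_derivable_def by (intro exI[of _ "\<lambda>v. 0"]) auto

lemma complex_derivable_coord: "complex_derivable (\<lambda>x. x $ i) x"
  unfolding complex_derivable_def
  by (intro exI[of _ "\<lambda>v. v $ i"]) (auto intro!: bounded_linear_imp_has_derivative bounded_linear_vec_nth)

lemma complex_derivable_add:
  assumes "complex_derivable p x" "complex_derivable q x" shows "complex_derivable (\<lambda>x. p x + q x) x"
proof -
  obtain L M where "(p has_derivative L) (at x)" "\<forall>c v. L (c *s v) = c * L v"
    "(q has_derivative M) (at x)" "\<forall>c v. M (c *s v) = c * M v"
    using assms unfolding complex_derivable_def by blast
  then show ?thesis unfolding complex_derivable_def
    by (intro exI[of _ "\<lambda>v. L v + M v"]) (auto intro!: has_derivative_add simp: algebra_simps)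
qed

lemma complex_derivable_mult:
  assumes "complex_derivable p x" "complex_derivable q x" shows "complex_derivable (\<lambda>x. p x * q x) x"
proof -
  obtain L M where "(p has_derivative L) (at x)" "\<forall>c v. L (c *s v) = c * L v"
    "(q has_derivative M) (at x)" "\<forall>c v. M (c *s v) = c * M v"
    using assms unfolding complex_derivable_def by blast
  then show ?thesis unfolding complex_derivable_def
    by (intro exI[of _ "\<lambda>v. p x * M v + L v * q x"] conjI has_derivative_mult) (auto simp: algebra_simps)
qed

lemma complex_derivable_inverse:
  assumes "complex_derivable p x" "p x \<noteq> 0" shows "complex_derivable (\<lambda>x. inverse (p x)) x"
proof -
  obtain L where "(p has_derivative L) (at x)" "\<forall>c v. L (c *s v) = c * L v"
    using assms unfolding complex_derivable_def by blast
  then show ?thesis unfolding complex_derivable_def using assms(2)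
    by (intro exI[of _ "\<lambda>v. - (inverse (p x) * L v * inverse (p x))"] conjI Deriv.has_derivative_inverse)
       (auto simp: algebra_simps)
qed

lemma complex_derivable_polynomial_fun:
  assumes "polynomial_fun p" shows "complex_derivable p x"
proof -
  obtain A a where A: "finite A" "\<forall>x. p x = (\<Sum>\<alpha>\<in>A. a \<alpha> * monomial_fun \<alpha> x)"
    using assms unfolding polynomial_fun_def by blast
  have pow: "complex_derivable (\<lambda>x. x $ i ^ n) x" for i n
    by (induction n) (auto intro: complex_derivable_const complex_derivable_mult complex_derivable_coord)
  have "complex_derivable (\<lambda>x. \<Prod>i\<in>I. x $ i ^ \<alpha> i) x" for I \<alpha>
    by (induction I rule: infinite_finite_induct)
       (auto intro: complex_derivable_const complex_derivable_mult pow)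
  then have mon: "complex_derivable (monomial_fun \<alpha>) x" for \<alpha> by (simp add: monomial_fun_def[abs_def])
  have "complex_derivable (\<lambda>x. \<Sum>\<alpha>\<in>B. a \<alpha> * monomial_fun \<alpha> x) x" for B
  proof (induction B rule: infinite_finite_induct)
    case (insert \<alpha> B)
    then show ?case
      using complex_derivable_add[OF complex_derivable_mult[OF complex_derivable_const mon] insert.IH] by simp
  qed (simp_all add: complex_derivable_const)
  moreover have "p = (\<lambda>x. \<Sum>\<alpha>\<in>A. a \<alpha> * monomial_fun \<alpha> x)" using A(2) by auto
  ultimately show ?thesis by simp
qed

lemma linear_smult_left: "linear (\<lambda>s::complex. s *s (v :: complex ^ 'n::finite))"
  by (rule linearI) (auto simp: vec_eq_iff algebra_simps)

lemma linear_matrix_vector_complex: "linear (\<lambda>v. (A :: complex ^ 'n ^ 'm) *v v)"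
  by (rule linearI) (auto simp: vec_eq_iff matrix_vector_mult_def algebra_simps sum.distrib scaleR_sum_right)

lemma deriv_along_axis:
  fixes x :: "complex ^ 'n::finite"
  assumes "(p has_derivative L) (at x)" "\<And>c v. L (c *s v) = c * L v"
  shows "deriv (\<lambda>s. p (x + s *s axis m 1)) 0 = L (axis m 1)"
proof -
  have "((\<lambda>s::complex. x + s *s axis m 1) has_derivative (\<lambda>s. s *s axis m 1)) (at 0)"
    using linear_smult_left[of "axis m (1::complex)"]
    by (auto intro!: derivative_eq_intros bounded_linear_imp_has_derivative simp: linear_conv_bounded_linear)
  then have "((\<lambda>s. p (x + s *s axis m 1)) has_derivative (\<lambda>s. L (s *s axis m 1))) (at 0)"
    by (rule has_derivative_compose) (use assms(1) in simp)
  then have "((\<lambda>s. p (x + s *s axis m 1)) has_field_derivative L (axis m 1)) (at 0)"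
    unfolding has_field_derivative_def assms(2) by (simp add: mult_commute_abs)
  then show ?thesis by (rule DERIV_imp_deriv)
qed

lemma complex_linear_expand:
  fixes L :: "complex ^ 'n::finite \<Rightarrow> complex"
  assumes "linear L" "\<And>c v. L (c *s v) = c * L v"
  shows "L v = (\<Sum>m\<in>UNIV. v $ m * L (axis m 1))"
proof -
  have "v = (\<Sum>m\<in>UNIV. v $ m *s axis m 1)" by (simp add: basis_expansion)
  then have "L v = L (\<Sum>m\<in>UNIV. v $ m *s axis m 1)" by simp
  also have "\<dots> = (\<Sum>m\<in>UNIV. v $ m * L (axis m 1))" using assms by (simp add: linear_sum)
  finally show ?thesis .
qed

text \<open>The line from \<open>a\<close> to \<open>y\<close> meets the open set in infinitely many
  points.\<close>

lemma polynomial_fun_eq_0_on_open: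
  assumes "polynomial_fun p" "open U" "a \<in> U" "\<And>u. u \<in> U \<Longrightarrow> p u = 0"
  shows "p y = 0"
proof -
  obtain q where q: "\<And>t. p (a + t *s (y - a)) = poly q t" using polynomial_fun_line[OF assms(1)] by blast
  define T where "T = (\<lambda>t. a + t *s (y - a)) -` U"
  have "continuous_on UNIV (\<lambda>t::complex. t *s (y - a))"
    using linear_smult_left[of "y - a"] by (simp add: linear_continuous_on linear_conv_bounded_linear)
  then have "open T" unfolding T_def
    using assms(2) by (intro open_vimage) (auto intro: continuous_intros)
  moreover have "0 \<in> T" using assms(3) by (simp add: T_def)
  ultimately have "infinite T" using finite_imp_not_open by blast
  moreover have "T \<subseteq> {t. poly q t = 0}" using assms(4) by (auto simp: T_def q[symmetric])
  ultimately have "q = 0" using poly_roots_finite[of q] finite_subset[of T] by auto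
  then show ?thesis using q[of 1] by simp
qed

text \<open>A dominant map has an invertible derivative in some chart, hence its image contains an open
  set of that chart.\<close>

lemma dominant_compose_nonzero:
  fixes F :: "complex ^ 'n::finite \<Rightarrow> complex ^ 'n"
  assumes dom: "dominant F" and F: "\<And>i. homogeneous d (\<lambda>x. F x $ i)"
    and s: "homogeneous e s" "\<exists>x. s x \<noteq> 0"
  shows "\<exists>x. s (F x) \<noteq> 0"
proof (rule ccontr)
  assume "\<not> ?thesis"
  then have s0: "\<And>x. s (F x) = 0" by blast
  have Fpf: "polynomial_fun (\<lambda>x. F x $ i)" for i using F homogeneous_imp_polynomial_fun by blast
  \<comment> \<open>Every pair of charts would do, so one arbitrary index serves for source and
    target.\<close>
  define i :: 'n where "i = undefined"
  obtain x where x: "x $ i = 1" "F x $ i \<noteq> 0" "chart_jacobian F i i x \<noteq> 0"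
    using dom unfolding dominant_def by blast
  define \<pi> where "\<pi> = (\<lambda>y::complex^'n. \<chi> m. if m = i then 1 else y $ m)"
  define \<iota> where "\<iota> = (\<lambda>v::complex^'n. \<chi> m. if m = i then 0 else v $ m)"
  have \<pi>x: "\<pi> x = x" using x(1) by (simp add: \<pi>_def vec_eq_iff)
  have \<iota>lin: "linear \<iota>" by (rule linearI) (auto simp: \<iota>_def vec_eq_iff)
  have \<pi>eq: "\<pi> = (\<lambda>y. axis i 1 + \<iota> y)" by (auto simp: \<pi>_def \<iota>_def vec_eq_iff axis_def)
  have \<pi>d: "(\<pi> has_derivative \<iota>) (at y)" for y
    unfolding \<pi>eq using \<iota>lin
    by (auto intro!: derivative_eq_intros bounded_linear_imp_has_derivative simp: linear_conv_bounded_linear)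
  have \<pi>c: "continuous_on UNIV \<pi>"
    unfolding \<pi>eq using \<iota>lin by (intro continuous_intros) (simp add: linear_continuous_on linear_conv_bounded_linear)
  define Q where "Q = (\<lambda>l y. F y $ l / F y $ i)"
  have Qd: "complex_derivable (Q l) y" if "F y $ i \<noteq> 0" for l y
    unfolding Q_def divide_inverse using that Fpf
    by (intro complex_derivable_mult complex_derivable_inverse complex_derivable_polynomial_fun) auto
  then obtain N where N: "\<And>l. (Q l has_derivative N l) (at x)" "\<And>l c v. N l (c *s v) = c * N l v"
    using x(2) unfolding complex_derivable_def by metis
  \<comment> \<open>The chart map, completed by the identity in the coordinate \<open>i\<close> to a
    self-map of the full space. Its derivative at \<open>x\<close> is then the very matrix whose
    determinant is \<open>chart_jacobian\<close>.\<close>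
  define \<Phi> where "\<Phi> = (\<lambda>y. \<chi> l. if l = i then y $ i else Q l (\<pi> y))"
  define M where "M = (\<chi> l m. if l = i \<or> m = i then (if l = i \<and> m = i then 1 else 0)
                 else deriv (\<lambda>s. F (x + s *s axis m 1) $ l / F (x + s *s axis m 1) $ i) 0)"
  have Mlm: "M $ l $ m = N l (axis m 1)" if "l \<noteq> i" "m \<noteq> i" for l m
    using that deriv_along_axis[OF N] by (simp add: M_def Q_def)
  have \<Phi>d: "(\<Phi> has_derivative (\<lambda>v. M *v v)) (at x)"
  proof (rule has_derivative_componentwise_within[THEN iffD2, rule_format])
    fix b :: "complex ^ 'n" assume "b \<in> Basis"
    then obtain l c where b: "b = axis l c" unfolding Basis_vec_def by blast
    have comp: "((\<lambda>y. \<Phi> y $ l) has_derivative (\<lambda>v. (M *v v) $ l)) (at x)"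
    proof (cases "l = i")
      case True
      have "(M *v v) $ l = v $ i" for v
      proof -
        have "(M *v v) $ l = (\<Sum>m\<in>UNIV. M $ i $ m * v $ m)"
          using True by (simp add: matrix_vector_mult_def)
        also have "\<dots> = (\<Sum>m\<in>UNIV. if m = i then v $ i else 0)"
          by (intro sum.cong) (auto simp: M_def)
        finally show ?thesis by simp
      qed
      then show ?thesis using True
        by (auto simp: \<Phi>_def intro!: bounded_linear_imp_has_derivative bounded_linear_vec_nth)
    next
      case False
      have "(M *v v) $ l = N l (\<iota> v)" for v
      proof -
        have "N l (\<iota> v) = (\<Sum>m\<in>UNIV. \<iota> v $ m * N l (axis m 1))"
          by (rule complex_linear_expand[OF has_derivative_linear[OF N(1)] N(2)])
        also have "\<dots> = (\<Sum>m\<in>UNIV. M $ l $ m * v $ m)"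
        proof (intro sum.cong refl)
          fix m
          show "\<iota> v $ m * N l (axis m 1) = M $ l $ m * v $ m"
            using False Mlm[of l m] by (cases "m = i") (simp_all add: \<iota>_def M_def)
        qed
        also have "\<dots> = (M *v v) $ l" by (simp add: matrix_vector_mult_def)
        finally show ?thesis by simp
      qed
      moreover have "((\<lambda>y. Q l (\<pi> y)) has_derivative (\<lambda>v. N l (\<iota> v))) (at x)"
        using has_derivative_compose[OF \<pi>d] N(1) \<pi>x by metis
      ultimately show ?thesis using False by (simp add: \<Phi>_def)
    qed
    then show "((\<lambda>y. \<Phi> y \<bullet> b) has_derivative (\<lambda>v. (M *v v) \<bullet> b)) (at x)"
      unfolding b inner_axis by (rule has_derivative_inner_left)
  qed
  define S where "S = {y. F (\<pi> y) $ i \<noteq> 0}"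
  have Fc: "continuous_on UNIV (\<lambda>y. F y $ l)" for l
    using complex_derivable_polynomial_fun[OF Fpf] unfolding complex_derivable_def
    by (metis continuous_at_imp_continuous_on has_derivative_continuous)
  have F\<pi>c: "continuous_on UNIV (\<lambda>y. F (\<pi> y) $ l)" for l
    using continuous_on_compose2[OF Fc \<pi>c] by auto
  have "open S"
    unfolding S_def using F\<pi>c by (intro open_Collect_neq continuous_on_const)
  have "continuous_on S (\<lambda>y. if l = i then y $ i else Q l (\<pi> y))" for l
  proof (cases "l = i")
    case True
    then show ?thesis by (simp add: continuous_on_component continuous_on_id)
  next
    case False
    have "continuous_on S (\<lambda>y. F (\<pi> y) $ l / F (\<pi> y) $ i)"
      by (rule continuous_on_divide) (use F\<pi>c in \<open>auto simp: S_def intro: continuous_on_subset\<close>)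
    then show ?thesis using False by (simp add: Q_def)
  qed
  then have "continuous_on S \<Phi>" unfolding \<Phi>_def by (rule continuous_on_vec_lambda)
  have "x \<in> S" using x \<pi>x by (simp add: S_def)
  have "det M \<noteq> 0" using x(3) unfolding chart_jacobian_def M_def .
  then have "invertible M" by (simp add: invertible_det_nz)
  then obtain M' where inv: "M ** M' = mat 1" unfolding invertible_def by blast
  \<comment> \<open>Continuity on \<open>S\<close> and a right inverse of the derivative at the
    single point \<open>x\<close> are enough for openness there.\<close>
  have "\<Phi> x \<in> interior (\<Phi> ` S)"
  proof (rule sussmann_open_mapping[OF \<open>open S\<close> \<open>continuous_on S \<Phi>\<close> \<open>x \<in> S\<close> \<Phi>d])
    show "bounded_linear (\<lambda>v. M' *v v)"
      using linear_matrix_vector_complex linear_conv_bounded_linear by blast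
    show "(*v) M \<circ> (*v) M' = id"
      by (simp add: fun_eq_iff matrix_vector_mul_assoc inv)
    show "S \<subseteq> S" "x \<in> interior S" using \<open>open S\<close> \<open>x \<in> S\<close> by (auto simp: interior_open)
  qed
  moreover have "s (\<pi> u) = 0" if "u \<in> \<Phi> ` S" for u
  proof -
    obtain y where y: "y \<in> S" "u = \<Phi> y" using \<open>u \<in> \<Phi> ` S\<close> by blast
    have "F (\<pi> y) = F (\<pi> y) $ i *s \<pi> u"
      using y by (simp add: vec_eq_iff \<pi>_def[of] \<Phi>_def Q_def S_def)
    then have "(F (\<pi> y) $ i) ^ e * s (\<pi> u) = 0" using s0 homogeneous_scale[OF s(1)] by metis
    then show ?thesis using y by (simp add: S_def)
  qed
  moreover have "polynomial_fun (\<lambda>u. s (\<pi> u))"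
  proof (rule polynomial_fun_compose[OF homogeneous_imp_polynomial_fun[OF s(1)]])
    show "polynomial_fun (\<lambda>x. \<pi> x $ m)" for m
      by (cases "m = i") (auto simp: \<pi>_def polynomial_fun_const polynomial_fun_coord)
  qed
  ultimately have \<pi>0: "s (\<pi> u) = 0" for u
    using polynomial_fun_eq_0_on_open[of "\<lambda>u. s (\<pi> u)" "interior (\<Phi> ` S)" "\<Phi> x" u]
      interior_subset[of "\<Phi> ` S"] by (simp add: subset_iff)
  \<comment> \<open>So far \<open>s\<close> vanishes on the affine chart; homogeneity extends this
    to all \<open>u\<close> whose coordinate \<open>i\<close> is nonzero.\<close>
  have "u $ i * s u = 0" for u
  proof (cases "u $ i = 0")
    case False
    have "u = u $ i *s \<pi> (inverse (u $ i) *s u)" using False by (simp add: vec_eq_iff \<pi>_def)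
    then have "s u = u $ i ^ e * s (\<pi> (inverse (u $ i) *s u))" using homogeneous_scale[OF s(1)] by metis
    then show ?thesis using \<pi>0 by simp
  qed simp
  moreover have "\<exists>u::complex^'n. u $ i \<noteq> 0" by (metis one_index zero_neq_one)
  ultimately show False
    using polynomial_fun_eq_0_of_mult[OF polynomial_fun_coord homogeneous_imp_polynomial_fun[OF s(1)]] s(2) by blast
qed

section \<open>Liftings of iterates\<close>

lemma zero_of_prime_factor:
  fixes u :: "complex ^ 3 \<Rightarrow> complex"
  assumes "polynomial_fun u" "\<exists>x. u x \<noteq> 0" "u z = 0"
  shows "\<exists>g. prime_fun g \<and> poly_divides g u \<and> g z = 0"
proof -
  have "u z = 0 \<longrightarrow> (\<exists>g. prime_fun g \<and> poly_divides g u \<and> g z = 0)"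
    using assms(1,2)
  proof (induction u rule: polynomial_fun_prime_induct)
    case (factor g u)
    have "poly_divides g (\<lambda>x. g x * u x)" by (rule poly_dvd_mult_right[OF poly_dvd_refl factor(2)])
    moreover have "poly_divides h (\<lambda>x. g x * u x)" if "poly_divides h u" for h
      by (rule poly_dvd_mult_left[OF that prime_fun_polynomial_fun[OF factor(1)]])
    ultimately show ?case using factor by auto
  qed simp
  then show ?thesis using assms(3) by blast
qed

lemma hypersurface_mero_image_iff:
  fixes F :: "complex ^ 3 \<Rightarrow> complex ^ 3"
  assumes g: "prime_fun g" "homogeneous k g" and F: "\<And>i. homogeneous d (\<lambda>x. F x $ i)"
    and nd: "\<not> (\<forall>i. poly_divides g (\<lambda>x. F x $ i))"
  shows "hypersurface (mero_image F (zero_locus {g})) \<longleftrightarrow> (\<exists>h. maps_onto_curve g F h)"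
proof
  assume hyp: "hypersurface (mero_image F (zero_locus {g}))"
  have "\<not> maps_to_point g F v" for v
  proof
    assume v: "maps_to_point g F v"
    then have "v \<noteq> 0" unfolding maps_to_point_def by blast
    then show False
      using hyp not_hypersurface_singleton unfolding mero_image_point[OF g F nd v] by blast
  qed
  then show "\<exists>h. maps_onto_curve g F h" using image_classification[OF g F nd] by blast
next
  assume "\<exists>h. maps_onto_curve g F h"
  then obtain h where h: "maps_onto_curve g F h" by blast
  then obtain l where "prime_fun h" "homogeneous l h" unfolding maps_onto_curve_def by blast
  then show "hypersurface (mero_image F (zero_locus {g}))"
    unfolding mero_image_curve[OF g F nd h] by (rule hypersurface_prime)
qed

lemma lifting_id: "lifting (id :: complex ^ 3 \<Rightarrow> complex ^ 3)"
proof -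
  have "no_common_factor (id :: complex ^ 3 \<Rightarrow> complex ^ 3)"
  proof (rule no_common_factorI, rule ccontr)
    fix g :: "complex ^ 3 \<Rightarrow> complex"
    assume g: "prime_fun g" and "\<not> (\<exists>i. \<not> poly_divides g (\<lambda>x. id x $ i))"
    then have d: "poly_divides g (\<lambda>x. x $ i)" for i by auto
    have "\<exists>x::complex^3. x $ 1 \<noteq> 0" by (metis one_index zero_neq_one)
    then obtain k where k: "homogeneous k g" using prime_factor_homogeneous[OF homogeneous_coord _ g d] by blast
    obtain x where "x \<noteq> 0" "g x = 0"
      using irreducible_zero_locus[OF g k] unfolding irreducible_algebraic_def zero_locus_def by auto
    then have "x $ i = 0" for i using poly_dvd_imp_zero[OF d] by blast
    then show False using \<open>x \<noteq> 0\<close> by (simp add: vec_eq_iff)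
  qed
  then show ?thesis unfolding lifting_def using homogeneous_coord by (auto intro!: exI[of _ "Suc 0"])
qed

text \<open>\<open>nondeg\<close> is the only trace of dominance needed for iteration: no curve
  contains the image of \<open>f\<close>, so composites do not vanish identically and have
  liftings.\<close>

locale nondegenerate_map =
  fixes f :: "complex ^ 3 \<Rightarrow> complex ^ 3" and d :: nat
  assumes f_hom: "homogeneous d (\<lambda>x. f x $ i)"
    and f_ncf: "no_common_factor f"
    and nondeg: "homogeneous e s \<Longrightarrow> \<exists>x. s x \<noteq> 0 \<Longrightarrow> \<exists>x. s (f x) \<noteq> 0"
begin

lemma funpow_homogeneous: "\<exists>D. \<forall>i. homogeneous D (\<lambda>x. (f ^^ n) x $ i)"
proof (induction n)
  case 0
  then show ?case using homogeneous_coord by auto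
next
  case (Suc n)
  then obtain D where D: "\<And>i. homogeneous D (\<lambda>x. (f ^^ n) x $ i)" by blast
  have "homogeneous (D * d) (\<lambda>x. f ((f ^^ n) x) $ i)" for i
    by (rule homogeneous_compose[OF f_hom D])
  then show ?case by auto
qed

lemma funpow_nondeg: "homogeneous e s \<Longrightarrow> \<exists>x. s x \<noteq> 0 \<Longrightarrow> \<exists>x. s ((f ^^ n) x) \<noteq> 0"
proof (induction n arbitrary: e s)
  case (Suc n)
  show ?case using Suc.IH[OF homogeneous_compose[OF Suc.prems(1) f_hom] nondeg[OF Suc.prems]] by simp
qed simp

lemma funpow_nonzero: "\<exists>x. (f ^^ n) x $ i \<noteq> 0"
proof -
  have "\<exists>x::complex^3. x $ i \<noteq> 0" by (metis one_index zero_neq_one)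
  then show ?thesis by (rule funpow_nondeg[OF homogeneous_coord])
qed

lemma lifting_iterate: "lifting_of_iterate f n (iterate f n)"
proof -
  obtain D where D: "\<And>i. homogeneous D (\<lambda>x. (f ^^ n) x $ i)" using funpow_homogeneous by blast
  have "\<exists>x. (f ^^ n) x \<noteq> 0" using funpow_nonzero[of n 1] by (metis zero_index)
  then have "\<exists>F. lifting_of_iterate f n F"
    using lifting_exists[OF D] unfolding lifting_of_iterate_def lifting_def by blast
  then show ?thesis unfolding iterate_def by (rule someI_ex)
qed

lemma lifting_of_iterateE:
  assumes "lifting_of_iterate f n A"
  obtains a h where "\<And>i. homogeneous a (\<lambda>x. A x $ i)" "no_common_factor A" "polynomial_fun h"
    "\<exists>x. h x \<noteq> 0" "\<And>x. (f ^^ n) x = h x *s A x"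
  using assms unfolding lifting_of_iterate_def lifting_def by blast

lemma lifting_not_dvd:
  "lifting_of_iterate f n A \<Longrightarrow> prime_fun g \<Longrightarrow> \<not> (\<forall>i. poly_divides g (\<lambda>x. A x $ i))"
  using no_common_factor_prime unfolding lifting_of_iterate_def lifting_def by blast

lemma lifting_of_iterate_id: "lifting_of_iterate f 0 id"
  unfolding lifting_of_iterate_def using lifting_id
  by (auto intro!: exI[of _ "\<lambda>x. 1"] polynomial_fun_const)

lemma lifting_of_iterate_1: "lifting_of_iterate f 1 f"
  unfolding lifting_of_iterate_def lifting_def using f_hom f_ncf
  by (auto intro!: exI[of _ "\<lambda>x. 1"] polynomial_fun_const)

lemma lifting_nondeg:
  assumes "lifting_of_iterate f n A" "homogeneous e s" "\<exists>x. s x \<noteq> 0"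
  shows "\<exists>x. s (A x) \<noteq> 0"
proof -
  obtain a h where "\<And>x. (f ^^ n) x = h x *s A x" using assms(1) lifting_of_iterateE by metis
  then show ?thesis using funpow_nondeg[OF assms(2,3), of n] by (auto simp: homogeneous_scale[OF assms(2)])
qed

lemma lifting_nonzero: "lifting_of_iterate f n A \<Longrightarrow> \<exists>x. A x $ i \<noteq> 0"
proof -
  have "\<exists>x::complex^3. x $ i \<noteq> 0" by (metis one_index zero_neq_one)
  then show "lifting_of_iterate f n A \<Longrightarrow> ?thesis" using lifting_nondeg[OF _ homogeneous_coord] by blast
qed

text \<open>With \<open>u = (hA \<circ> f^n) hB^a\<close> the composite \<open>f^(m+n)\<close>
  equals both \<open>u (A \<circ> B)\<close> and \<open>hC C\<close>. Since the coordinates of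
  \<open>C\<close> have no common factor, \<open>u\<close> divides \<open>hC\<close>, and the
  quotient is \<Delta>.\<close>

lemma compose_lifting:
  assumes A: "lifting_of_iterate f m A" and B: "lifting_of_iterate f n B" and C: "lifting_of_iterate f (m + n) C"
  shows "\<exists>\<Delta>. polynomial_fun \<Delta> \<and> (\<exists>x. \<Delta> x \<noteq> 0) \<and> (\<forall>x. A (B x) = \<Delta> x *s C x)"
proof -
  obtain a hA where A': "\<And>i. homogeneous a (\<lambda>x. A x $ i)" "polynomial_fun hA" "\<And>x. (f ^^ m) x = hA x *s A x"
    using A lifting_of_iterateE by metis
  obtain b hB where B': "\<And>i. homogeneous b (\<lambda>x. B x $ i)" "polynomial_fun hB" "\<And>x. (f ^^ n) x = hB x *s B x"
    using B lifting_of_iterateE by metis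
  obtain c hC where C': "\<And>i. homogeneous c (\<lambda>x. C x $ i)" "no_common_factor C" "polynomial_fun hC"
      "\<And>x. (f ^^ (m + n)) x = hC x *s C x"
    using C lifting_of_iterateE by metis
  obtain D where D: "\<And>i. homogeneous D (\<lambda>x. (f ^^ n) x $ i)" using funpow_homogeneous by blast
  define u where "u = (\<lambda>x. hA ((f ^^ n) x) * hB x ^ a)"
  have u: "polynomial_fun u"
    unfolding u_def
    by (rule polynomial_fun_mult[OF polynomial_fun_compose[OF A'(2) homogeneous_imp_polynomial_fun[OF D]]
          polynomial_fun_power[OF B'(2)]])
  have eq: "(f ^^ (m + n)) x $ i = u x * A (B x) $ i" for x i
  proof -
    have "(f ^^ (m + n)) x = hA ((f ^^ n) x) *s A (hB x *s B x)" by (simp add: funpow_add A'(3) B'(3))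
    then show ?thesis by (simp add: homogeneous_scale[OF A'(1)] u_def)
  qed
  have u0: "\<exists>x. u x \<noteq> 0" using funpow_nonzero[of "m + n" 1] eq by (metis mult_zero_left)
  have ABpf: "polynomial_fun (\<lambda>x. A (B x) $ i)" for i
    by (rule homogeneous_imp_polynomial_fun[OF homogeneous_compose[OF A'(1) B'(1)]])
  have Cpf: "polynomial_fun (\<lambda>x. C x $ i)" for i by (rule homogeneous_imp_polynomial_fun[OF C'(1)])
  have "poly_divides u hC"
  proof (rule dvd_of_dvd_mult_coprime[OF u u0 Cpf _ C'(3)])
    show "\<exists>i. \<not> poly_divides g (\<lambda>x. C x $ i)" if "prime_fun g" for g
      by (rule no_common_factor_prime[OF C'(2) that])
    show "poly_divides u (\<lambda>x. C x $ i * hC x)" for i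
      by (rule poly_dividesI[OF ABpf[of i]]) (simp add: eq[symmetric] C'(4))
  qed
  then obtain w where w: "polynomial_fun w" "\<And>x. hC x = u x * w x" using poly_dividesE by blast
  have AB: "A (B x) $ i = w x * C x $ i" for x i
  proof (rule polynomial_fun_cancel[OF u ABpf polynomial_fun_mult[OF w(1) Cpf] u0])
    show "u x * A (B x) $ i = u x * (w x * C x $ i)" for x
      by (simp add: eq[symmetric] C'(4) w(2) flip: mult.assoc)
  qed
  then have "A (B x) = w x *s C x" for x by (simp add: vec_eq_iff)
  moreover have "\<exists>x. w x \<noteq> 0" using funpow_nonzero[of "m + n" 1] eq AB by (metis mult_zero_left mult_zero_right)
  ultimately show ?thesis using w(1) by blast
qed

text \<open>Images compose along curves. Write \<open>A \<circ> B = \<Delta> C\<close>; if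
  \<open>g\<close> divided \<Delta>, then \<open>h\<close> would divide all coordinates of the
  lifting \<open>A\<close>. So the power of \<Delta> in
  \<open>s \<circ> A \<circ> B = \<Delta>^e (s \<circ> C)\<close> can be cancelled modulo
  \<open>g\<close>.\<close>

lemma image_step:
  assumes g: "prime_fun g" and A: "lifting_of_iterate f m A" and B: "lifting_of_iterate f n B"
    and C: "lifting_of_iterate f (m + n) C" and h: "maps_onto_curve g B h" and s: "homogeneous e s"
  shows "poly_divides g (\<lambda>x. s (C x)) \<longleftrightarrow> poly_divides h (\<lambda>x. s (A x))"
proof -
  obtain a where A': "\<And>i. homogeneous a (\<lambda>x. A x $ i)" using A lifting_of_iterateE by metis
  obtain c where C': "\<And>i. homogeneous c (\<lambda>x. C x $ i)" using C lifting_of_iterateE by metis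
  have hp: "prime_fun h" and hd: "\<And>e s. homogeneous e s \<Longrightarrow> poly_divides g (\<lambda>x. s (B x)) \<longleftrightarrow> poly_divides h s"
    using h unfolding maps_onto_curve_def by blast+
  obtain \<Delta> where \<Delta>: "polynomial_fun \<Delta>" "\<And>x. A (B x) = \<Delta> x *s C x" using compose_lifting[OF A B C] by blast
  have Cpf: "polynomial_fun (\<lambda>x. C x $ i)" for i by (rule homogeneous_imp_polynomial_fun[OF C'])
  have sC: "polynomial_fun (\<lambda>x. s (C x))"
    by (rule polynomial_fun_compose[OF homogeneous_imp_polynomial_fun[OF s] Cpf])
  obtain i where "\<not> poly_divides h (\<lambda>x. A x $ i)" using lifting_not_dvd[OF A hp] by blast
  then have "\<not> poly_divides g (\<lambda>x. \<Delta> x * C x $ i)" using hd[OF A'[of i]] \<Delta>(2) by simp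
  then have "\<not> poly_divides g \<Delta>" using poly_dvd_mult_right[OF _ Cpf] by blast
  then have g\<Delta>: "\<not> poly_divides g (\<lambda>x. \<Delta> x ^ e)" using prime_fun_dvd_power[OF g \<Delta>(1)] by blast
  have "poly_divides h (\<lambda>x. s (A x)) \<longleftrightarrow> poly_divides g (\<lambda>x. s (A (B x)))"
    using hd[OF homogeneous_compose[OF s A']] by simp
  also have "(\<lambda>x. s (A (B x))) = (\<lambda>x. \<Delta> x ^ e * s (C x))" by (simp add: \<Delta>(2) homogeneous_scale[OF s])
  also have "poly_divides g \<dots> \<longleftrightarrow> poly_divides g (\<lambda>x. s (C x))"
    using prime_fun_dvd_mult[OF g polynomial_fun_power[OF \<Delta>(1)] sC] g\<Delta>
      poly_dvd_mult_left[OF _ polynomial_fun_power[OF \<Delta>(1)]] by blast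
  finally show ?thesis by simp
qed

lemma curve_step:
  assumes "prime_fun g" "lifting_of_iterate f m A" "lifting_of_iterate f n B" "lifting_of_iterate f (m + n) C"
    "maps_onto_curve g B h" "maps_onto_curve h A k"
  shows "maps_onto_curve g C k"
  using assms(6) image_step[OF assms(1-5)] unfolding maps_onto_curve_def by blast

lemma point_step:
  assumes "prime_fun g" "lifting_of_iterate f m A" "lifting_of_iterate f n B" "lifting_of_iterate f (m + n) C"
    "maps_onto_curve g B h" "maps_to_point h A v"
  shows "maps_to_point g C v"
  using assms(6) image_step[OF assms(1-5)] unfolding maps_to_point_def by blast

lemma maps_onto_curve_id: "prime_fun g \<Longrightarrow> homogeneous k g \<Longrightarrow> maps_onto_curve g id g"
  unfolding maps_onto_curve_def by auto

text \<open>The case of a step from the identity. It transfers facts about a concrete lifting to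
  \<open>iterate\<close>, which is only a chosen one.\<close>

lemma curve_lifting_indep:
  assumes "prime_fun g" "homogeneous k g" "lifting_of_iterate f n A" "lifting_of_iterate f n C" "maps_onto_curve g A h"
  shows "maps_onto_curve g C h"
  using curve_step[OF assms(1,3) lifting_of_iterate_id _ maps_onto_curve_id[OF assms(1,2)] assms(5)] assms(4) by simp

lemma point_lifting_indep:
  assumes "prime_fun g" "homogeneous k g" "lifting_of_iterate f n A" "lifting_of_iterate f n C" "maps_to_point g A v"
  shows "maps_to_point g C v"
  using point_step[OF assms(1,3) lifting_of_iterate_id _ maps_onto_curve_id[OF assms(1,2)] assms(5)] assms(4) by simp

lemma lifting_classification:
  assumes "prime_fun g" "homogeneous k g" "lifting_of_iterate f n A"
  shows "(\<exists>h. maps_onto_curve g A h) \<or> (\<exists>v. maps_to_point g A v)"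
proof -
  obtain a where "\<And>i. homogeneous a (\<lambda>x. A x $ i)" using assms(3) lifting_of_iterateE by metis
  then show ?thesis by (rule image_classification[OF assms(1,2) _ lifting_not_dvd[OF assms(3,1)]])
qed

lemma iter_image_curve:
  assumes "prime_fun g" "homogeneous k g" "lifting_of_iterate f n A" "maps_onto_curve g A h"
  shows "iter_image f n (zero_locus {g}) = zero_locus {h}"
proof -
  obtain a where "\<And>i. homogeneous a (\<lambda>x. iterate f n x $ i)" using lifting_iterate lifting_of_iterateE by metis
  then show ?thesis
    using mero_image_curve[OF assms(1,2) _ lifting_not_dvd[OF lifting_iterate assms(1)]
        curve_lifting_indep[OF assms(1-3) lifting_iterate assms(4)]] by blast
qed

lemma iter_image_point:
  assumes "prime_fun g" "homogeneous k g" "lifting_of_iterate f n A" "maps_to_point g A v"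
  shows "iter_image f n (zero_locus {g}) = {pt v}"
proof -
  obtain a where "\<And>i. homogeneous a (\<lambda>x. iterate f n x $ i)" using lifting_iterate lifting_of_iterateE by metis
  then show ?thesis
    using mero_image_point[OF assms(1,2) _ lifting_not_dvd[OF lifting_iterate assms(1)]
        point_lifting_indep[OF assms(1-3) lifting_iterate assms(4)]] by blast
qed

lemma hypersurface_iter_image_iff:
  assumes "prime_fun g" "homogeneous k g"
  shows "hypersurface (iter_image f n (zero_locus {g})) \<longleftrightarrow> (\<exists>h. maps_onto_curve g (iterate f n) h)"
proof -
  obtain a where "\<And>i. homogeneous a (\<lambda>x. iterate f n x $ i)" using lifting_iterate lifting_of_iterateE by metis
  then show ?thesis
    by (rule hypersurface_mero_image_iff[OF assms _ lifting_not_dvd[OF lifting_iterate assms(1)]])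
qed

lemma curve_not_in_indeterminacy:
  assumes "prime_fun h" "homogeneous l h"
  shows "\<not> zero_locus {h} \<subseteq> indeterminacy f"
proof
  assume L: "zero_locus {h} \<subseteq> indeterminacy f"
  have "poly_divides h (\<lambda>x. f x $ i)" for i
  proof (rule prime_dvd_of_vanishing[OF assms(1) homogeneous_imp_polynomial_fun[OF f_hom]])
    fix x :: "complex ^ 3" assume x: "x \<noteq> 0" "h x = 0"
    then have "pt x \<in> indeterminacy f" using L pt_in_zero_locus_single[OF assms(2)] by blast
    then show "f x $ i = 0" using pt_in_indeterminacy[OF f_hom x(1)] by simp
  qed
  then show False using no_common_factor_prime[OF f_ncf assms(1)] by blast
qed

text \<open>The factor between \<open>f\<close> and the chosen lifting divides all coordinates of
  \<open>f\<close>, hence is constant.\<close>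

lemma iterate_1: "\<exists>c. c \<noteq> 0 \<and> (\<forall>x. f x = c *s iterate f 1 x)"
proof -
  obtain a h where A: "\<And>i. homogeneous a (\<lambda>x. iterate f 1 x $ i)" "polynomial_fun h" "\<exists>x. h x \<noteq> 0"
      "\<And>x. (f ^^ 1) x = h x *s iterate f 1 x"
    using lifting_iterate[of 1] lifting_of_iterateE by metis
  have "poly_divides h (\<lambda>x. f x $ i)" for i
    by (rule poly_dividesI[OF homogeneous_imp_polynomial_fun[OF A(1)[of i]]]) (use A(4) in simp)
  then obtain c where "\<And>x. h x = c" using f_ncf A(2) unfolding no_common_factor_def by blast
  then show ?thesis using A(3,4) by auto
qed

end

section \<open>The map of the proposition\<close>

text \<open>A chain of irreducible subsets of a point has length 0. The empty set is included, since
  an image may be empty when only indeterminate points are available.\<close>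

lemma proj_codim_singleton:
  fixes X :: "3 proj set"
  assumes "X \<subseteq> {z}"
  shows "proj_codim X > 1"
proof -
  have "proj_dim X \<le> 0"
    unfolding proj_dim_def
  proof (rule SUP_least)
    fix d :: nat
    assume "d \<in> {d. \<exists>Z. (\<forall>i\<le>d. irreducible_algebraic (Z i) \<and> Z i \<subseteq> X) \<and> (\<forall>i<d. Z i \<subset> Z (Suc i))}"
    then obtain Z where Z: "\<And>i. i \<le> d \<Longrightarrow> irreducible_algebraic (Z i) \<and> Z i \<subseteq> X" "\<And>i. i < d \<Longrightarrow> Z i \<subset> Z (Suc i)"
      by blast
    have "d = 0"
    proof (rule ccontr)
      assume "d \<noteq> 0"
      then have "Z 0 \<subset> Z 1" "Z 1 \<subseteq> {z}" "Z 0 \<noteq> {}"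
        using Z(1)[of 0] Z(1)[of 1] Z(2)[of 0] assms by (auto simp: irreducible_algebraic_def)
      then show False by blast
    qed
    then show "ereal (real d) \<le> 0" by (simp add: zero_ereal_def)
  qed
  have "ereal 1 < ereal 2 - 0" by simp
  also have "\<dots> \<le> ereal 2 - proj_dim X" using \<open>proj_dim X \<le> 0\<close> by (intro ereal_minus_mono) auto
  finally show ?thesis unfolding proj_codim_def by (simp add: one_ereal_def)
qed

text \<open>A point on the curve followed by the curve itself is a chain of length 1.\<close>

lemma proj_codim_curve:
  fixes h :: "complex ^ 3 \<Rightarrow> complex"
  assumes h: "prime_fun h" "homogeneous l h" and X: "zero_locus {h} \<subseteq> X"
  shows "\<not> proj_codim X > 1"
proof -
  obtain u where u: "u \<noteq> 0" "pt u \<in> zero_locus {h}"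
    using irreducible_zero_locus[OF h] unfolding irreducible_algebraic_def zero_locus_def by auto
  have "zero_locus {h} \<noteq> {pt u}"
    using hypersurface_prime[OF h] not_hypersurface_singleton[OF u(1)] by metis
  then have sub: "{pt u} \<subset> zero_locus {h}" using u by blast
  define Z where "Z = (\<lambda>i::nat. if i = 0 then {pt u} else zero_locus {h})"
  have "(\<forall>i\<le>1. irreducible_algebraic (Z i) \<and> Z i \<subseteq> X) \<and> (\<forall>i<1. Z i \<subset> Z (Suc i))"
    using sub X irreducible_singleton[OF u(1)] irreducible_zero_locus[OF h] by (auto simp: Z_def)
  then have "ereal (real 1) \<le> proj_dim X"
    unfolding proj_dim_def by (intro SUP_upper) blast
  then have "ereal 2 - proj_dim X \<le> ereal 2 - ereal (real 1)" by (intro ereal_minus_mono) auto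
  then show ?thesis unfolding proj_codim_def by (auto simp: one_ereal_def)
qed

text \<open>The three \<open>Q_j\<close> and the coefficients of the pencil become vectors, so that
  arguments treat all coordinates alike; the vector \<open>1\<close> represents [1:1:1].\<close>

locale collapsing_map =
  fixes P R :: "complex ^ 3 \<Rightarrow> complex" and Q :: "complex ^ 3 \<Rightarrow> complex ^ 3"
    and p q :: nat and f :: "complex ^ 3 \<Rightarrow> complex ^ 3"
  assumes P: "homogeneous p P" "p \<ge> 1" and Q: "homogeneous q (\<lambda>x. Q x $ i)" and R: "homogeneous (p + q) R"
    and value1: "P 1 * Q 1 $ i = R 1" and R1: "R 1 \<noteq> 0"
    and f: "f x $ i = P x * Q x $ i - R x" and f_ncf: "no_common_factor f" and dom: "dominant f"
    and pencil: "a \<noteq> 0 \<Longrightarrow> (\<Sum>i\<in>UNIV. a $ i) = 0 \<Longrightarrow>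
        irreducible_component C (zero_locus {\<lambda>x. \<Sum>i\<in>UNIV. a $ i * Q x $ i}) \<Longrightarrow> hypersurface (iter_image f 1 C)"
    and P_image: "irreducible_component C (zero_locus {P}) \<Longrightarrow> hypersurface (iter_image f 2 C)"
    and collapsed: "irreducible_algebraic G \<Longrightarrow> hypersurface G \<Longrightarrow> iter_image f 1 G = {pt 1} \<Longrightarrow> G \<subseteq> zero_locus {P}"
begin

sublocale nondegenerate_map f "p + q"
proof
  show f_hom: "homogeneous (p + q) (\<lambda>x. f x $ i)" for i
    unfolding f by (intro homogeneous_diff homogeneous_mult P Q R)
  show "no_common_factor f" by (rule f_ncf)
  show "\<exists>x. s (f x) \<noteq> 0" if "homogeneous e s" "\<exists>x. s x \<noteq> 0" for e s
    by (rule dominant_compose_nonzero[OF dom f_hom that])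
qed

lemma P1: "P 1 \<noteq> 0" using value1[of 1] R1 by auto

lemma P_nonzero: "\<exists>x. P x \<noteq> 0" using P1 by blast

lemma P_polynomial: "polynomial_fun P" by (rule homogeneous_imp_polynomial_fun[OF P(1)])

lemma Q_polynomial: "polynomial_fun (\<lambda>x. Q x $ i)" by (rule homogeneous_imp_polynomial_fun[OF Q])

lemma R_polynomial: "polynomial_fun R" by (rule homogeneous_imp_polynomial_fun[OF R])

lemma one_neq_0: "(1 :: complex ^ 3) \<noteq> 0" by (metis one_index zero_index zero_neq_one)

lemma f_1: "f 1 = 0" by (simp add: vec_eq_iff f value1)

lemma one_in_indeterminacy: "pt 1 \<in> indeterminacy f"
  using pt_in_indeterminacy[OF f_hom one_neq_0] f_1 by simp

lemma not_dvd_R: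
  assumes g: "prime_fun g" "poly_divides g P" shows "\<not> poly_divides g R"
proof
  assume "poly_divides g R"
  then have "poly_divides g (\<lambda>x. f x $ i)" for i
    unfolding f by (rule poly_dvd_diff[OF poly_dvd_mult_right[OF g(2) Q_polynomial]])
  then show False using no_common_factor_prime[OF f_ncf g(1)] by blast
qed

text \<open>Modulo \<open>g\<close> a form \<open>s\<close> of degree \<open>e\<close> composed with
  \<open>f\<close> becomes \<open>s 1\<close> times a power of \<open>- R\<close>; that power is not
  divisible by \<open>g\<close>, for otherwise \<open>g\<close> would be a common factor of
  \<open>f\<close>.\<close>

lemma P_maps_to_one:
  assumes g: "prime_fun g" "poly_divides g P" shows "maps_to_point g f 1"
proof -
  have "poly_divides g (\<lambda>x. s (f x)) \<longleftrightarrow> s 1 = 0" if s: "homogeneous e s" for e s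
  proof -
    have "poly_divides g (\<lambda>x. s (f x) - s ((- R x) *s 1))"
    proof (rule poly_divides_compose_cong[OF homogeneous_imp_polynomial_fun[OF s]])
      show "poly_divides g (\<lambda>x. f x $ i - ((- R x) *s 1) $ i)" for i
        using poly_dvd_mult_right[OF g(2) Q_polynomial] by (simp add: f)
      show "polynomial_fun (\<lambda>x. f x $ i)" for i by (rule homogeneous_imp_polynomial_fun[OF f_hom])
      show "polynomial_fun (\<lambda>x. ((- R x) *s 1) $ i)" for i using polynomial_fun_minus[OF R_polynomial] by simp
    qed
    then have *: "poly_divides g (\<lambda>x. s (f x) - s 1 * (- R x) ^ e)"
      unfolding homogeneous_scale[OF s] by (simp only: mult.commute)
    show ?thesis
    proof
      assume "poly_divides g (\<lambda>x. s (f x))"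
      then have d: "poly_divides g (\<lambda>x. s 1 * (- R x) ^ e)" using poly_dvd_diff[OF _ *, of "\<lambda>x. s (f x)"] by simp
      have mR: "polynomial_fun (\<lambda>x. - R x)" by (rule polynomial_fun_minus[OF R_polynomial])
      show "s 1 = 0"
      proof (rule ccontr)
        assume "s 1 \<noteq> 0"
        then have "poly_divides g (\<lambda>x. (- R x) ^ e)"
          using prime_fun_dvd_cmult[OF g(1) polynomial_fun_power[OF mR] _ d] by blast
        then have "poly_divides g (\<lambda>x. - R x)" by (rule prime_fun_dvd_power[OF g(1) mR])
        then have "poly_divides g (\<lambda>x. -1 * R x)" by simp
        then have "poly_divides g R" by (rule prime_fun_dvd_cmult[OF g(1) R_polynomial, rotated]) simp
        then show False using not_dvd_R[OF g] by blast
      qed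
    qed (use * in simp)
  qed
  then show ?thesis unfolding maps_to_point_def using one_neq_0 by blast
qed

lemma maps_to_point_imp_dvd_P:
  assumes g: "prime_fun g" "homogeneous k g" and v: "maps_to_point g f v"
  shows "poly_divides g P"
proof -
  have v0: "v \<noteq> 0" and vd: "\<And>e s. homogeneous e s \<Longrightarrow> poly_divides g (\<lambda>x. s (f x)) \<longleftrightarrow> s v = 0"
    using v unfolding maps_to_point_def by blast+
  show ?thesis
  proof (cases "\<exists>c. v = c *s 1")
    case True
    then have "pt v = pt 1" using pt_eq_iff[OF one_neq_0 v0] by simp
    then have "iter_image f 1 (zero_locus {g}) = {pt 1}" using iter_image_point[OF g lifting_of_iterate_1 v] by simp
    then have "zero_locus {g} \<subseteq> zero_locus {P}"
      using collapsed irreducible_zero_locus[OF g] hypersurface_prime[OF g] by blast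
    then show ?thesis using zero_locus_subset_iff_dvd[OF g P(1)] by blast
  next
    case False
    text \<open>The linear form \<open>s\<close> vanishes at \<open>v\<close> and at \<open>[1:1:1]\<close>, so \<open>R\<close> cancels in \<open>s \<circ> f\<close>.\<close>
    define a :: "complex ^ 3" where "a = vector [v $ 3 - v $ 2, v $ 1 - v $ 3, v $ 2 - v $ 1]"
    define s where "s = (\<lambda>x::complex^3. \<Sum>i\<in>UNIV. a $ i * x $ i)"
    define T where "T = (\<lambda>x. \<Sum>i\<in>UNIV. a $ i * Q x $ i)"
    have a_sum: "(\<Sum>i\<in>UNIV. a $ i) = 0" by (simp add: a_def sum_3)
    \<comment> \<open>\<open>a\<close> is the cross product of \<open>1\<close> and
      \<open>v\<close>, so it is nonzero because \<open>v\<close> is not a multiple of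
      \<open>1\<close>.\<close>
    have a0: "a \<noteq> 0"
    proof
      assume "a = 0"
      then have "a $ 1 = 0" "a $ 3 = 0" by simp_all
      then have "v $ 3 = v $ 1" "v $ 2 = v $ 1" by (simp_all add: a_def)
      then have "v = v $ 1 *s 1" by (simp add: vec_eq_iff forall_3)
      then show False using False by blast
    qed
    have s: "homogeneous 1 s" unfolding s_def by (intro homogeneous_sum homogeneous_cmult homogeneous_coord)
    have T: "homogeneous q T" unfolding T_def by (intro homogeneous_sum homogeneous_cmult Q)
    have sf: "s (f x) = P x * T x" for x
    proof -
      have "s (f x) = P x * T x - R x * (\<Sum>i\<in>UNIV. a $ i)"
        by (simp add: s_def T_def f sum_3 algebra_simps)
      then show ?thesis using a_sum by simp
    qed
    have s0: "\<exists>x. s x \<noteq> 0"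
    proof -
      obtain i where "a $ i \<noteq> 0" using a0 by (metis vec_eq_iff zero_index)
      then have "s (axis i 1) \<noteq> 0" by (simp add: s_def axis_def if_distrib cong: if_cong)
      then show ?thesis by blast
    qed
    \<comment> \<open>If \<open>T\<close> were zero, the image of \<open>f\<close> would lie in the
      line \<open>s = 0\<close>. Components of the zero locus of \<open>T\<close> are described by
      prime factors only for nonzero \<open>T\<close>.\<close>
    then have T0: "\<exists>x. T x \<noteq> 0" using nondeg[OF s] sf by auto
    have "s v = 0" by (simp add: s_def a_def sum_3 algebra_simps)
    then have "poly_divides g (\<lambda>x. P x * T x)" using vd[OF s] sf by simp
    then consider "poly_divides g P" | "poly_divides g T"
      using prime_fun_dvd_mult[OF g(1) P_polynomial homogeneous_imp_polynomial_fun[OF T]] by blast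
    then show ?thesis
    proof cases
      case 2
      then have "irreducible_component (zero_locus {g}) (zero_locus {T})"
        using irreducible_component_zero_locus[OF T T0] g by blast
      then have "hypersurface (iter_image f 1 (zero_locus {g}))"
        using pencil[OF a0 a_sum] unfolding T_def by blast
      then show ?thesis
        using iter_image_point[OF g lifting_of_iterate_1 v] not_hypersurface_singleton[OF v0] by simp
    qed
  qed
qed

text \<open>If the image of \<open>g = 0\<close> were a curve, \<open>f\<close> would vanish along
  that curve and have a common factor. So the image is a point.\<close>

lemma dvd_indeterminate_imp_dvd_P:
  assumes g: "prime_fun g" "homogeneous k g" and d: "\<And>i. poly_divides g (\<lambda>x. f (f x) $ i)"
  shows "poly_divides g P"
proof -
  have "\<not> maps_onto_curve g f h" for h
  proof
    assume "maps_onto_curve g f h"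
    then have "prime_fun h" "\<And>i. poly_divides h (\<lambda>x. f x $ i)"
      using d f_hom unfolding maps_onto_curve_def by blast+
    then show False using no_common_factor_prime[OF f_ncf] by blast
  qed
  then obtain v where "maps_to_point g f v" using lifting_classification[OF g lifting_of_iterate_1] by blast
  then show ?thesis by (rule maps_to_point_imp_dvd_P[OF g])
qed

text \<open>After a curve, \<open>f\<close> is applied once. After a visit to [1:1:1] the next image
  is found by applying \<open>f^2\<close> to the curve of time \<open>m\<close>, one step before the
  visit; therefore that curve is part of the induction hypothesis, and for every lifting of
  \<open>f^m\<close>, as later uses involve different liftings.\<close>

lemma orbit_dichotomy:
  assumes g: "prime_fun g" "homogeneous k g"
  shows "lifting_of_iterate f n A \<Longrightarrow> (\<exists>h. maps_onto_curve g A h) \<or>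
    (maps_to_point g A 1 \<and> (\<exists>m h. n = Suc m \<and> (\<forall>B. lifting_of_iterate f m B \<longrightarrow> maps_onto_curve g B h) \<and> poly_divides h P))"
proof (induction n arbitrary: A)
  case 0
  then show ?case using curve_lifting_indep[OF g lifting_of_iterate_id 0 maps_onto_curve_id[OF g]] by blast
next
  case (Suc n)
  note It = lifting_iterate[of n]
  consider h where "maps_onto_curve g (iterate f n) h" | m h where "n = Suc m"
      "\<And>B. lifting_of_iterate f m B \<Longrightarrow> maps_onto_curve g B h" "poly_divides h P"
    using Suc.IH[OF It] by blast
  then show ?case
  proof cases
    case 1
    then obtain l where hp: "prime_fun h" "homogeneous l h" unfolding maps_onto_curve_def by blast
    consider k where "maps_onto_curve h f k" | v where "maps_to_point h f v"
      using lifting_classification[OF hp lifting_of_iterate_1] by blast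
    then show ?thesis
    proof cases
      case 1
      then show ?thesis
        using curve_step[OF g(1) lifting_of_iterate_1 It _ \<open>maps_onto_curve g (iterate f n) h\<close>] Suc.prems by auto
    next
      case 2
      then have "poly_divides h P" by (rule maps_to_point_imp_dvd_P[OF hp])
      moreover have "maps_to_point g A 1"
        using point_step[OF g(1) lifting_of_iterate_1 It _ \<open>maps_onto_curve g (iterate f n) h\<close>
            P_maps_to_one[OF hp(1) calculation]] Suc.prems by simp
      ultimately show ?thesis
        using curve_lifting_indep[OF g It _ \<open>maps_onto_curve g (iterate f n) h\<close>] by blast
    qed
  next
    case 2
    note gh = 2(2)[OF lifting_iterate]
    then obtain l where hp: "prime_fun h" "homogeneous l h" unfolding maps_onto_curve_def by blast
    then have "irreducible_component (zero_locus {h}) (zero_locus {P})"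
      using irreducible_component_zero_locus[OF P(1) P_nonzero] 2(3) by blast
    then obtain k where k: "maps_onto_curve h (iterate f 2) k"
      using P_image hypersurface_iter_image_iff[OF hp] by blast
    have "lifting_of_iterate f (2 + m) A" using Suc.prems 2(1) by simp
    then show ?thesis using curve_step[OF g(1) lifting_iterate lifting_iterate _ gh k] by blast
  qed
qed

text \<open>Only an inclusion, since \<open>X\<close> is arbitrary and may consist of indeterminate
  points.\<close>

lemma iter_image_in_P:
  assumes "X \<subseteq> zero_locus {P}" shows "iter_image f 1 X \<subseteq> {pt 1}"
proof -
  obtain c where c: "c \<noteq> 0" "\<And>x. f x = c *s iterate f 1 x" using iterate_1 by blast
  have "pt (iterate f 1 x) = pt 1" if x: "x \<noteq> 0" "pt x \<in> X - indeterminacy (iterate f 1)" for x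
  proof -
    have "P x = 0" using x assms pt_in_zero_locus_single[OF P(1)] by blast
    then have "f x = (- R x) *s 1" by (simp add: vec_eq_iff f)
    then have "iterate f 1 x = (- R x / c) *s 1" using c by (simp add: vec_eq_iff field_simps)
    moreover have "iterate f 1 x \<noteq> 0" using x by (auto simp: indeterminacy_def)
    ultimately show ?thesis using pt_eq_iff[OF one_neq_0, of "iterate f 1 x"] by metis
  qed
  then have "{pt (iterate f 1 x) |x. x \<noteq> 0 \<and> pt x \<in> X - indeterminacy (iterate f 1)} \<subseteq> {pt 1}" by blast
  then show ?thesis
    unfolding mero_image_def by (rule zariski_closure_subset[OF algebraic_singleton[OF one_neq_0]])
qed

section \<open>Degree lowering and primitive hypersurfaces\<close>

lemma degree_lowering_in_P: "hypersurface K \<Longrightarrow> K \<subseteq> zero_locus {P} \<Longrightarrow> degree_lowering f K"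
  unfolding degree_lowering_def using iter_image_in_P one_in_indeterminacy by blast

lemma height_in_P: "K \<subseteq> zero_locus {P} \<Longrightarrow> height f K = 1"
  unfolding height_def using iter_image_in_P one_in_indeterminacy by (intro Least_equality) auto

lemma primitive_system_P: "primitive_system f {zero_locus {P}}"
  unfolding primitive_system_def
proof (intro conjI ballI allI impI)
  have "hypersurface (zero_locus {P})" unfolding hypersurface_def using P P_nonzero by blast
  then show "degree_lowering f H" if "H \<in> {zero_locus {P}}" for H using degree_lowering_in_P that by auto
  show "proj_codim (iter_image f m H) > 1" if "H \<in> {zero_locus {P}}" "m \<in> {1..height f H}" for H m
    using that height_in_P[of H] proj_codim_singleton[OF iter_image_in_P[of H]] by auto
  fix H assume H: "irreducible_algebraic H \<and> degree_lowering f H"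
  then obtain g k where g: "prime_fun g" "homogeneous k g" "H = zero_locus {g}"
    using irreducible_hypersurfaceE unfolding degree_lowering_def by metis
  obtain n where n: "iter_image f n H \<subseteq> indeterminacy f" using H unfolding degree_lowering_def by blast
  \<comment> \<open>No curve lies in the indeterminacy locus, so at time \<open>n\<close> the orbit
    is at the point, and the curve just before it, possibly at time 0, lies in
    \<open>{P = 0}\<close>.\<close>
  have "\<not> maps_onto_curve g (iterate f n) h" for h
  proof
    assume h: "maps_onto_curve g (iterate f n) h"
    then obtain l where "prime_fun h" "homogeneous l h" unfolding maps_onto_curve_def by blast
    then show False
      using curve_not_in_indeterminacy iter_image_curve[OF g(1,2) lifting_iterate h] n g(3) by metis
  qed
  then obtain m h where "maps_onto_curve g (iterate f m) h" "poly_divides h P"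
    using orbit_dichotomy[OF g(1,2) lifting_iterate[of n]] lifting_iterate by blast
  moreover obtain l where hp: "prime_fun h" "homogeneous l h" using calculation unfolding maps_onto_curve_def by blast
  ultimately show "\<exists>n. \<exists>K\<in>{zero_locus {P}}. hypersurface (iter_image f n H) \<and> iter_image f n H \<subseteq> K"
    using iter_image_curve[OF g(1,2) lifting_iterate] hypersurface_prime[OF hp] zero_locus_mono_dvd[OF hp(2) P(1)] g(3)
    by (metis singletonI)
qed auto

text \<open>Heights are at least 1, so the codimension condition covers the first image. A component
  sent onto a curve would make this image too large; hence every component is contracted and lies in
  \<open>{P = 0}\<close>.\<close>

lemma primitive_in_P:
  assumes H: "degree_lowering f H" "\<And>m. m \<in> {1..height f H} \<Longrightarrow> proj_codim (iter_image f m H) > 1"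
  shows "H \<subseteq> zero_locus {P}"
proof
  fix z assume z: "z \<in> H"
  obtain e r where r: "homogeneous e r" "\<exists>x. r x \<noteq> 0" "H = zero_locus {r}"
    using H(1) unfolding degree_lowering_def hypersurface_def by blast
  have "\<exists>n. n \<ge> 1 \<and> iter_image f n H \<subseteq> indeterminacy f" using H(1) unfolding degree_lowering_def by blast
  then have "height f H \<ge> 1" unfolding height_def by (rule LeastI2_ex) simp
  then have codim: "proj_codim (iter_image f 1 H) > 1" using H(2) by simp
  obtain x where x: "z = pt x" "x \<noteq> 0" "r x = 0" using z r(3) unfolding zero_locus_def by blast
  obtain g where g: "prime_fun g" "poly_divides g r" "g x = 0"
    using zero_of_prime_factor[OF homogeneous_imp_polynomial_fun[OF r(1)] r(2) x(3)] by blast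
  obtain k where k: "homogeneous k g" using prime_factor_homogeneous[OF r(1,2) g(1,2)] by blast
  have sub: "iter_image f 1 (zero_locus {g}) \<subseteq> iter_image f 1 H"
    unfolding r(3) by (rule mero_image_mono[OF zero_locus_mono_dvd[OF k r(1) g(2)]])
  have "\<not> maps_onto_curve g f h" for h
  proof
    assume h: "maps_onto_curve g f h"
    then obtain l where hp: "prime_fun h" "homogeneous l h" unfolding maps_onto_curve_def by blast
    then show False
      using proj_codim_curve[OF hp] codim sub iter_image_curve[OF g(1) k lifting_of_iterate_1 h] by simp
  qed
  then obtain v where "maps_to_point g f v" using lifting_classification[OF g(1) k lifting_of_iterate_1] by blast
  then have "poly_divides g P" by (rule maps_to_point_imp_dvd_P[OF g(1) k])
  then have "P x = 0" using g(3) poly_dvd_imp_zero by blast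
  then show "z \<in> zero_locus {P}" using x pt_in_zero_locus_single[OF P(1)] by simp
qed

text \<open>All members lie in \<open>{P = 0}\<close> and have height 1, while heights are distinct:
  there is at most one. There is at least one because the non-constant \<open>P\<close> has a prime
  factor, whose curve is degree lowering.\<close>

lemma primitive_system_unique:
  assumes "primitive_system f S"
  shows "\<exists>K. S = {K} \<and> K \<subseteq> zero_locus {P} \<and> hypersurface K"
proof -
  have dl: "\<And>H. H \<in> S \<Longrightarrow> degree_lowering f H" and sub: "\<And>H. H \<in> S \<Longrightarrow> H \<subseteq> zero_locus {P}"
    using assms primitive_in_P unfolding primitive_system_def by blast+
  have "P 0 = 0" using homogeneous_scale[OF P(1), of 0 1] P(2) by simp
  then have "\<not> (\<exists>c. \<forall>x. P x = c)" using P1 by metis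
  then obtain g where g: "prime_fun g" "poly_divides g P" using prime_factor_exists[OF P_polynomial] by blast
  then obtain k where k: "homogeneous k g" using prime_factor_homogeneous[OF P(1) P_nonzero] by blast
  have "degree_lowering f (zero_locus {g})"
    by (rule degree_lowering_in_P[OF hypersurface_prime[OF g(1) k] zero_locus_mono_dvd[OF k P(1) g(2)]])
  then obtain K where K: "K \<in> S"
    using assms irreducible_zero_locus[OF g(1) k] unfolding primitive_system_def by blast
  have "H = K" if "H \<in> S" for H
    using assms that K height_in_P[OF sub[OF that]] height_in_P[OF sub[OF K]]
    unfolding primitive_system_def by (metis inj_onD)
  then have "S = {K}" using K by blast
  then show ?thesis using sub dl K unfolding degree_lowering_def by blast
qed

text \<open>A component of a smaller hypersurface comes from a prime factor of \<open>P\<close>, so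
  it is a component of \<open>{P = 0}\<close> too, and (b) applies to it.\<close>

lemma component_in_P:
  assumes K: "hypersurface K" "K \<subseteq> zero_locus {P}" and H: "irreducible_component H K"
  shows "irreducible_component H (zero_locus {P}) \<and> iter_image f 1 H = {pt 1}"
proof -
  obtain e r where r: "homogeneous e r" "\<exists>x. r x \<noteq> 0" "K = zero_locus {r}"
    using K(1) unfolding hypersurface_def by blast
  then obtain g k where g: "prime_fun g" "homogeneous k g" "poly_divides g r" "H = zero_locus {g}"
    using H irreducible_component_zero_locus[OF r(1,2)] by blast
  then have "zero_locus {g} \<subseteq> zero_locus {P}" using zero_locus_mono_dvd[OF g(2) r(1) g(3)] K(2) r(3) by blast
  then have gP: "poly_divides g P" using zero_locus_subset_iff_dvd[OF g(1,2) P(1)] by blast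
  then have "irreducible_component H (zero_locus {P})"
    using irreducible_component_zero_locus[OF P(1) P_nonzero] g by blast
  then show ?thesis using iter_image_point[OF g(1,2) lifting_of_iterate_1 P_maps_to_one[OF g(1) gP]] g(4) by simp
qed

section \<open>Common factors of composed liftings and the recursion\<close>

lemma second_iterate_factor:
  "\<exists>h e. homogeneous e h \<and> (\<exists>x. h x \<noteq> 0) \<and> h 1 \<noteq> 0 \<and> (\<forall>x. f (f x) = h x *s iterate f 2 x)"
proof -
  obtain a h where A: "\<And>i. homogeneous a (\<lambda>x. iterate f 2 x $ i)" and h: "polynomial_fun h" "\<exists>x. h x \<noteq> 0"
      "\<And>x. (f ^^ 2) x = h x *s iterate f 2 x"
    using lifting_iterate[of 2] lifting_of_iterateE by metis
  have ff: "(f ^^ 2) x = f (f x)" for x by (simp add: numeral_2_eq_2)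
  obtain D where D: "\<And>i. homogeneous D (\<lambda>x. (f ^^ 2) x $ i)" using funpow_homogeneous by blast
  have "(f ^^ 2) x $ 1 = h x * iterate f 2 x $ 1" for x using h(3) by simp
  then obtain e where e: "homogeneous e h"
    using homogeneous_factor[OF D funpow_nonzero h(1) homogeneous_imp_polynomial_fun[OF A]] by blast
  have "h 1 \<noteq> 0"
  proof
    assume "h 1 = 0"
    then obtain g where g: "prime_fun g" "poly_divides g h" "g 1 = 0" using zero_of_prime_factor[OF h(1,2)] by blast
    obtain k where k: "homogeneous k g" using prime_factor_homogeneous[OF e h(2) g(1,2)] by blast
    have "poly_divides g (\<lambda>x. f (f x) $ i)" for i
    proof -
      have "poly_divides g (\<lambda>x. h x * iterate f 2 x $ i)"
        by (rule poly_dvd_mult_right[OF g(2) homogeneous_imp_polynomial_fun[OF A]])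
      then show ?thesis using h(3) ff by simp
    qed
    then have "poly_divides g P" by (rule dvd_indeterminate_imp_dvd_P[OF g(1) k])
    then show False using g(3) poly_dvd_imp_zero P1 by blast
  qed
  then show ?thesis using e h ff by metis
qed

text \<open>With \<open>f \<circ> A = \<Delta>1 B\<close>, \<open>f \<circ> B = \<Delta> C0\<close> and \<open>F\<^sub>2 \<circ> A = \<Delta>2 C0\<close>, the two ways to compute \<open>f \<circ> f \<circ> A\<close>
  give \<open>\<Delta>1\<^sup>d \<Delta> = (h \<circ> A) \<Delta>2\<close>. By the dichotomy, a curve on which \<open>\<Delta>1\<close> vanishes is sent by \<open>A\<close> to
  \<open>[1:1:1]\<close>, where \<open>h\<close> does not vanish; and no curve lies in the zero sets of both \<open>\<Delta>\<close> and \<open>\<Delta>2\<close>.\<close>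

lemma next_lifting:
  assumes h: "homogeneous eh h" "\<exists>x. h x \<noteq> 0" "h 1 \<noteq> 0" "\<And>x. f (f x) = h x *s iterate f 2 x"
    and A: "lifting_of_iterate f n A" and B: "lifting_of_iterate f (Suc n) B"
  shows "\<exists>C. lifting_of_iterate f (Suc (Suc n)) C \<and> (\<forall>x. h (A x) *s C x = f (B x))"
proof -
  define C0 where "C0 = iterate f (Suc (Suc n))"
  have C0: "lifting_of_iterate f (Suc (Suc n)) C0" unfolding C0_def by (rule lifting_iterate)
  obtain a where Ah: "\<And>i. homogeneous a (\<lambda>x. A x $ i)" using A lifting_of_iterateE by metis
  obtain b where Bh: "\<And>i. homogeneous b (\<lambda>x. B x $ i)" using B lifting_of_iterateE by metis
  obtain c hC where Ch: "\<And>i. homogeneous c (\<lambda>x. C0 x $ i)" "no_common_factor C0" "polynomial_fun hC"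
      "\<exists>x. hC x \<noteq> 0" "\<And>x. (f ^^ Suc (Suc n)) x = hC x *s C0 x"
    using C0 lifting_of_iterateE by metis
  obtain a2 where F2h: "\<And>i. homogeneous a2 (\<lambda>x. iterate f 2 x $ i)" using lifting_iterate lifting_of_iterateE by metis
  obtain \<Delta>1 where \<Delta>1: "polynomial_fun \<Delta>1" "\<exists>x. \<Delta>1 x \<noteq> 0" "\<And>x. f (A x) = \<Delta>1 x *s B x"
    using compose_lifting[OF lifting_of_iterate_1 A, of B] B unfolding plus_1_eq_Suc by blast
  obtain \<Delta> where \<Delta>: "polynomial_fun \<Delta>" "\<exists>x. \<Delta> x \<noteq> 0" "\<And>x. f (B x) = \<Delta> x *s C0 x"
    using compose_lifting[OF lifting_of_iterate_1 B, of C0] C0 unfolding plus_1_eq_Suc by blast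
  obtain \<Delta>2 where \<Delta>2: "polynomial_fun \<Delta>2" "\<And>x. iterate f 2 (A x) = \<Delta>2 x *s C0 x"
    using compose_lifting[OF lifting_iterate[of 2] A, of C0] C0 unfolding add_2_eq_Suc by blast
  have Cpf: "polynomial_fun (\<lambda>x. C0 x $ i)" for i by (rule homogeneous_imp_polynomial_fun[OF Ch(1)])
  have hApf: "polynomial_fun (\<lambda>x. h (A x))" by (rule homogeneous_imp_polynomial_fun[OF homogeneous_compose[OF h(1) Ah]])
  have hA0: "\<exists>x. h (A x) \<noteq> 0" by (rule lifting_nondeg[OF A h(1,2)])
  define D where "D = (\<lambda>x. \<Delta>1 x ^ (p + q))"
  have Dpf: "polynomial_fun D" unfolding D_def by (rule polynomial_fun_power[OF \<Delta>1(1)])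
  have fAh: "homogeneous (a * (p + q)) (\<lambda>x. f (A x) $ i)" for i by (rule homogeneous_compose[OF f_hom Ah])
  have fBh: "homogeneous (b * (p + q)) (\<lambda>x. f (B x) $ i)" for i by (rule homogeneous_compose[OF f_hom Bh])
  have eq: "h (A x) * \<Delta>2 x = D x * \<Delta> x" for x
  proof (rule polynomial_fun_cancel[OF Cpf[of 1] polynomial_fun_mult[OF hApf \<Delta>2(1)] polynomial_fun_mult[OF Dpf \<Delta>(1)]
        lifting_nonzero[OF C0]])
    fix x
    have "f (f (A x)) $ 1 = h (A x) * \<Delta>2 x * C0 x $ 1" by (simp add: h(4) \<Delta>2(2))
    moreover have "f (f (A x)) $ 1 = D x * \<Delta> x * C0 x $ 1"
      using homogeneous_scale[OF f_hom[of 1], of "\<Delta>1 x" "B x"] by (simp add: \<Delta>1(3) D_def \<Delta>(3))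
    ultimately show "C0 x $ 1 * (h (A x) * \<Delta>2 x) = C0 x $ 1 * (D x * \<Delta> x)"
      by (metis mult.commute)
  qed
  have not_curve: "\<not> maps_onto_curve g E k"
    if g: "\<And>i. poly_divides g (\<lambda>x. f (E x) $ i)" for g E k
  proof
    assume k: "maps_onto_curve g E k"
    then have "prime_fun k" "\<And>i. poly_divides k (\<lambda>x. f x $ i)"
      using g f_hom unfolding maps_onto_curve_def by blast+
    then show False using no_common_factor_prime[OF f_ncf] by blast
  qed
  have "poly_divides (\<lambda>x. h (A x)) \<Delta>"
  \<comment> \<open>The family of cofactors has the single member \<open>D\<close>, the power of
    \<Delta>1.\<close>
  proof (rule dvd_of_dvd_mult_coprime[where b = "\<lambda>_::unit. D", OF hApf hA0 Dpf _ \<Delta>(1)])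
    show "poly_divides (\<lambda>x. h (A x)) (\<lambda>x. D x * \<Delta> x)"
      by (rule poly_dividesI[OF \<Delta>2(1)]) (simp add: eq)
    fix g assume g: "prime_fun g" "poly_divides g (\<lambda>x. h (A x))"
    show "\<exists>i::unit. \<not> poly_divides g D"
    proof (rule ccontr)
      assume "\<not> ?thesis"
      then have "poly_divides g D" by blast
      then have "poly_divides g \<Delta>1" unfolding D_def by (rule prime_fun_dvd_power[OF g(1) \<Delta>1(1)])
      then have d: "poly_divides g (\<lambda>x. f (A x) $ i)" for i
        using poly_dvd_mult_right[OF _ homogeneous_imp_polynomial_fun[OF Bh[of i]]] by (simp add: \<Delta>1(3))
      obtain k where k: "homogeneous k g"
        using prime_factor_homogeneous[OF homogeneous_compose[OF h(1) Ah] hA0 g] by blast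
      have "maps_to_point g A 1" using orbit_dichotomy[OF g(1) k A] not_curve[OF d] by blast
      then show False using g(2) h(1,3) unfolding maps_to_point_def by blast
    qed
  qed
  then obtain u where u: "polynomial_fun u" "\<And>x. \<Delta> x = h (A x) * u x" using poly_dividesE by blast
  have \<Delta>2u: "\<Delta>2 x = D x * u x" for x
    by (rule polynomial_fun_cancel[OF hApf \<Delta>2(1) polynomial_fun_mult[OF Dpf u(1)] hA0])
       (simp only: eq, simp only: u(2) mult_ac)
  \<comment> \<open>A prime \<open>g\<close> dividing \<open>u\<close> divides both \<Delta> and
    \<Delta>2. From \<Delta>, \<open>f \<circ> B\<close> vanishes on \<open>g = 0\<close>, so
    \<open>B\<close> sends it to a point and, by the dichotomy, \<open>A\<close> sends it onto a
    curve \<open>h1\<close>. From \<Delta>2, the second iterate then vanishes along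
    \<open>h1\<close>, impossible for a lifting.\<close>
  have "\<exists>c. \<forall>x. u x = c"
  proof (rule ccontr)
    assume "\<not> ?thesis"
    then obtain g where g: "prime_fun g" "poly_divides g u" using prime_factor_exists[OF u(1)] by blast
    have "poly_divides g \<Delta>" using poly_dvd_mult_left[OF g(2) hApf] unfolding ext[of \<Delta>, OF u(2)] .
    then have d: "poly_divides g (\<lambda>x. f (B x) $ i)" for i
      using poly_dvd_mult_right[OF _ Cpf[of i]] by (simp add: \<Delta>(3))
    have "\<exists>x. f (B x) $ 1 \<noteq> 0"
      by (rule lifting_nondeg[OF B f_hom]) (use funpow_nonzero[of 1 1] in simp)
    then obtain k where k: "homogeneous k g" using prime_factor_homogeneous[OF fBh _ g(1) d] by blast
    obtain h1 where h1: "maps_onto_curve g A h1"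
      using orbit_dichotomy[OF g(1) k B] not_curve[OF d] A by blast
    have "poly_divides g \<Delta>2" using poly_dvd_mult_left[OF g(2) Dpf] unfolding ext[of \<Delta>2, OF \<Delta>2u] .
    then have "poly_divides g (\<lambda>x. iterate f 2 (A x) $ i)" for i
      using poly_dvd_mult_right[OF _ Cpf[of i]] by (simp add: \<Delta>2(2))
    then have "prime_fun h1" "\<And>i. poly_divides h1 (\<lambda>x. iterate f 2 x $ i)"
      using h1 F2h unfolding maps_onto_curve_def by blast+
    then show False using lifting_not_dvd[OF lifting_iterate] by blast
  qed
  then obtain w where w: "\<And>x. u x = w" by blast
  have w0: "w \<noteq> 0" using \<Delta>(2) u(2) w by auto
  \<comment> \<open>The recursion demands an equality, not one up to a constant, so the chosen
    lifting is rescaled.\<close>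
  define C where "C = (\<lambda>x. w *s C0 x)"
  have "h (A x) *s C x = f (B x)" for x by (simp add: C_def \<Delta>(3) u(2) w vector_smult_assoc)
  moreover have "lifting_of_iterate f (Suc (Suc n)) C"
    unfolding lifting_of_iterate_def lifting_def
  proof (intro conjI)
    show "\<exists>d. \<forall>i. homogeneous d (\<lambda>x. C x $ i)" using homogeneous_cmult[OF Ch(1), of w] by (auto simp: C_def)
    show "no_common_factor C"
    proof (rule no_common_factorI)
      fix g :: "complex ^ 3 \<Rightarrow> complex" assume g: "prime_fun g"
      then obtain i where "\<not> poly_divides g (\<lambda>x. C0 x $ i)" using no_common_factor_prime[OF Ch(2)] by blast
      then show "\<exists>i. \<not> poly_divides g (\<lambda>x. C x $ i)"
        using prime_fun_dvd_cmult[OF g Cpf w0] by (auto simp: C_def)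
    qed
    show "\<exists>h. polynomial_fun h \<and> (\<exists>x. h x \<noteq> 0) \<and> (\<forall>x. (f ^^ Suc (Suc n)) x = h x *s C x)"
    proof (intro exI[of _ "\<lambda>x. inverse w * hC x"] conjI allI)
      show "polynomial_fun (\<lambda>x. inverse w * hC x)" by (rule polynomial_fun_mult[OF polynomial_fun_const Ch(3)])
      show "\<exists>x. inverse w * hC x \<noteq> 0" using Ch(4) w0 by auto
      show "(f ^^ Suc (Suc n)) x = (inverse w * hC x) *s C x" for x
        unfolding Ch(5) C_def using w0 by (simp add: vector_smult_assoc)
    qed
  qed
  ultimately show ?thesis by blast
qed

text \<open>Each new lifting depends on its two predecessors, so dependent choice runs over pairs of
  consecutive liftings, starting from the identity and \<open>f\<close> itself. With delay 1 the
  denominator involves the lifting two steps back.\<close>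

lemma quasi_algebraically_stable: "quasi_algebraically_stable f"
proof -
  obtain h e where h: "homogeneous e h" "\<exists>x. h x \<noteq> 0" "h 1 \<noteq> 0" "\<And>x. f (f x) = h x *s iterate f 2 x"
    using second_iterate_factor by metis
  define I where "I = (\<lambda>n (A, B). lifting_of_iterate f n A \<and> lifting_of_iterate f (Suc n) B \<and> (n = 0 \<longrightarrow> A = id \<and> B = f))"
  have "\<exists>G. \<forall>n. I n (G n) \<and> fst (G (Suc n)) = snd (G n) \<and> (\<forall>x. h (fst (G n) x) *s snd (G (Suc n)) x = f (snd (G n) x))"
  proof (rule dependent_nat_choice)
    show "\<exists>x. I 0 x"
      using lifting_of_iterate_id lifting_of_iterate_1 by (intro exI[of _ "(id, f)"]) (simp add: I_def)
    fix X n assume "I n X"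
    then obtain A B where AB: "X = (A, B)" "lifting_of_iterate f n A" "lifting_of_iterate f (Suc n) B"
      unfolding I_def by (cases X) auto
    then obtain C where "lifting_of_iterate f (Suc (Suc n)) C" "\<And>x. h (A x) *s C x = f (B x)"
      using next_lifting[OF h] by blast
    then show "\<exists>Y. I (Suc n) Y \<and> fst Y = snd X \<and> (\<forall>x. h (fst X x) *s snd Y x = f (snd X x))"
      using AB by (intro exI[of _ "(B, C)"]) (simp add: I_def)
  qed
  then obtain G where G: "\<And>n. I n (G n)" "\<And>n. fst (G (Suc n)) = snd (G n)"
      "\<And>n x. h (fst (G n) x) *s snd (G (Suc n)) x = f (snd (G n) x)" by blast
  define F where "F = (\<lambda>n. fst (G n))"
  have F: "lifting_of_iterate f n (F n)" for n using G(1)[of n] by (auto simp: I_def F_def)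
  have F01: "F 0 = id" "F 1 = f" using G(1)[of 0] G(2)[of 0] by (auto simp: I_def F_def split: prod.splits)
  have rec: "h (F n x) *s F (Suc (Suc n)) x = f (F (Suc n) x)" for n x
    using G(3)[of n x] G(2)[of n] G(2)[of "Suc n"] by (simp add: F_def)
  show ?thesis
    unfolding quasi_algebraically_stable_def
  proof (rule exI[of _ "1::nat"], rule exI[of _ e], rule exI[of _ h], rule exI[of _ F], intro conjI ballI allI impI)
    show "F n = F 1 \<circ> F (n - 1)" if "n \<in> {1..1}" for n using that F01 by auto
    show "\<exists>x. h (F (n - 1 - 1) x) \<noteq> 0" for n
      by (rule lifting_nondeg[OF F[of "n - 1 - 1"] h(1,2)])
    show "h (F (n - 1 - 1) x) *s F n x = F 1 (F (n - 1) x)" if "n > 1" for n x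
    proof -
      define k where "k = n - 2"
      then have "n = Suc (Suc k)" using \<open>n > 1\<close> by simp
      then show ?thesis using rec[of k x] F01(2) by simp
    qed
  qed (use F F01 h(1) in simp_all)
qed

end

theorem proposition4p5:
  fixes P Q1 Q2 Q3 R :: "complex ^ 3 \<Rightarrow> complex"
    and p q :: nat
    and f :: "complex ^ 3 \<Rightarrow> complex ^ 3"
  assumes "homogeneous p P" and "p \<ge> 1"
    and "homogeneous q Q1" and "homogeneous q Q2" and "homogeneous q Q3"
    and "homogeneous (p + q) R"
    and "P (vector [1, 1, 1]) * Q1 (vector [1, 1, 1]) = R (vector [1, 1, 1])"
    and "P (vector [1, 1, 1]) * Q2 (vector [1, 1, 1]) = R (vector [1, 1, 1])"
    and "P (vector [1, 1, 1]) * Q3 (vector [1, 1, 1]) = R (vector [1, 1, 1])"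
    and "R (vector [1, 1, 1]) \<noteq> 0"
    and "f = (\<lambda>x. vector [P x * Q1 x - R x, P x * Q2 x - R x, P x * Q3 x - R x])"
    and "no_common_factor f"
    and "dominant f"
    and a: "\<And>a b c C. (a, b, c) \<noteq> (0, 0, 0) \<Longrightarrow> a + b + c = 0 \<Longrightarrow>
          irreducible_component C (zero_locus {\<lambda>x. a * Q1 x + b * Q2 x + c * Q3 x}) \<Longrightarrow>
          hypersurface (iter_image f 1 C)"
    and b: "\<And>C. irreducible_component C (zero_locus {P}) \<Longrightarrow> hypersurface (iter_image f 2 C)"
    and c: "\<And>G. irreducible_algebraic G \<Longrightarrow> hypersurface G \<Longrightarrow>
          iter_image f 1 G = {pt (vector [1, 1, 1])} \<Longrightarrow> G \<subseteq> zero_locus {P}"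
  shows "(\<exists>H\<^sub>0. primitive_system f {H\<^sub>0}) \<and>
    (\<forall>S. primitive_system f S \<longrightarrow>
      (\<exists>H\<^sub>0. S = {H\<^sub>0} \<and>
        (\<forall>H. irreducible_component H H\<^sub>0 \<longrightarrow>
          (\<forall>m\<in>{1..height f H\<^sub>0}. \<not> iter_image f m H \<subseteq> H\<^sub>0)) \<and>
        (\<forall>H. irreducible_component H H\<^sub>0 \<longrightarrow>
          (\<forall>m\<ge>height f H\<^sub>0 + 1. \<not> iter_image f m H \<subseteq> indeterminacy f) \<or>
          (\<exists>m\<^sub>0\<ge>height f H\<^sub>0. hypersurface (iter_image f (m\<^sub>0 + 1) H) \<and>
             (\<forall>m\<in>{height f H\<^sub>0 + 1..m\<^sub>0}. \<not> iter_image f m H \<subseteq> indeterminacy f))))) \<and>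
    quasi_algebraically_stable f"
proof -
  have e: "(vector [1, 1, 1] :: complex ^ 3) = 1" by (simp add: vec_eq_iff forall_3)
  define Q :: "complex ^ 3 \<Rightarrow> complex ^ 3" where "Q = (\<lambda>x. vector [Q1 x, Q2 x, Q3 x])"
  have Q: "Q x $ 1 = Q1 x" "Q x $ 2 = Q2 x" "Q x $ 3 = Q3 x" for x by (simp_all add: Q_def)
  interpret collapsing_map P R Q p q f
  proof
    show "homogeneous p P" "1 \<le> p" "homogeneous (p + q) R" "R 1 \<noteq> 0" "no_common_factor f" "dominant f"
      using assms e by simp_all
    have "\<forall>i. homogeneous q (\<lambda>x. Q x $ i)" using assms(3-5) by (simp add: forall_3 Q)
    then show "homogeneous q (\<lambda>x. Q x $ i)" for i by blast
    have "\<forall>i. P 1 * Q 1 $ i = R 1" using assms(7-9) e by (simp add: forall_3 Q)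
    then show "P 1 * Q 1 $ i = R 1" for i by blast
    have "\<forall>i. f x $ i = P x * Q x $ i - R x" for x by (simp add: forall_3 Q assms(11))
    then show "f x $ i = P x * Q x $ i - R x" for x i by blast
    show "hypersurface (iter_image f 1 C)"
      if "v \<noteq> 0" "(\<Sum>i\<in>UNIV. v $ i) = 0" "irreducible_component C (zero_locus {\<lambda>x. \<Sum>i\<in>UNIV. v $ i * Q x $ i})"
      for v :: "complex ^ 3" and C
    proof (rule a[of "v $ 1" "v $ 2" "v $ 3"])
      show "(v $ 1, v $ 2, v $ 3) \<noteq> (0, 0, 0)" using that(1) by (auto simp: vec_eq_iff forall_3)
    qed (use that in \<open>simp_all add: sum_3 Q\<close>)
    show "hypersurface (iter_image f 2 C)" if "irreducible_component C (zero_locus {P})" for C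
      using b that by blast
    show "G \<subseteq> zero_locus {P}"
      if "irreducible_algebraic G" "hypersurface G" "iter_image f 1 G = {pt 1}" for G
      using c that e by simp
  qed
  have "\<exists>H\<^sub>0. S = {H\<^sub>0} \<and>
        (\<forall>H. irreducible_component H H\<^sub>0 \<longrightarrow>
          (\<forall>m\<in>{1..height f H\<^sub>0}. \<not> iter_image f m H \<subseteq> H\<^sub>0)) \<and>
        (\<forall>H. irreducible_component H H\<^sub>0 \<longrightarrow>
          (\<forall>m\<ge>height f H\<^sub>0 + 1. \<not> iter_image f m H \<subseteq> indeterminacy f) \<or>
          (\<exists>m\<^sub>0\<ge>height f H\<^sub>0. hypersurface (iter_image f (m\<^sub>0 + 1) H) \<and>
             (\<forall>m\<in>{height f H\<^sub>0 + 1..m\<^sub>0}. \<not> iter_image f m H \<subseteq> indeterminacy f)))"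
    if S: "primitive_system f S" for S
  proof -
    obtain K where K: "S = {K}" "K \<subseteq> zero_locus {P}" "hypersurface K" using primitive_system_unique[OF S] by blast
    have ht: "height f K = 1" by (rule height_in_P[OF K(2)])
    \<comment> \<open>As the height is 1, (ii) concerns only the first image, which is this
      point.\<close>
    have "pt 1 \<notin> K" using K(2) pt_in_zero_locus_single[OF P(1) one_neq_0] P1 by blast
    then have "\<not> iter_image f 1 H \<subseteq> K" if "irreducible_component H K" for H
      using component_in_P[OF K(3,2) that] by simp
    \<comment> \<open>In (iii) the second alternative holds with \<open>m\<^sub>0 = 1\<close>: by
      (b) the second image is a curve, and the range of \<open>m\<close> from 2 to 1 is
      empty.\<close>
    moreover have "hypersurface (iter_image f (1 + 1) H)" if "irreducible_component H K" for H
      using component_in_P[OF K(3,2) that] P_image unfolding one_add_one by blast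
    ultimately show ?thesis
      using K(1) ht by (intro exI[of _ K] conjI allI impI disjI2 exI[of _ "1::nat"]) auto
  qed
  then show ?thesis using primitive_system_P quasi_algebraically_stable by blast
qed

end
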